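(* Let $\alpha>0$, $\ell\in\mathbb{N}$ and $b\in H^{\infty,\ell}_\alpha$. Then $\mathfrak{h}^{\ell}_{b,\alpha}\in\mathcal{S}_2(F^{2,\ell}_\alpha)$ if and only if $b\in F^{2,\ell}_{\alpha/2,\Delta}$. Moreover, $$\|\mathfrak{h}^{\ell}_{b,\alpha}\|_{\mathcal{S}_2(F^{2,\ell}_\alpha)}\simeq\|b\|_{F^{2,\ell}_{\alpha/2,\Delta}}.$$
   Context: $\mathbb{N}=\{1,2,3,\dots\}$, $\nu$ is Lebesgue measure on $\mathbb{C}$, $H(\mathbb{C})$ is the space of entire functions. For $\alpha>0$ and $\ell\in\mathbb{N}$, $L^{2,\ell}_\alpha$ is the Hilbert space of measurable $f$ on $\mathbb{C}$ with $\|f\|_{L^{2,\ell}_\alpha}^2=\int_{\mathbb{C}}|f(z)|^2e^{-\alpha|z|^{2\ell}}d\nu(z)<\infty$, with inner product $\langle f,g\rangle^\ell_\alpha=\int_{\mathbb{C}}f\overline{g}\,e^{-\alpha|z|^{2\ell}}d\nu(z)$, and $F^{2,\ell}_\alpha:=H(\mathbb{C})\cap L^{2,\ell}_\alpha$. $\overline{F^{2,\ell}_\alpha}:=\{\overline f:f\in F^{2,\ell}_\alpha\}$. $F^{2,\ell}_{\alpha,\Delta}$ is the space of $f\in H(\mathbb{C})$ with $\|f\|^2_{F^{2,\ell}_{\alpha,\Delta}}:=\int_{\mathbb{C}}|f(z)e^{-\frac{\alpha}{2}|z|^{2\ell}}|^2(1+|z|)^{2(\ell-1)}d\nu(z)<\infty$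 (used in the statement with $\alpha/2$ in place of $\alpha$). $H^{\infty,\ell}_\alpha:=\{b\in H(\mathbb{C}):|b(z)|=O((1+|z|)^{2\ell-2}e^{\alpha|z|^{2\ell}/2})\}$. $E:=\{f\in H(\mathbb{C}):|f(z)|=O(e^{\beta|z|^\ell})\text{ for some }\beta>0\}$, a dense subspace of $F^{2,\ell}_\alpha$ containing the holomorphic polynomials. $K^\ell_\alpha(z,w)=\frac{\ell\alpha^{1/\ell}}{\pi}\sum_{m=0}^\infty\frac{\alpha^{m/\ell}z^m\overline{w}^m}{\Gamma((m+1)/\ell)}$ is the Bergman kernel of $F^{2,\ell}_\alpha$. For $b\in H^{\infty,\ell}_\alpha$, the small Hankel operator is defined on $f\in E$ by $$\mathfrak{h}^{\ell}_{b,\alpha}(f)(z):=\int_{\mathbb{C}}K^\ell_\alpha(w,z)f(w)\overline{b(w)}e^{-\alpha|w|^{2\ell}}\,d\nu(w).$$ $\mathcal{S}_2(F^{2,\ell}_\alpha)$ is the class of Hilbert–Schmidt operators from $F^{2,\ell}_\alpha$ to $\overline{F^{2,\ell}_\alpha}$ with the Hilbert–Schmidt norm, $\|T\|^2_{\mathcal{S}_2(F^{2,\ell}_\alpha)}=\sum_m\|Te_m\|^2_{L^{2,\ell}_\alpha}$ for an orthonormal basis $\{e_m\}$ of $F^{2,\ell}_\alpha$; $\mathfrak{h}^{\ell}_{b,\alpha}\in\mathcal{S}_2(F^{2,\ell}_\alpha)$ means that the operator defined on $E$ extends to such an operator. $A\simeq B$ means $C^{-1}B\le A\le CB$ with a constant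 $C>0$ independent of $b$. *)

theory Defs
  imports "HOL-Complex_Analysis.Complex_Analysis"
begin

text \<open>
  Lebesgue measure on the complex plane is \<open>lborel\<close>.  All spaces below are sets of genuine
  functions; no passage to almost-everywhere classes is needed for spaces of entire functions
  and of their conjugates.
\<close>

definition L2_space :: "real \<Rightarrow> nat \<Rightarrow> (complex \<Rightarrow> complex) set" where
  "L2_space \<alpha> l = {f \<in> borel_measurable lborel.
     integrable lborel (\<lambda>z. (cmod (f z))\<^sup>2 * exp (- \<alpha> * cmod z ^ (2 * l)))}"

definition L2_inner ::
  "real \<Rightarrow> nat \<Rightarrow> (complex \<Rightarrow> complex) \<Rightarrow> (complex \<Rightarrow> complex) \<Rightarrow> complex" where
  "L2_inner \<alpha> l f g =
     (\<integral>z. f z * cnj (g z) * of_real (exp (- \<alpha> * cmod z ^ (2 * l))) \<partial>lborel)"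

definition L2_norm :: "real \<Rightarrow> nat \<Rightarrow> (complex \<Rightarrow> complex) \<Rightarrow> real" where
  "L2_norm \<alpha> l f = sqrt (\<integral>z. (cmod (f z))\<^sup>2 * exp (- \<alpha> * cmod z ^ (2 * l)) \<partial>lborel)"

definition Fock :: "real \<Rightarrow> nat \<Rightarrow> (complex \<Rightarrow> complex) set" where
  "Fock \<alpha> l = {f. f holomorphic_on UNIV} \<inter> L2_space \<alpha> l"

definition cnj_Fock :: "real \<Rightarrow> nat \<Rightarrow> (complex \<Rightarrow> complex) set" where
  "cnj_Fock \<alpha> l = {(\<lambda>z. cnj (f z)) | f. f \<in> Fock \<alpha> l}"

definition Fock_Delta :: "real \<Rightarrow> nat \<Rightarrow> (complex \<Rightarrow> complex) set" where
  "Fock_Delta \<alpha> l = {f. f holomorphic_on UNIV \<and>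
     integrable lborel
       (\<lambda>z. (cmod (f z * of_real (exp (- (\<alpha> / 2) * cmod z ^ (2 * l)))))\<^sup>2
             * (1 + cmod z) ^ (2 * (l - 1)))}"

definition Fock_Delta_norm :: "real \<Rightarrow> nat \<Rightarrow> (complex \<Rightarrow> complex) \<Rightarrow> real" where
  "Fock_Delta_norm \<alpha> l f = sqrt (\<integral>z.
     (cmod (f z * of_real (exp (- (\<alpha> / 2) * cmod z ^ (2 * l)))))\<^sup>2
        * (1 + cmod z) ^ (2 * (l - 1)) \<partial>lborel)"

definition H_infty :: "real \<Rightarrow> nat \<Rightarrow> (complex \<Rightarrow> complex) set" where
  "H_infty \<alpha> l = {b. b holomorphic_on UNIV \<and>
     (\<exists>C. \<forall>z. cmod (b z) \<le> C * ((1 + cmod z) ^ (2 * l - 2) * exp (\<alpha> * cmod z ^ (2 * l) / 2)))}"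

definition E_space :: "nat \<Rightarrow> (complex \<Rightarrow> complex) set" where
  "E_space l = {f. f holomorphic_on UNIV \<and>
     (\<exists>\<beta>>0. \<exists>C. \<forall>z. cmod (f z) \<le> C * exp (\<beta> * cmod z ^ l))}"

definition Bergman_kernel :: "real \<Rightarrow> nat \<Rightarrow> complex \<Rightarrow> complex \<Rightarrow> complex" where
  "Bergman_kernel \<alpha> l z w =
     of_real (real l * \<alpha> powr (1 / real l) / pi) *
     (\<Sum>m. of_real (\<alpha> powr (real m / real l)) * z ^ m * cnj w ^ m
            / of_real (Gamma (real (m + 1) / real l)))"

definition small_Hankel ::
  "real \<Rightarrow> nat \<Rightarrow> (complex \<Rightarrow> complex) \<Rightarrow> (complex \<Rightarrow> complex) \<Rightarrow> complex \<Rightarrow> complex" where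
  "small_Hankel \<alpha> l b f z =
     (\<integral>w. Bergman_kernel \<alpha> l w z * f w * cnj (b w)
            * of_real (exp (- \<alpha> * cmod w ^ (2 * l))) \<partial>lborel)"

text \<open>
  The Fock space is separable and infinite-dimensional, so its orthonormal bases are indexed
  by the natural numbers.
\<close>

definition Fock_onb :: "real \<Rightarrow> nat \<Rightarrow> (nat \<Rightarrow> complex \<Rightarrow> complex) \<Rightarrow> bool" where
  "Fock_onb \<alpha> l e \<longleftrightarrow>
     (\<forall>m. e m \<in> Fock \<alpha> l) \<and>
     (\<forall>m n. L2_inner \<alpha> l (e m) (e n) = (if m = n then 1 else 0)) \<and>
     (\<forall>f\<in>Fock \<alpha> l.
        (\<lambda>N. L2_norm \<alpha> l (\<lambda>z. f z - (\<Sum>m<N. L2_inner \<alpha> l f (e m) * e m z))) \<longlonglongrightarrow> 0)"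

text \<open>
  An operator from the Fock space to its conjugate is a map on all functions; only its values
  on the Fock space matter.
\<close>

definition Fock_bounded_op ::
  "real \<Rightarrow> nat \<Rightarrow> ((complex \<Rightarrow> complex) \<Rightarrow> (complex \<Rightarrow> complex)) \<Rightarrow> bool" where
  "Fock_bounded_op \<alpha> l T \<longleftrightarrow>
     (\<forall>f\<in>Fock \<alpha> l. T f \<in> cnj_Fock \<alpha> l) \<and>
     (\<forall>f\<in>Fock \<alpha> l. \<forall>g\<in>Fock \<alpha> l. T (\<lambda>z. f z + g z) = (\<lambda>z. T f z + T g z)) \<and>
     (\<forall>f\<in>Fock \<alpha> l. \<forall>c. T (\<lambda>z. c * f z) = (\<lambda>z. c * T f z)) \<and>
     (\<exists>C. \<forall>f\<in>Fock \<alpha> l. L2_norm \<alpha> l (T f) \<le> C * L2_norm \<alpha> l f)"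

definition hilbert_schmidt ::
  "real \<Rightarrow> nat \<Rightarrow> ((complex \<Rightarrow> complex) \<Rightarrow> (complex \<Rightarrow> complex)) \<Rightarrow> bool" where
  "hilbert_schmidt \<alpha> l T \<longleftrightarrow> Fock_bounded_op \<alpha> l T \<and>
     (\<exists>e. Fock_onb \<alpha> l e \<and> summable (\<lambda>m. (L2_norm \<alpha> l (T (e m)))\<^sup>2))"

text \<open>
  The sum does not depend on the orthonormal basis, so the norm is computed in an
  arbitrarily chosen one.
\<close>

definition hilbert_schmidt_norm ::
  "real \<Rightarrow> nat \<Rightarrow> ((complex \<Rightarrow> complex) \<Rightarrow> (complex \<Rightarrow> complex)) \<Rightarrow> real" where
  "hilbert_schmidt_norm \<alpha> l T =
     sqrt (\<Sum>m. (L2_norm \<alpha> l (T ((SOME e. Fock_onb \<alpha> l e) m)))\<^sup>2)"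

text \<open>
  An operator \<open>h\<close> given on the dense subspace \<open>E_space\<close> is Hilbert-Schmidt if some
  Hilbert-Schmidt operator extends it.  By density that extension is unique on the Fock space,
  and its norm is the norm of \<open>h\<close>.
\<close>

definition S2_extension ::
  "real \<Rightarrow> nat \<Rightarrow> ((complex \<Rightarrow> complex) \<Rightarrow> (complex \<Rightarrow> complex)) \<Rightarrow>
     ((complex \<Rightarrow> complex) \<Rightarrow> (complex \<Rightarrow> complex)) \<Rightarrow> bool" where
  "S2_extension \<alpha> l h T \<longleftrightarrow> hilbert_schmidt \<alpha> l T \<and> (\<forall>f\<in>E_space l. T f = h f)"

definition S2_class ::
  "real \<Rightarrow> nat \<Rightarrow> ((complex \<Rightarrow> complex) \<Rightarrow> (complex \<Rightarrow> complex)) set" where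
  "S2_class \<alpha> l = {h. \<exists>T. S2_extension \<alpha> l h T}"

definition S2_norm ::
  "real \<Rightarrow> nat \<Rightarrow> ((complex \<Rightarrow> complex) \<Rightarrow> (complex \<Rightarrow> complex)) \<Rightarrow> real" where
  "S2_norm \<alpha> l h = hilbert_schmidt_norm \<alpha> l (SOME T. S2_extension \<alpha> l h T)"

end

theory Submission
  imports Defs
begin

text \<open>
  Monomials are orthogonal for every radial weight, so for an entire \<open>b\<close> with Taylor
  coefficients \<open>\<beta> k\<close> the squared norm of \<open>b\<close> in a radially weighted space is a weighted sum of
  the \<open>\<bar>\<beta> k\<bar>\<^sup>2\<close> (\<open>parseval_entire\<close>). Write \<open>N k\<close> for the squared norm of \<open>z ^ k\<close> in the Fock
  space (\<open>moment\<close>). In the basis of normalized monomials the small Hankel operator is a weighted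
  Hankel matrix: up to conjugation its \<open>(m, n)\<close> entry is
  \<open>\<beta> (m + n) * N (m + n) / sqrt (N m * N n)\<close>. Summing squares along antidiagonals, its squared
  Hilbert-Schmidt norm is \<open>\<Sum>k. \<bar>\<beta> k\<bar>\<^sup>2 * W k\<close> with \<open>W k = (\<Sum>m\<le>k. (N k)\<^sup>2 / (N m * N (k - m)))\<close>.
  The squared norm of \<open>b\<close> in the space with weight
  \<open>exp (- (\<alpha> / 2) * r ^ (2 * l)) * (1 + r) ^ (2 * (l - 1))\<close> is \<open>\<Sum>k. \<bar>\<beta> k\<bar>\<^sup>2 * D k\<close>, where \<open>D k\<close>
  is the corresponding squared norm of \<open>z ^ k\<close>. The whole theorem therefore comes down to \<open>W k\<close>
  and \<open>D k\<close> being comparable (\<open>hankel_coeff_weight_comparable\<close>).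

  Both weights are explicit. Up to common factors, \<open>D k\<close> is comparable to
  \<open>2 powr (k / l) * Gamma ((k + l) / l)\<close>, while \<open>W k\<close> is \<open>Gamma ((k + 1) / l)\<^sup>2\<close> times the sum
  of \<open>1 / (Gamma (i / l) * Gamma (j / l))\<close> over \<open>i + j = k + 2\<close>. For \<open>l = 1\<close> the latter is a sum
  of binomial coefficients divided by a factorial, and \<open>2 ^ k\<close> comes from Pascal's rule.
  Pascal's rule survives for all \<open>l\<close>: with \<open>r = 1 / Gamma\<close>, the functional equation gives
  \<open>(x + y - 2) * r x * r y = r (x - 1) * r y + r x * r (y - 1)\<close>. Summed along an antidiagonal it
  relates the sums for \<open>k + l\<close> and \<open>k\<close> up to boundary terms of constant sign, so the convolution
  is squeezed between multiples of the exact solution of the recursion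
  (\<open>rGamma_convolution_asymp\<close>). Logarithmic convexity of \<open>Gamma\<close> matches the remaining Gamma
  factors (\<open>Gamma_square_comparison\<close>).

  The rest justifies the matrix computation. Growth of the kernel is controlled by the crude
  bound \<open>R ^ (2 * m) * J R \<le> N m\<close>, valid for every radius \<open>R\<close> with a factor \<open>J R\<close> that is
  independent of \<open>m\<close> (\<open>moment_lower_bound\<close>); this is enough to integrate the kernel series term
  by term (\<open>small_Hankel_sums\<close>). If the entries are square summable, Cauchy-Schwarz row by row
  makes the integral formula itself a bounded operator on the whole Fock space
  (\<open>small_Hankel_bounded_op\<close>), so that it is the required extension. Conversely any
  Hilbert-Schmidt extension agrees with the integral formula on monomials, and its
  Hilbert-Schmidt sum may be computed in that basis (\<open>hilbert_schmidt_sum_basis_independent\<close>).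
\<close>

section \<open>Rotations and radial integrals in the plane\<close>

text \<open>
  By Vitali's covering theorem an open set is, up to a null set, a disjoint union of balls, and
  a rotation maps balls to balls of the same measure. Applied to the inverse rotation as well,
  the inequality becomes an equality on open sets.
\<close>

lemma emeasure_open_le_rotated:
  fixes c :: complex
  assumes c: "cmod c = 1" and U: "open U"
  shows "emeasure lborel U \<le> emeasure lborel ((*) c ` U)"
proof -
  \<comment> \<open>The Vitali family: all balls inside the set.\<close>
  define K where "K = {(x, r). 0 < r \<and> ball x r \<subseteq> U}"
  have c0: "c \<noteq> 0" using c by auto
  have img: "(*) c ` ball x r = ball (c * x) r" for x r
  proof -
    have "dist (c * x) (c * y) = dist x y" for y
      by (simp add: dist_norm norm_mult c flip: right_diff_distrib)
    moreover have "y = c * (y / c)" for y using c0 by simp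
    ultimately show ?thesis
      unfolding set_eq_iff image_iff mem_ball Bex_def by metis
  qed
  have "\<exists>i. i \<in> K \<and> x \<in> ball (fst i) (snd i) \<and> snd i < d" if "x \<in> U" "0 < d" for x d
  proof -
    obtain e where e: "e > 0" "ball x e \<subseteq> U" using U \<open>x \<in> U\<close> openE by blast
    have "ball x (min e (d/2)) \<subseteq> U" using e by auto
    then show ?thesis using e that
      by (intro exI[of _ "(x, min e (d/2))"]) (auto simp: K_def)
  qed
  then obtain C where C: "countable C" "C \<subseteq> K"
     and dis: "pairwise (\<lambda>i j. disjnt (ball (fst i) (snd i)) (ball (fst j) (snd j))) C"
     and neg: "negligible (U - (\<Union>i \<in> C. ball (fst i) (snd i)))"
    using Vitali_covering_theorem_balls[of U K fst snd] by blast
  let ?B = "\<lambda>i. ball (fst i) (snd i) :: complex set"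
  let ?V = "\<Union>i\<in>C. ?B i"
  have VU: "?V \<subseteq> U" using C by (fastforce simp: K_def)
  have disj: "disjoint_family_on ?B C"
    using dis by (auto simp: disjoint_family_on_def pairwise_def disjnt_def)
  have disj': "disjoint_family_on (\<lambda>i. (*) c ` ?B i) C"
  proof -
    have "inj ((*) c)" using c0 by (simp add: inj_on_def)
    then show ?thesis using disj unfolding disjoint_family_on_def
      by (metis image_Int image_empty)
  qed
  have [measurable]: "U \<in> sets borel" "?V \<in> sets borel"
    using U by (auto intro!: borel_open)
  have "emeasure lborel U = emeasure lborel ?V + emeasure lborel (U - ?V)"
    using VU by (subst plus_emeasure) (auto intro!: arg_cong[where f="emeasure lborel"])
  also have "emeasure lborel (U - ?V) = 0"
  proof -
    have "U - ?V \<in> null_sets lebesgue" using neg by (simp add: negligible_iff_null_sets)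
    then have "emeasure lebesgue (U - ?V) = 0" by blast
    then show ?thesis by simp
  qed
  also have "emeasure lborel ?V = (\<integral>\<^sup>+i. emeasure lborel (?B i) \<partial>count_space C)"
    using C disj by (intro emeasure_UN_countable) auto
  also have "\<dots> = (\<integral>\<^sup>+i. emeasure lborel ((*) c ` ?B i) \<partial>count_space C)"
    using C by (intro nn_integral_cong) (auto simp: img emeasure_ball K_def split: prod.splits)
  also have "\<dots> = emeasure lborel (\<Union>i\<in>C. (*) c ` ?B i)"
    using C disj' by (intro emeasure_UN_countable[symmetric]) (auto simp: img)
  also have "\<dots> \<le> emeasure lborel ((*) c ` U)"
  proof (rule emeasure_mono)
    have "z = c * (z / c)" for z using c0 by simp
    then have "(*) c ` U = (\<lambda>z. z / c) -` U" using c0 unfolding set_eq_iff image_iff vimage_def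
      by (metis (no_types, lifting) mem_Collect_eq nonzero_mult_div_cancel_left)
    moreover have "open ((\<lambda>z. z / c) -` U)" 
      using U c0 by (intro open_vimage continuous_intros) auto
    ultimately show "(*) c ` U \<in> sets lborel" by simp
  qed (use VU in blast)
  finally show ?thesis by simp
qed

lemma distr_lborel_rotation:
  fixes c :: complex
  assumes c: "cmod c = 1"
  shows "distr lborel borel ((*) c) = lborel"
proof (rule lborel_eqI[symmetric])
  fix l u :: complex assume lu: "\<And>b. b \<in> Basis \<Longrightarrow> l \<bullet> b \<le> u \<bullet> b"
  have c0: "c \<noteq> 0" using c by auto
  have ci: "cmod (inverse c) = 1" using c by (simp add: norm_inverse)
  have pre: "(*) c -` box l u = (*) (inverse c) ` box l u"
    using c0 by (auto simp: image_iff field_simps)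
  have "open ((*) (inverse c) ` box l u)"
    unfolding pre[symmetric] by (intro open_vimage continuous_intros open_box)
  from emeasure_open_le_rotated[OF c this] 
  have "emeasure lborel ((*) (inverse c) ` box l u) \<le> emeasure lborel (box l u)"
    using c0 by (simp add: image_image flip: mult.assoc)
  with emeasure_open_le_rotated[OF ci open_box[of l u]]
  have "emeasure lborel ((*) (inverse c) ` box l u) = emeasure lborel (box l u)" by simp
  then show "emeasure (distr lborel borel ((*) c)) (box l u) = (\<Prod>b\<in>Basis. (u - l) \<bullet> b)"
    using lu by (simp add: emeasure_distr pre emeasure_lborel_box)
qed simp

lemma integral_rotation:
  fixes c :: complex and f :: "complex \<Rightarrow> complex"
  assumes c: "cmod c = 1" and f: "f \<in> borel_measurable borel"
  shows "(\<integral>z. f (c * z) \<partial>lborel) = (\<integral>z. f z \<partial>lborel)"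
proof -
  have "(\<integral>z. f z \<partial>lborel) = (\<integral>z. f z \<partial>(distr lborel borel ((*) c)))"
    by (simp add: distr_lborel_rotation[OF c])
  also have "\<dots> = (\<integral>z. f (c * z) \<partial>lborel)"
    using f by (subst integral_distr) auto
  finally show ?thesis by simp
qed

text \<open>
  The rotation by \<open>pi / (n - j)\<close> changes the sign of the integrand.
\<close>

lemma monomials_orthogonal_radial:
  fixes \<phi> :: "real \<Rightarrow> real"
  assumes ne: "n \<noteq> j" and [measurable]: "\<phi> \<in> borel_measurable borel"
  shows "(\<integral>z. z ^ n * cnj (z ^ j) * of_real (\<phi> (cmod z)) \<partial>lborel) = 0"
proof -
  define t where "t = pi / (real n - real j)"
  define f where "f = (\<lambda>z. z ^ n * cnj (z ^ j) * complex_of_real (\<phi> (cmod z)))"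
  have [measurable]: "f \<in> borel_measurable borel"
    unfolding f_def by (intro borel_measurable_times measurable_compose[OF _ borel_measurable_of_real]) 
      (auto intro!: borel_measurable_continuous_onI continuous_intros)
  have fm: "f \<in> borel_measurable borel" by measurable
  have "cis t ^ n * cnj (cis t) ^ j = cis ((real n - real j) * t)"
    by (simp add: Complex.DeMoivre cis_cnj cis_mult algebra_simps)
  also have "\<dots> = -1" using ne by (simp add: t_def)
  finally have m1: "cis t ^ n * cnj (cis t) ^ j = -1" .
  have "f (cis t * z) = - f z" for z
  proof -
    have "f (cis t * z) = (cis t ^ n * cnj (cis t) ^ j) * f z"
      by (simp add: f_def norm_mult power_mult_distrib mult_ac)
    then show ?thesis by (simp add: m1)
  qed
  \<comment> \<open>If the integrand is not integrable, both sides are 0 by convention and the identity still holds.\<close>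
  then have "(\<integral>z. f z \<partial>lborel) = - (\<integral>z. f z \<partial>lborel)"
    using integral_rotation[of "cis t" f] fm by simp
  then have "(\<integral>z. f z \<partial>lborel) = 0"
    by (metis add.inverse_inverse add_eq_0_iff mult_2 mult_eq_0_iff zero_neq_numeral)
  then show ?thesis by (simp add: f_def)
qed

text \<open>
  The function \<open>\<psi> z = \<alpha> * cmod z ^ (2 * l)\<close> pushes planar measure forward to a measure on the
  half line which the areas of discs determine: it has a power of \<open>s\<close> as density. Along \<open>\<psi>\<close> the
  integral is Euler's integral.
\<close>

lemma nn_integral_radial_power:
  fixes \<alpha> :: real and l k :: nat
  assumes "\<alpha> > 0" and "l \<ge> 1"
  shows "(\<integral>\<^sup>+z. ennreal (cmod z ^ (2 * k) * exp (- \<alpha> * cmod z ^ (2 * l))) \<partial>lborel)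
     = ennreal (pi / real l * \<alpha> powr (- (real (k + 1) / real l)) * Gamma (real (k + 1) / real l))"
proof -
  define \<psi> where "\<psi> = (\<lambda>z::complex. \<alpha> * cmod z ^ (2 * l))"
  define c where "c = pi / real l * \<alpha> powr (- (1 / real l))"
  define d where "d = (\<lambda>s::real. indicator {0..} s * (c * s powr (1 / real l - 1)))"
  define M where "M = density lborel (\<lambda>s. ennreal (d s))"
  have l0: "real l > 0" using assms by simp
  have c0: "c > 0" using assms by (simp add: c_def)
  have [measurable]: "\<psi> \<in> borel_measurable borel" "d \<in> borel_measurable borel"
    by (simp_all add: \<psi>_def d_def)
  have d0: "d s \<ge> 0" for s using c0 by (simp add: d_def)
  have em_M: "emeasure M {..s} = ennreal (if s \<ge> 0 then pi * (s / \<alpha>) powr (1 / real l) else 0)" for s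
  proof (cases "s \<ge> 0")
    case True
    have hi: "((\<lambda>x. x powr (1 / real l - 1)) has_integral (s powr (1 / real l) / (1 / real l))) {0..s}"
      using has_integral_powr_from_0[of "1 / real l - 1" s] True l0 by simp
    have "emeasure M {..s} = (\<integral>\<^sup>+x. ennreal (d x) * indicator {..s} x \<partial>lborel)"
      unfolding M_def by (intro emeasure_density) auto
    also have "\<dots> = (\<integral>\<^sup>+x. ennreal (c * (x powr (1 / real l - 1))) * indicator {0..s} x \<partial>lborel)"
      by (intro nn_integral_cong) (auto simp: d_def split: split_indicator)
    also have "\<dots> = ennreal (c * (s powr (1 / real l) / (1 / real l)))"
      using c0 by (intro nn_integral_has_integral_lebesgue' has_integral_mult_right hi) auto
    also have "c * (s powr (1 / real l) / (1 / real l)) = pi * (s / \<alpha>) powr (1 / real l)"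
      using True assms by (simp add: c_def powr_divide powr_minus field_simps)
    finally show ?thesis using True by simp
  next
    case False
    have "emeasure M {..s} = (\<integral>\<^sup>+x. ennreal (d x) * indicator {..s} x \<partial>lborel)"
      unfolding M_def by (intro emeasure_density) auto
    also have "\<dots> = (\<integral>\<^sup>+x. 0 \<partial>(lborel::real measure))"
      using False by (intro nn_integral_cong) (auto simp: d_def split: split_indicator)
    finally show ?thesis using False by simp
  qed
  have em_D: "emeasure (distr lborel borel \<psi>) {..s} = ennreal (if s \<ge> 0 then pi * (s / \<alpha>) powr (1 / real l) else 0)" for s
  proof (cases "s \<ge> 0")
    case True
    define r where "r = (s / \<alpha>) powr (1 / (2 * real l))"
    have r: "r \<ge> 0" by (simp add: r_def)
    have r2: "r ^ (2 * l) = s / \<alpha>"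
    proof (cases "s = 0")
      case False
      then have "r > 0" using True assms by (simp add: r_def)
      then have "r ^ (2 * l) = r powr real (2 * l)" by (rule powr_realpow[symmetric])
      also have "\<dots> = s / \<alpha>" using False True assms l0 by (simp add: r_def powr_powr)
      finally show ?thesis .
    qed (use assms in \<open>simp add: r_def\<close>)
    have "\<psi> z \<le> s \<longleftrightarrow> cmod z \<le> r" for z
    proof -
      have "\<psi> z \<le> s \<longleftrightarrow> cmod z ^ (2 * l) \<le> r ^ (2 * l)"
        unfolding r2 \<psi>_def using assms by (simp add: field_simps)
      also have "\<dots> \<longleftrightarrow> cmod z \<le> r" using r assms by (intro power_mono_iff) auto
      finally show ?thesis .
    qed
    then have "\<psi> -` {..s} = cball 0 r" by (auto simp: dist_norm)
    then have "emeasure (distr lborel borel \<psi>) {..s} = emeasure lborel (cball (0::complex) r)"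
      by (simp add: emeasure_distr)
    also have "\<dots> = ennreal (pi * r ^ 2)" using r
      by (simp add: emeasure_cball unit_ball_vol_2)
    also have "r ^ 2 = (s / \<alpha>) powr (1 / real l)"
    proof (cases "s = 0")
      case False
      then have "r > 0" using True assms by (simp add: r_def)
      then have "r ^ 2 = r powr real 2" by (rule powr_realpow[symmetric])
      also have "\<dots> = (s / \<alpha>) powr (1 / real l)" using False True assms l0 by (simp add: r_def powr_powr)
      finally show ?thesis .
    qed (simp add: r_def)
    finally show ?thesis using True by simp
  next
    case False
    have "\<psi> z \<ge> 0" for z using assms by (simp add: \<psi>_def)
    then have "\<psi> -` {..s} = {}" using False by (auto simp: not_le) (meson dual_order.trans not_le)
    then show ?thesis using False by (simp add: emeasure_distr)
  qed
  have eq: "distr lborel borel \<psi> = M"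
  proof (rule measure_eqI_generator_eq[where E = "range atMost" and \<Omega> = UNIV and A = "\<lambda>i. {..real i}"])
    show "Int_stable (range (atMost :: real \<Rightarrow> _))"
      by (auto simp: Int_stable_def)
    show "sets M = sigma_sets UNIV (range atMost)"
      unfolding M_def by (simp add: borel_eq_atMost)
    show "sets (distr lborel borel \<psi>) = sigma_sets UNIV (range atMost)"
      by (simp add: borel_eq_atMost)
    show "(\<Union>i. {..real i}) = UNIV" using real_arch_simple by auto
  qed (auto simp: em_M em_D)
  define p where "p = real (k + 1) / real l"
  have p: "p > 0" using l0 by (simp add: p_def)
  define g where "g = (\<lambda>s::real. (s / \<alpha>) powr (real k / real l) * exp (- s))"
  have [measurable]: "g \<in> borel_measurable borel" by (simp add: g_def)
  have [simp]: "g s \<ge> 0" for s by (simp add: g_def)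
  have "(\<integral>\<^sup>+z. ennreal (cmod z ^ (2 * k) * exp (- \<alpha> * cmod z ^ (2 * l))) \<partial>lborel)
      = (\<integral>\<^sup>+z. ennreal (g (\<psi> z)) \<partial>lborel)"
  proof (rule nn_integral_cong_AE, rule AE_mp[OF AE_lborel_singleton[of 0]], rule AE_I2, rule impI)
    fix z :: complex assume "z \<noteq> 0"
    then have z: "cmod z > 0" by simp
    have "(\<psi> z / \<alpha>) powr (real k / real l) = (cmod z powr real (2 * l)) powr (real k / real l)"
      using assms z by (simp add: \<psi>_def powr_realpow[symmetric])
    also have "\<dots> = cmod z powr real (2 * k)" using l0 by (simp add: powr_powr)
    also have "\<dots> = cmod z ^ (2 * k)" using z by (rule powr_realpow)
    finally show "ennreal (cmod z ^ (2 * k) * exp (- \<alpha> * cmod z ^ (2 * l))) = ennreal (g (\<psi> z))"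
      by (simp add: g_def \<psi>_def)
  qed
  also have "\<dots> = (\<integral>\<^sup>+s. ennreal (g s) \<partial>(distr lborel borel \<psi>))"
    by (subst nn_integral_distr) auto
  also have "\<dots> = (\<integral>\<^sup>+s. ennreal (d s) * ennreal (g s) \<partial>lborel)"
    unfolding eq M_def by (subst nn_integral_density) auto
  also have "\<dots> = (\<integral>\<^sup>+s. ennreal (pi / real l * \<alpha> powr - p) * ennreal (indicator {0..} s * s powr (p - 1) / exp s) \<partial>lborel)"
  proof (rule nn_integral_cong)
    fix s :: real
    have "d s * g s = pi / real l * \<alpha> powr - p * (indicator {0..} s * s powr (p - 1) / exp s)"
    proof (cases "s > 0")
      case True
      have "s powr (1 / real l - 1) * s powr (real k / real l) = s powr (p - 1)"
        by (simp add: p_def powr_add[symmetric] add_divide_distrib algebra_simps)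
      moreover have "\<alpha> powr (- (1 / real l)) / \<alpha> powr (real k / real l) = \<alpha> powr - p"
        by (simp add: p_def powr_diff[symmetric] add_divide_distrib)
      ultimately show ?thesis using True assms
        by (simp add: d_def g_def c_def powr_divide exp_minus field_simps)
    next
      case False
      then show ?thesis by (cases "s = 0") (simp_all add: d_def g_def)
    qed
    then show "ennreal (d s) * ennreal (g s) =
       ennreal (pi / real l * \<alpha> powr - p) * ennreal (indicator {0..} s * s powr (p - 1) / exp s)"
      using d0 by (simp flip: ennreal_mult')
  qed
  also have "\<dots> = ennreal (pi / real l * \<alpha> powr - p) * ennreal (Gamma p)"
    using Gamma_conv_nn_integral_real[OF p] by (subst nn_integral_cmult) auto
  finally show ?thesis using p by (simp add: p_def flip: ennreal_mult')
qed

section \<open>Convolutions of reciprocal Gamma values\<close>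

lemma ratio_bounded_if_cofinitely:
  fixes u v :: "nat \<Rightarrow> real"
  assumes v: "\<And>k. v k > 0" and C: "\<And>k. k \<ge> K \<Longrightarrow> u k \<le> C * v k"
  shows "\<exists>C>0. \<forall>k. u k \<le> C * v k"
proof -
  define D where "D = 1 + \<bar>C\<bar> + (\<Sum>i<K. \<bar>u i\<bar> / v i)"
  have nn: "\<bar>u i\<bar> / v i \<ge> 0" for i using v[of i] by simp
  then have S: "(\<Sum>i<K. \<bar>u i\<bar> / v i) \<ge> 0" by (simp add: sum_nonneg)
  have "u k \<le> D * v k" for k
  proof (cases "k \<ge> K")
    case True
    have "C \<le> D" using S by (simp add: D_def)
    then show ?thesis using C[OF True] v[of k] by (meson less_eq_real_def mult_right_mono order_trans)
  next
    case False
    have "\<bar>u k\<bar> / v k \<le> (\<Sum>i<K. \<bar>u i\<bar> / v i)"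
      using False nn by (intro member_le_sum) auto
    then have "\<bar>u k\<bar> / v k \<le> D" by (simp add: D_def)
    then show ?thesis using v[of k] by (simp add: field_simps)
  qed
  moreover have "D > 0" using S by (simp add: D_def)
  ultimately show ?thesis by blast
qed

text \<open>
  The quotient \<open>u / v\<close> decreases along each residue class modulo \<open>l\<close>, so its first \<open>l\<close> values
  bound it.
\<close>

lemma ratio_bounded_if_step_decreasing:
  fixes u v :: "nat \<Rightarrow> real"
  assumes l: "l \<ge> 1" and v: "\<And>k. k \<ge> K \<Longrightarrow> v k > 0"
    and step: "\<And>k. k \<ge> K \<Longrightarrow> u (k + l) * v k \<le> u k * v (k + l)"
  shows "\<exists>C>0. \<forall>k\<ge>K. u k \<le> C * v k"
proof -
  define D where "D = 1 + (\<Sum>i\<in>{K..<K+l}. \<bar>u i / v i\<bar>)"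
  have "u k / v k \<le> D" if "k \<ge> K" for k
    using that
  proof (induction k rule: less_induct)
    case (less k)
    show ?case
    proof (cases "k < K + l")
      case True
      have "\<bar>u k / v k\<bar> \<le> (\<Sum>i\<in>{K..<K+l}. \<bar>u i / v i\<bar>)"
        using True less.prems by (intro member_le_sum) auto
      then show ?thesis unfolding D_def by linarith
    next
      case False
      define j where "j = k - l"
      have j: "k = j + l" "j \<ge> K" using False by (auto simp: j_def)
      have "u k / v k \<le> u j / v j"
        using step[OF j(2)] v[OF j(2)] v[of k] less.prems by (simp add: j(1) field_simps)
      also have "\<dots> \<le> D" using less.IH[of j] j l by simp
      finally show ?thesis .
    qed
  qed
  moreover have "D > 0" unfolding D_def by (intro add_pos_nonneg sum_nonneg) auto
  ultimately show ?thesis using v by (metis pos_divide_le_eq)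
qed

definition rGamma_convolution :: "nat \<Rightarrow> nat \<Rightarrow> real" where
  "rGamma_convolution l n = (\<Sum>i\<in>{1..<n}. rGamma (real i / real l) * rGamma (real (n - i) / real l))"

definition rGamma_convolution_tail :: "nat \<Rightarrow> nat \<Rightarrow> real" where
  "rGamma_convolution_tail l n = (\<Sum>i\<in>{l..n-l}. rGamma (real i / real l) * rGamma (real (n - i) / real l))"

lemma rGamma_real_pos: "x > 0 \<Longrightarrow> rGamma (x::real) > 0"
  by (simp add: rGamma_inverse_Gamma)

lemma rGamma_real_nonneg: "x \<ge> 0 \<Longrightarrow> rGamma (x::real) \<ge> 0"
  using rGamma_real_pos[of x] by (cases "x = 0") (auto intro: less_imp_le)

lemma rGamma_pred: "rGamma (x - 1) = (x - 1) * rGamma (x::real)"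
  using rGamma_plus1[of "x - 1"] by simp

text \<open>
  The analogue of Pascal's rule: for \<open>1 / (Gamma x * Gamma y)\<close> at integer arguments it is the
  recursion of the binomial coefficients.
\<close>

lemma rGamma_product_split:
  fixes x y :: real
  shows "(x + y - 2) * (rGamma x * rGamma y) = rGamma (x - 1) * rGamma y + rGamma x * rGamma (y - 1)"
  by (simp add: rGamma_pred algebra_simps)

text \<open>
  Reflection of the antidiagonal identifies the two sums that Pascal's rule produces.
\<close>

lemma rGamma_split_sum:
  assumes l: "l \<ge> 1" and I: "I \<subseteq> {..n+l}" "\<And>i. i \<in> I \<Longrightarrow> n + l - i \<in> I"
  shows "(real n / real l - 1) * (\<Sum>i\<in>I. rGamma (real i / real l) * rGamma (real (n + l - i) / real l))
     = 2 * (\<Sum>i\<in>I. rGamma (real i / real l - 1) * rGamma (real (n + l - i) / real l))"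
proof -
  let ?x = "\<lambda>i. real i / real l" and ?y = "\<lambda>i. real (n + l - i) / real l"
  have s: "?x i + ?y i - 2 = real n / real l - 1" if "i \<in> I" for i
  proof -
    have "i \<le> n + l" using that I(1) by auto
    then show ?thesis using l by (simp add: of_nat_diff field_simps)
  qed
  have "(real n / real l - 1) * (\<Sum>i\<in>I. rGamma (?x i) * rGamma (?y i))
      = (\<Sum>i\<in>I. rGamma (?x i - 1) * rGamma (?y i) + rGamma (?x i) * rGamma (?y i - 1))"
    unfolding sum_distrib_left
    by (intro sum.cong refl) (metis s rGamma_product_split)
  also have "\<dots> = (\<Sum>i\<in>I. rGamma (?x i - 1) * rGamma (?y i)) + (\<Sum>i\<in>I. rGamma (?x i) * rGamma (?y i - 1))"
    by (rule sum.distrib)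
  also have "(\<Sum>i\<in>I. rGamma (?x i) * rGamma (?y i - 1)) = (\<Sum>i\<in>I. rGamma (?x i - 1) * rGamma (?y i))"
    using I by (intro sum.reindex_bij_witness[of _ "\<lambda>i. n + l - i" "\<lambda>i. n + l - i"]) auto
  finally show ?thesis by simp
qed

text \<open>
  Shifting the index by \<open>l\<close> recovers the shorter convolution. The terms \<open>i < l\<close> that are left
  over involve \<open>rGamma\<close> on \<open>(-1, 0)\<close>, where it is negative, and can only help; the term \<open>i = l\<close>
  vanishes.
\<close>

lemma rGamma_convolution_step:
  assumes l: "l \<ge> 1"
  shows "(real n / real l - 1) * rGamma_convolution l (n + l) \<le> 2 * rGamma_convolution l n"
proof -
  let ?t = "\<lambda>i. rGamma (real i / real l - 1) * rGamma (real (n + l - i) / real l)"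
  have nonpos: "?t i \<le> 0" if "i \<in> {1..<n+l}" "i \<notin> {l+1..<n+l}" for i
  proof -
    have "rGamma (real i / real l - 1) \<le> 0" 
      unfolding rGamma_pred using that l
      by (intro mult_nonpos_nonneg rGamma_real_nonneg) (auto simp: field_simps)
    then show ?thesis by (intro mult_nonpos_nonneg rGamma_real_nonneg) auto
  qed
  have "(real n / real l - 1) * rGamma_convolution l (n + l) = 2 * (\<Sum>i\<in>{1..<n+l}. ?t i)"
    unfolding rGamma_convolution_def by (rule rGamma_split_sum[OF l]) auto
  also have "(\<Sum>i\<in>{1..<n+l}. ?t i) = (\<Sum>i\<in>{l+1..<n+l}. ?t i) + (\<Sum>i\<in>{1..<n+l} - {l+1..<n+l}. ?t i)"
    using sum.subset_diff[of "{l+1..<n+l}" "{1..<n+l}" ?t] by (auto simp: add.commute)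
  also have "(\<Sum>i\<in>{1..<n+l} - {l+1..<n+l}. ?t i) \<le> 0"
    using nonpos by (intro sum_nonpos) blast
  also have "(\<Sum>i\<in>{l+1..<n+l}. ?t i) = rGamma_convolution l n"
    unfolding rGamma_convolution_def
    using l by (intro sum.reindex_bij_witness[of _ "\<lambda>i. i + l" "\<lambda>i. i - l"])
      (auto simp: of_nat_diff diff_divide_distrib)
  finally show ?thesis by simp
qed

text \<open>
  In the part of the convolution with both indices at least \<open>l\<close>, the boundary terms are values
  of \<open>rGamma\<close> on \<open>[0, 1)\<close> and have the opposite sign, so the recursion gives a lower bound.
\<close>

lemma rGamma_convolution_tail_step:
  assumes l: "l \<ge> 1" and n: "n \<ge> 2 * l"
  shows "(real n / real l - 1) * rGamma_convolution_tail l (n + l) \<ge> 2 * rGamma_convolution_tail l n"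
proof -
  let ?g = "\<lambda>i. rGamma (real i / real l) * rGamma (real (n - i) / real l)"
  let ?t = "\<lambda>i. rGamma (real i / real l - 1) * rGamma (real (n + l - i) / real l)"
  have "rGamma_convolution_tail l n \<le> (\<Sum>i\<in>{0..n-l}. ?g i)"
    unfolding rGamma_convolution_tail_def
    by (intro sum_mono2 mult_nonneg_nonneg rGamma_real_nonneg) auto
  also have "\<dots> = (\<Sum>i\<in>{l..n+l-l}. ?t i)"
    using l n by (intro sum.reindex_bij_witness[of _ "\<lambda>i. i - l" "\<lambda>i. i + l"])
      (auto simp: of_nat_diff diff_divide_distrib add_divide_distrib)
  also have "2 * \<dots> = (real n / real l - 1) * rGamma_convolution_tail l (n + l)"
    unfolding rGamma_convolution_tail_def
    using n by (intro rGamma_split_sum[OF l, symmetric]) auto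
  finally show ?thesis by simp
qed

text \<open>
  Both inequalities are logarithmic convexity: of the midpoint \<open>x\<close> between \<open>x - t\<close> and \<open>x + t\<close>,
  and of \<open>x + t\<close> and \<open>x - t\<close> between \<open>x\<close> and its neighbours \<open>x + 1\<close> and \<open>x - 1\<close>.
\<close>

lemma Gamma_square_comparison:
  fixes x t :: real
  assumes t: "0 \<le> t" "t < 1" and x: "x > 1"
  shows "Gamma x ^ 2 \<le> Gamma (x + t) * Gamma (x - t)"
    and "Gamma (x + t) * Gamma (x - t) \<le> x / (x - 1) * Gamma x ^ 2"
proof -
  let ?L = "\<lambda>x::real. ln (Gamma x)"
  have cv: "?L ((1 - u) * a + u * b) \<le> (1 - u) * ?L a + u * ?L b"
    if "0 \<le> u" "u \<le> 1" "a > 0" "b > 0" for a b u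
    using convex_onD[OF log_convex_Gamma_real, of u a b] that by simp
  have pos: "Gamma x > 0" "Gamma (x+t) > 0" "Gamma (x-t) > 0" using t x by simp_all
  have "?L x \<le> (1 - 1/2) * ?L (x + t) + 1/2 * ?L (x - t)"
    using cv[of "1/2" "x + t" "x - t"] t x by (simp add: field_simps)
  then have "ln (Gamma x ^ 2) \<le> ln (Gamma (x + t) * Gamma (x - t))"
    using pos by (simp add: ln_mult ln_realpow)
  then show "Gamma x ^ 2 \<le> Gamma (x + t) * Gamma (x - t)"
    using pos by (subst (asm) ln_le_cancel_iff) auto
  have G1: "Gamma (x + 1) = x * Gamma x" by (rule Gamma_plus1) (use x nonpos_Ints_nonpos[of x] in auto)
  have G2: "Gamma x = (x - 1) * Gamma (x - 1)" using Gamma_plus1[of "x - 1"] x nonpos_Ints_nonpos[of "x - 1"] by auto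
  have "?L (x + t) \<le> (1 - t) * ?L x + t * ?L (x + 1)"
    using cv[of t x "x + 1"] t x by (simp add: algebra_simps)
  moreover have "?L (x + 1) = ln x + ?L x" using pos(1) x unfolding G1 by (intro ln_mult_pos) auto
  moreover have "?L (x - t) \<le> (1 - t) * ?L x + t * ?L (x - 1)"
    using cv[of t x "x - 1"] t x by (simp add: algebra_simps)
  moreover have "?L x = ln (x - 1) + ?L (x - 1)" unfolding G2 using x by (intro ln_mult_pos Gamma_real_pos) auto
  ultimately have "?L (x + t) \<le> ?L x + t * ln x" "?L (x - t) \<le> ?L x - t * ln (x - 1)"
    by (simp_all add: algebra_simps)
  then have "?L (x + t) + ?L (x - t) \<le> 2 * ?L x + t * (ln x - ln (x - 1))"
    by (simp add: algebra_simps)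
  also have "\<dots> \<le> 2 * ?L x + (ln x - ln (x - 1))"
    using t x mult_right_mono[of t 1 "ln x - ln (x - 1)"] by simp
  finally have "ln (Gamma (x + t) * Gamma (x - t)) \<le> ln (x / (x - 1) * Gamma x ^ 2)"
    using pos(2,3) x less_imp_neq[OF pos(1), symmetric] by (simp add: ln_mult ln_div ln_realpow del: Gamma_eq_zero_iff)
  moreover have "x / (x - 1) * Gamma x ^ 2 > 0"
    using pos(1) x by (intro mult_pos_pos divide_pos_pos zero_less_power) linarith+
  ultimately show "Gamma (x + t) * Gamma (x - t) \<le> x / (x - 1) * Gamma x ^ 2"
    using pos(2,3) by (subst (asm) ln_le_cancel_iff) simp_all
qed

text \<open>
  \<open>P\<close> solves the recursion of the convolution exactly, so the two one-sided recursions make the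
  quotients monotone in steps of \<open>l\<close>.
\<close>

lemma rGamma_convolution_asymp:
  assumes l: "l \<ge> 1"
  defines "P \<equiv> \<lambda>k. 2 powr (real k / real l) * rGamma (real (k + 2) / real l - 1)"
  shows "\<exists>C>0. \<forall>k\<ge>l. rGamma_convolution l (k + 2) \<le> C * P k"
    and "\<exists>C>0. \<forall>k\<ge>2*l. P k \<le> C * rGamma_convolution l (k + 2)"
proof -
  have l0: "real l > 0" using l by simp
  have Ppos: "P k > 0" if "k \<ge> l" for k
    unfolding P_def using that l0 by (intro mult_pos_pos rGamma_real_pos) (auto simp: field_simps)
  have spos: "real (k + 2) / real l - 1 > 0" if "k \<ge> l" for k
    using that l0 by (simp add: field_simps)
  have Pstep: "(real (k + 2) / real l - 1) * P (k + l) = 2 * P k" for k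
  proof -
    have e1: "2 powr (real (k + l) / real l) = 2 * 2 powr (real k / real l)"
      using l0 by (simp add: add_divide_distrib powr_add)
    have e2: "real (k + l + 2) / real l - 1 = real (k + 2) / real l"
      using l0 by (simp add: field_simps)
    have reorder: "a * ((2 * p) * g) = 2 * (p * (a * g))" for a p g :: real by simp
    show ?thesis unfolding P_def e1 e2 rGamma_pred[of "real (k + 2) / real l"] by (rule reorder)
  qed
  show "\<exists>C>0. \<forall>k\<ge>l. rGamma_convolution l (k + 2) \<le> C * P k"
  proof (rule ratio_bounded_if_step_decreasing[OF l])
    fix k assume k: "k \<ge> l"
    let ?s = "real (k + 2) / real l - 1"
    have "?s * (rGamma_convolution l (k + l + 2) * P k) \<le> 2 * rGamma_convolution l (k + 2) * P k"
    proof -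
      have e: "k + 2 + l = k + l + 2" by simp
      have "?s * rGamma_convolution l (k + l + 2) \<le> 2 * rGamma_convolution l (k + 2)"
        using rGamma_convolution_step[OF l, of "k + 2"] unfolding e .
      from mult_right_mono[OF this less_imp_le[OF Ppos[OF k]]] show ?thesis
        by (simp only: mult.assoc)
    qed
    also have "\<dots> = ?s * (rGamma_convolution l (k + 2) * P (k + l))"
      using arg_cong[OF Pstep[of k], of "\<lambda>y. y * rGamma_convolution l (k + 2)"] by (simp only: mult_ac)
    finally show "rGamma_convolution l (k + l + 2) * P k \<le> rGamma_convolution l (k + 2) * P (k + l)"
      using spos[OF k] by (simp only: mult_le_cancel_left_pos)
  qed (use Ppos in auto)
  have Tpos: "rGamma_convolution_tail l (k + 2) > 0" if "k \<ge> 2 * l" for k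
    unfolding rGamma_convolution_tail_def
    using that l by (intro sum_pos mult_pos_pos rGamma_real_pos) auto
  have "\<exists>C>0. \<forall>k\<ge>2*l. P k \<le> C * rGamma_convolution_tail l (k + 2)"
  proof (rule ratio_bounded_if_step_decreasing[OF l])
    fix k assume k: "k \<ge> 2 * l"
    let ?s = "real (k + 2) / real l - 1"
    have kl: "k \<ge> l" using k by simp
    have "?s * (P (k + l) * rGamma_convolution_tail l (k + 2)) = P k * (2 * rGamma_convolution_tail l (k + 2))"
      using arg_cong[OF Pstep[of k], of "\<lambda>y. y * rGamma_convolution_tail l (k + 2)"] by (simp only: mult_ac)
    also have "\<dots> \<le> P k * (?s * rGamma_convolution_tail l (k + 2 + l))"
      using rGamma_convolution_tail_step[OF l, of "k + 2"] Ppos[OF kl] k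
      by (intro mult_left_mono) linarith+
    also have "k + 2 + l = k + l + 2" by simp
    finally have "?s * (P (k + l) * rGamma_convolution_tail l (k + 2)) \<le> ?s * (P k * rGamma_convolution_tail l (k + l + 2))"
      by (simp only: mult.left_commute)
    then show "P (k + l) * rGamma_convolution_tail l (k + 2) \<le> P k * rGamma_convolution_tail l (k + l + 2)"
      using spos[OF kl] by (simp only: mult_le_cancel_left_pos)
  qed (use Tpos in auto)
  then obtain C where C: "C > 0" "\<And>k. k \<ge> 2*l \<Longrightarrow> P k \<le> C * rGamma_convolution_tail l (k + 2)" by blast
  have "rGamma_convolution_tail l (k + 2) \<le> rGamma_convolution l (k + 2)" if "k \<ge> 2 * l" for k
    unfolding rGamma_convolution_def rGamma_convolution_tail_def
    using l that by (intro sum_mono2 mult_nonneg_nonneg rGamma_real_nonneg) auto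
  then have "P k \<le> C * rGamma_convolution l (k + 2)" if "k \<ge> 2 * l" for k
    using that C by (meson mult_left_mono less_imp_le order_trans)
  then show "\<exists>C>0. \<forall>k\<ge>2*l. P k \<le> C * rGamma_convolution l (k + 2)" using C(1) by blast
qed

text \<open>
  With \<open>x = (k + 1) / l\<close> and \<open>t = 1 - 1 / l\<close> the Gamma factor of \<open>R\<close> has the argument \<open>x + t\<close>
  and the growth rate \<open>P\<close> of the convolution (\<open>rGamma_convolution_asymp\<close>) involves
  \<open>rGamma (x - t)\<close>, so comparing \<open>S\<close> with \<open>R\<close> is comparing \<open>Gamma x ^ 2\<close> with
  \<open>Gamma (x + t) * Gamma (x - t)\<close>.
\<close>

lemma Gamma_convolution_comparable:
  assumes l: "l \<ge> 1"
  defines "R \<equiv> \<lambda>k. 2 powr (real k / real l) * Gamma (real (k + l) / real l)"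
    and "S \<equiv> \<lambda>k. Gamma (real (k + 1) / real l) ^ 2 * rGamma_convolution l (k + 2)"
  shows "\<exists>C>0. \<forall>k. S k \<le> C * R k" and "\<exists>C>0. \<forall>k. R k \<le> C * S k"
proof -
  have l0: "real l > 0" using l by simp
  define P where "P = (\<lambda>k. 2 powr (real k / real l) * rGamma (real (k + 2) / real l - 1))"
  obtain C1 where C1: "C1 > 0" "\<And>k. k \<ge> l \<Longrightarrow> rGamma_convolution l (k + 2) \<le> C1 * P k"
    using rGamma_convolution_asymp(1)[OF l] unfolding P_def by blast
  obtain C2 where C2: "C2 > 0" "\<And>k. k \<ge> 2*l \<Longrightarrow> P k \<le> C2 * rGamma_convolution l (k + 2)"
    using rGamma_convolution_asymp(2)[OF l] unfolding P_def by blast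
  have Rpos: "R k > 0" for k unfolding R_def using l0 by (intro mult_pos_pos Gamma_real_pos) auto
  have Spos: "S k > 0" for k unfolding S_def rGamma_convolution_def
    using l0 by (intro mult_pos_pos sum_pos zero_less_power Gamma_real_pos rGamma_real_pos) auto
  define t where "t = 1 - 1 / real l"
  have t: "0 \<le> t" "t < 1" using l by (auto simp: t_def)
  have PG: "P k * Gamma (real (k + 1) / real l) ^ 2 \<le> R k" 
       "R k \<le> (1 + real l) * (P k * Gamma (real (k + 1) / real l) ^ 2)" if k: "k \<ge> l" for k
  proof -
    define x where "x = real (k + 1) / real l"
    have x: "x > 1" "x \<ge> 1 + 1 / real l" using k l0 by (auto simp: x_def field_simps)
    have xp: "x + t = real (k + l) / real l" and xm: "x - t = real (k + 2) / real l - 1"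
      using l0 by (auto simp: x_def t_def field_simps)
    have gp: "Gamma (x - t) > 0" using x t by simp
    have P: "P k = 2 powr (real k / real l) / Gamma (x - t)"
      unfolding P_def xm[symmetric] by (simp add: rGamma_inverse_Gamma field_simps)
    have R: "R k = 2 powr (real k / real l) / Gamma (x - t) * (Gamma (x + t) * Gamma (x - t))"
      unfolding R_def xp[symmetric] using gp by simp
    have nn: "2 powr (real k / real l) / Gamma (x - t) \<ge> 0" using gp by simp
    show "P k * Gamma (real (k + 1) / real l) ^ 2 \<le> R k"
      unfolding x_def[symmetric] P R using Gamma_square_comparison(1)[OF t x(1)] nn by (rule mult_left_mono)
    have "x / (x - 1) \<le> 1 + real l"
    proof -
      have "(x - 1) * real l \<ge> 1" using x l0 by (simp add: field_simps)
      then show ?thesis using x by (simp add: field_simps)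
    qed
    then have "Gamma (x + t) * Gamma (x - t) \<le> (1 + real l) * Gamma x ^ 2"
      using Gamma_square_comparison(2)[OF t x(1)] by (meson mult_right_mono zero_le_power2 order_trans)
    from mult_left_mono[OF this nn] show "R k \<le> (1 + real l) * (P k * Gamma (real (k + 1) / real l) ^ 2)"
      unfolding x_def[symmetric] P R by (simp add: mult_ac)
  qed
  show "\<exists>C>0. \<forall>k. S k \<le> C * R k"
  proof (rule ratio_bounded_if_cofinitely[OF Rpos])
    fix k assume k: "k \<ge> l"
    have "S k \<le> C1 * (P k * Gamma (real (k + 1) / real l) ^ 2)"
      unfolding S_def using mult_left_mono[OF C1(2)[OF k], of "Gamma (real (k + 1) / real l) ^ 2"]
      by (simp add: mult_ac)
    also have "\<dots> \<le> C1 * R k" using PG(1)[OF k] C1(1) by simp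
    finally show "S k \<le> C1 * R k" .
  qed
  show "\<exists>C>0. \<forall>k. R k \<le> C * S k"
  proof (rule ratio_bounded_if_cofinitely[OF Spos])
    fix k assume k: "k \<ge> 2 * l"
    have "R k \<le> (1 + real l) * (P k * Gamma (real (k + 1) / real l) ^ 2)"
      using PG(2)[of k] k by simp
    also have "\<dots> \<le> (1 + real l) * (C2 * S k)"
      unfolding S_def using mult_right_mono[OF C2(2)[OF k], of "Gamma (real (k + 1) / real l) ^ 2"]
      by (intro mult_left_mono) (simp_all add: mult_ac)
    finally show "R k \<le> ((1 + real l) * C2) * S k" by simp
  qed
qed

section \<open>Entire functions and radial weights\<close>

text \<open>
  A relation between coefficients and function, so that products with monomials and Taylor
  remainders come with their coefficients and never have to be differentiated.
\<close>

definition entire_series :: "(nat \<Rightarrow> complex) \<Rightarrow> (complex \<Rightarrow> complex) \<Rightarrow> bool" where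
  "entire_series a f \<longleftrightarrow> (\<forall>z. (\<lambda>k. a k * z ^ k) sums f z)"

lemma entire_series_holomorphic: "entire_series a f \<Longrightarrow> f holomorphic_on UNIV"
proof -
  assume "entire_series a f"
  then have "f holomorphic_on ball 0 r" for r
    by (intro power_series_holomorphic[of 0 r a]) (simp add: entire_series_def)
  moreover have "(\<Union>n. ball (0::complex) (real n)) = UNIV"
    using reals_Archimedean2 by (auto simp: dist_norm)
  ultimately show ?thesis using holomorphic_on_UN_open[of UNIV f "\<lambda>n. ball 0 (real n)"] by auto
qed

lemma holomorphic_entire_series:
  assumes "f holomorphic_on UNIV"
  obtains a where "entire_series a f"
proof
  show "entire_series (\<lambda>k. (deriv ^^ k) f 0 / fact k) f"
    unfolding entire_series_def
  proof
    fix z :: complex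
    have "(\<lambda>n. (deriv ^^ n) f 0 / fact n * (z - 0) ^ n) sums f z"
      using assms by (intro holomorphic_power_series[of f 0 "cmod z + 1"]) (auto intro: holomorphic_on_subset)
    then show "(\<lambda>k. (deriv ^^ k) f 0 / fact k * z ^ k) sums f z" by simp
  qed
qed

lemma entire_series_continuous: "entire_series a f \<Longrightarrow> continuous_on S f"
  using entire_series_holomorphic holomorphic_on_imp_continuous_on continuous_on_subset by blast

lemma entire_series_borel [measurable_dest]: "entire_series a f \<Longrightarrow> f \<in> borel_measurable borel"
  by (intro borel_measurable_continuous_onI entire_series_continuous)

lemma entire_series_abs_summable:
  assumes "entire_series a f" and that: "r \<ge> 0"
  shows "summable (\<lambda>k. cmod (a k) * r ^ k)"
proof -
  have "summable (\<lambda>k. a k * of_real (r + 1) ^ k)"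
    using assms(1) unfolding entire_series_def summable_def by blast
  moreover have "norm (complex_of_real r) < norm (complex_of_real (r + 1))"
    using that by (simp del: of_real_add)
  ultimately have "summable (\<lambda>k. norm (a k * of_real r ^ k))" by (rule powser_insidea)
  then show ?thesis using that by (simp add: norm_mult norm_power)
qed

lemma entire_series_monomial: "entire_series (\<lambda>k. if k = n then 1 else 0) (\<lambda>z. z ^ n)"
  unfolding entire_series_def
proof
  fix z :: complex
  have "(\<lambda>k. (if k = n then 1 else 0) * z ^ k) = (\<lambda>k. if k = n then z ^ k else 0)" by auto
  then show "(\<lambda>k. (if k = n then 1 else 0) * z ^ k) sums (z ^ n)"
    using sums_single[of n "\<lambda>k. z ^ k"] by simp
qed

lemma entire_series_mult_monomial:
  assumes "entire_series a f"
  shows "entire_series (\<lambda>k. if k < m then 0 else a (k - m)) (\<lambda>z. z ^ m * f z)"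
  unfolding entire_series_def
proof
  fix z
  let ?g = "\<lambda>k. (if k < m then 0 else a (k - m)) * z ^ k"
  have "(\<lambda>k. z ^ m * (a k * z ^ k)) sums (z ^ m * f z)"
    using assms unfolding entire_series_def by (intro sums_mult) auto
  also have "(\<lambda>k. z ^ m * (a k * z ^ k)) = (\<lambda>k. ?g (k + m))" by (auto simp: power_add)
  finally have "?g sums (z ^ m * f z + (\<Sum>i<m. ?g i))" by (rule sums_iff_shift[THEN iffD1])
  then show "?g sums (z ^ m * f z)" by simp
qed

lemma entire_series_diff_partial_sum:
  assumes "entire_series a f"
  shows "entire_series (\<lambda>k. if k < N then 0 else a k) (\<lambda>z. f z - (\<Sum>m<N. a m * z ^ m))"
  unfolding entire_series_def
proof
  fix z
  have "(\<lambda>k. a k * z ^ k - (if k \<in> {..<N} then a k * z ^ k else 0)) sums (f z - (\<Sum>m<N. a m * z ^ m))"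
    using assms unfolding entire_series_def by (intro sums_diff sums_If_finite_set) auto
  also have "(\<lambda>k. a k * z ^ k - (if k \<in> {..<N} then a k * z ^ k else 0)) = (\<lambda>k. (if k < N then 0 else a k) * z ^ k)" by auto
  finally show "(\<lambda>k. (if k < N then 0 else a k) * z ^ k) sums (f z - (\<Sum>m<N. a m * z ^ m))" .
qed

text \<open>
  On a disc the power series converges absolutely and uniformly, which allows integration term
  by term against any continuous function.
\<close>

lemma disk_integral_series:
  assumes f: "entire_series a f" and h: "continuous_on UNIV h"
  shows "(\<lambda>k. a k * (CLINT z:cball 0 R|lborel. z ^ k * h z)) sums (CLINT z:cball 0 R|lborel. f z * h z)"
proof (cases "R \<ge> 0")
  case False
  then show ?thesis by (simp add: set_lebesgue_integral_def)
next
  case True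
  have [measurable]: "h \<in> borel_measurable borel" using h by (rule borel_measurable_continuous_onI)
  let ?t = "\<lambda>k z. indicat_real (cball 0 R) z *\<^sub>R (a k * z ^ k * h z)"
  have int: "integrable lborel (?t k)" for k
    by (intro borel_integrable_compact continuous_intros continuous_on_subset[OF h]) auto
  obtain B where B: "B \<ge> 0" "\<And>z. z \<in> cball 0 R \<Longrightarrow> cmod (h z) \<le> B"
  proof -
    have "compact (h ` cball 0 R)"
      by (intro compact_continuous_image continuous_on_subset[OF h]) auto
    then have "bounded (h ` cball 0 R)" by (rule compact_imp_bounded)
    then obtain b where "\<forall>x\<in>h ` cball 0 R. cmod x \<le> b" by (auto simp: bounded_iff)
    then have "cmod (h z) \<le> \<bar>b\<bar>" if "z \<in> cball 0 R" for z using that abs_ge_self[of b] by (meson imageI order_trans)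
    then show ?thesis by (intro that[of "\<bar>b\<bar>"]) auto
  qed
  have bound: "cmod (?t k z) \<le> (cmod (a k) * R ^ k) * (indicat_real (cball 0 R) z * B)" for k z
  proof (cases "z \<in> cball 0 R")
    case z: True
    have "cmod z ^ k * cmod (h z) \<le> R ^ k * B"
      using z B True by (intro mult_mono power_mono) auto
    then show ?thesis using z by (simp add: norm_mult norm_power mult.assoc mult_left_mono)
  qed simp
  have S: "summable (\<lambda>k. cmod (a k) * R ^ k)" using entire_series_abs_summable[OF f True] .
  have intB: "integrable lborel (\<lambda>z::complex. indicat_real (cball 0 R) z * B)"
    by (intro integrable_mult_left integrable_real_indicator emeasure_bounded_finite) auto
  have "(\<lambda>k. integral\<^sup>L lborel (?t k)) sums (\<integral>z. (\<Sum>k. ?t k z) \<partial>lborel)"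
  proof (rule sums_integral[OF int])
    show "AE z in lborel. summable (\<lambda>k. norm (?t k z))"
      by (intro AE_I2 summable_comparison_test'[OF summable_mult2[OF S]]) (use bound in auto)
    show "summable (\<lambda>k. \<integral>z. norm (?t k z) \<partial>lborel)"
    proof (rule summable_comparison_test'[OF summable_mult2[OF S, of "\<integral>z. indicat_real (cball (0::complex) R) z * B \<partial>lborel"]])
      fix k :: nat assume "k \<ge> 0"
      have "(\<integral>z. norm (?t k z) \<partial>lborel) \<le> (\<integral>z. (cmod (a k) * R ^ k) * (indicat_real (cball (0::complex) R) z * B) \<partial>lborel)"
      proof (rule Bochner_Integration.integral_mono)
        show "integrable lborel (\<lambda>z. norm (?t k z))" using int by (rule integrable_norm)
        show "integrable lborel (\<lambda>z::complex. cmod (a k) * R ^ k * (indicat_real (cball 0 R) z * B))"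
          by (intro integrable_mult_right intB)
      qed (rule bound)
      then show "norm (\<integral>z. norm (?t k z) \<partial>lborel) \<le> cmod (a k) * R ^ k * (\<integral>z. indicat_real (cball (0::complex) R) z * B \<partial>lborel)"
        by (simp add: integral_nonneg_AE)
    qed
  qed
  also have "(\<lambda>z. \<Sum>k. ?t k z) = (\<lambda>z. indicat_real (cball 0 R) z *\<^sub>R (f z * h z))"
  proof
    fix z
    have "(\<lambda>k. indicat_real (cball 0 R) z *\<^sub>R (a k * z ^ k * h z)) sums (indicat_real (cball 0 R) z *\<^sub>R (f z * h z))"
      using f unfolding entire_series_def by (intro sums_scaleR_right sums_mult2) auto
    then show "(\<Sum>k. ?t k z) = indicat_real (cball 0 R) z *\<^sub>R (f z * h z)" by (rule sums_unique[symmetric])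
  qed
  also have "(\<lambda>k. integral\<^sup>L lborel (?t k)) = (\<lambda>k. a k * (CLINT z:cball 0 R|lborel. z ^ k * h z))"
    unfolding set_lebesgue_integral_def
    by (subst integral_mult_right_zero[symmetric]) (simp add: mult_ac)
  finally show ?thesis unfolding set_lebesgue_integral_def .
qed

locale radial_weight =
  fixes \<phi> :: "real \<Rightarrow> real"
  assumes cont: "continuous_on UNIV \<phi>" and nonneg: "\<And>r. \<phi> r \<ge> 0"
begin

lemma weight_borel [measurable]: "\<phi> \<in> borel_measurable borel"
  using cont by (rule borel_measurable_continuous_onI)

lemma continuous_weight [continuous_intros]:
  "continuous_on S f \<Longrightarrow> continuous_on S (\<lambda>z. \<phi> (f z))"
  by (rule continuous_on_compose2[OF cont]) auto

definition disk_moment :: "real \<Rightarrow> nat \<Rightarrow> real" where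
  "disk_moment R k = (LINT z:cball (0::complex) R|lborel. cmod z ^ (2 * k) * \<phi> (cmod z))"

lemma integrable_disk_moment:
  "set_integrable lborel (cball (0::complex) R) (\<lambda>z. cmod z ^ (2 * k) * \<phi> (cmod z))"
  unfolding set_integrable_def by (intro borel_integrable_compact continuous_intros) auto

lemma disk_moment_nonneg: "disk_moment R k \<ge> 0"
  unfolding disk_moment_def set_lebesgue_integral_def
  by (intro integral_nonneg_AE AE_I2) (simp add: nonneg)

lemma nn_integral_disk_moment:
  "(\<integral>\<^sup>+z. ennreal (indicat_real (cball 0 R) z * (cmod z ^ (2 * k) * \<phi> (cmod z))) \<partial>lborel) = ennreal (disk_moment R k)"
  using integrable_disk_moment[of R k] unfolding disk_moment_def set_lebesgue_integral_def set_integrable_def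
  by (subst nn_integral_eq_integral) (auto simp: nonneg)

lemma disk_monomials_orthogonal:
  "(CLINT z:cball 0 R|lborel. z ^ n * (cnj (z ^ j) * of_real (\<phi> (cmod z))))
     = (if n = j then of_real (disk_moment R n) else 0)"
proof (cases "n = j")
  case False
  have "(CLINT z:cball 0 R|lborel. z ^ n * (cnj (z ^ j) * of_real (\<phi> (cmod z))))
      = (\<integral>z. z ^ n * cnj (z ^ j) * of_real ((\<lambda>r. indicator {..R} r * \<phi> r) (cmod z)) \<partial>lborel)"
    unfolding set_lebesgue_integral_def
    by (intro Bochner_Integration.integral_cong refl) (auto split: split_indicator)
  also have "\<dots> = 0" using False by (intro monomials_orthogonal_radial) measurable
  finally show ?thesis using False by simp
next
  case True
  have "z ^ j * cnj z ^ j = of_real (cmod z ^ (2 * j))" for z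
    by (simp add: complex_norm_square[symmetric] power_mult flip: power_mult_distrib)
  then have "(CLINT z:cball 0 R|lborel. z ^ n * (cnj (z ^ j) * of_real (\<phi> (cmod z))))
     = (\<integral>z. complex_of_real (indicat_real (cball 0 R) z *\<^sub>R (cmod z ^ (2 * j) * \<phi> (cmod z))) \<partial>lborel)"
    unfolding set_lebesgue_integral_def True
    by (intro Bochner_Integration.integral_cong refl) (auto simp: scaleR_conv_of_real mult.assoc[symmetric])
  also have "\<dots> = of_real (disk_moment R n)"
    unfolding disk_moment_def set_lebesgue_integral_def True by (rule integral_complex_of_real)
  finally show ?thesis using True by simp
qed

lemma disk_monomial_pairing:
  assumes g: "entire_series b g"
  shows "(CLINT z:cball 0 R|lborel. z ^ n * (cnj (g z) * of_real (\<phi> (cmod z)))) = cnj (b n) * of_real (disk_moment R n)"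
proof -
  let ?h = "\<lambda>z. cnj (z ^ n) * complex_of_real (\<phi> (cmod z))"
  have "(\<lambda>k. b k * (CLINT z:cball 0 R|lborel. z ^ k * ?h z)) sums (CLINT z:cball 0 R|lborel. g z * ?h z)"
    by (intro disk_integral_series[OF g] continuous_intros)
  also have "(\<lambda>k. b k * (CLINT z:cball 0 R|lborel. z ^ k * ?h z)) = (\<lambda>k. if k = n then b k * of_real (disk_moment R k) else 0)"
    unfolding disk_monomials_orthogonal by auto
  finally have "(CLINT z:cball 0 R|lborel. g z * ?h z) = b n * of_real (disk_moment R n)"
    using sums_single[of n "\<lambda>k. b k * of_real (disk_moment R k)"] sums_unique2 by blast
  then have "cnj (CLINT z:cball 0 R|lborel. g z * ?h z) = cnj (b n) * of_real (disk_moment R n)" by simp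
  moreover have "cnj (CLINT z:cball 0 R|lborel. g z * ?h z) = (CLINT z:cball 0 R|lborel. z ^ n * (cnj (g z) * of_real (\<phi> (cmod z))))"
    unfolding set_lebesgue_integral_def Bochner_Integration.integral_cnj[symmetric]
    by (intro Bochner_Integration.integral_cong refl) (simp add: mult_ac)
  ultimately show ?thesis by simp
qed

text \<open>
  On discs the pairing of entire functions is diagonal in their Taylor coefficients even if the
  functions are not square integrable on the plane; integrals over the plane are limits of
  these.
\<close>

lemma disk_pairing:
  assumes f: "entire_series a f" and g: "entire_series b g"
  shows "(\<lambda>k. a k * cnj (b k) * of_real (disk_moment R k)) sums
     (CLINT z:cball 0 R|lborel. f z * (cnj (g z) * of_real (\<phi> (cmod z))))"
proof -
  have "(\<lambda>k. a k * (CLINT z:cball 0 R|lborel. z ^ k * (cnj (g z) * of_real (\<phi> (cmod z))))) sums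
     (CLINT z:cball 0 R|lborel. f z * (cnj (g z) * of_real (\<phi> (cmod z))))"
    by (intro disk_integral_series[OF f] continuous_intros entire_series_continuous[OF g])
  then show ?thesis unfolding disk_monomial_pairing[OF g] by (simp add: mult_ac)
qed

lemma disk_integral_tendsto:
  fixes F :: "complex \<Rightarrow> complex"
  assumes "integrable lborel F"
  shows "(\<lambda>N. CLINT z:cball 0 (real N)|lborel. F z) \<longlonglongrightarrow> (\<integral>z. F z \<partial>lborel)"
  unfolding set_lebesgue_integral_def
proof (rule integral_dominated_convergence[where w="\<lambda>z. cmod (F z)"])
  show "AE x in lborel. (\<lambda>i. indicat_real (cball 0 (real i)) x *\<^sub>R F x) \<longlonglongrightarrow> F x"
  proof (rule AE_I2)
    fix x :: complex
    obtain n :: nat where "cmod x \<le> real n" using real_arch_simple by blast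
    then have "eventually (\<lambda>i. indicat_real (cball 0 (real i)) x *\<^sub>R F x = F x) sequentially"
      by (intro eventually_sequentiallyI[of n]) auto
    then show "(\<lambda>i. indicat_real (cball 0 (real i)) x *\<^sub>R F x) \<longlonglongrightarrow> F x" by (rule tendsto_eventually)
  qed
next
  show "(\<lambda>x. indicat_real (cball 0 (real N)) x *\<^sub>R F x) \<in> borel_measurable lborel" for N
    using assms by (intro borel_measurable_scaleR borel_measurable_indicator) auto
qed (use assms in \<open>auto split: split_indicator\<close>)

lemma nn_integral_SUP_disks:
  fixes F :: "complex \<Rightarrow> real"
  assumes [measurable]: "F \<in> borel_measurable borel" and F: "\<And>z. F z \<ge> 0"
  shows "(\<integral>\<^sup>+z. ennreal (F z) \<partial>lborel) = (SUP N. \<integral>\<^sup>+z. ennreal (indicat_real (cball 0 (real N)) z * F z) \<partial>lborel)"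
proof -
  have "ennreal (F z) = (SUP N. ennreal (indicat_real (cball 0 (real N)) z * F z))" for z
  proof (rule antisym)
    obtain n :: nat where "cmod z \<le> real n" using real_arch_simple by blast
    then show "ennreal (F z) \<le> (SUP N. ennreal (indicat_real (cball 0 (real N)) z * F z))"
      by (intro SUP_upper2[of n]) auto
  qed (auto intro!: SUP_least split: split_indicator)
  moreover have "(\<lambda>z. ennreal (indicat_real (cball 0 (real N)) z * F z)) \<in> borel_measurable lborel" for N
    by (intro measurable_compose[OF _ measurable_ennreal] borel_measurable_times borel_measurable_indicator) auto
  ultimately show ?thesis
    by (subst nn_integral_monotone_convergence_SUP[symmetric])
      (auto simp: incseq_def le_fun_def F split: split_indicator)
qed

lemma disk_moment_mono: "M \<le> N \<Longrightarrow> disk_moment M k \<le> disk_moment N k"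
  unfolding disk_moment_def set_lebesgue_integral_def
  using integrable_disk_moment unfolding set_integrable_def
  by (intro Bochner_Integration.integral_mono) (auto simp: nonneg split: split_indicator)

lemma nn_integral_power_eq_SUP:
  "(\<integral>\<^sup>+z. ennreal (cmod z ^ (2 * k) * \<phi> (cmod z)) \<partial>lborel) = (SUP N. ennreal (disk_moment (real N) k))"
  by (subst nn_integral_SUP_disks) (auto simp: nonneg nn_integral_disk_moment)

text \<open>
  Stated for nonnegative integrals, the identity also decides finiteness: an entire function
  lies in the weighted space exactly if its coefficients satisfy the summability condition.
\<close>

lemma parseval_entire:
  assumes f: "entire_series a f"
  shows "(\<integral>\<^sup>+z. ennreal ((cmod (f z))\<^sup>2 * \<phi> (cmod z)) \<partial>lborel)
    = (\<Sum>k. ennreal ((cmod (a k))\<^sup>2) * (\<integral>\<^sup>+z. ennreal (cmod z ^ (2 * k) * \<phi> (cmod z)) \<partial>lborel))"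
proof -
  note [measurable] = entire_series_borel[OF f]
  have disk: "(\<integral>\<^sup>+z. ennreal (indicat_real (cball 0 R) z * ((cmod (f z))\<^sup>2 * \<phi> (cmod z))) \<partial>lborel)
    = (\<Sum>k. ennreal ((cmod (a k))\<^sup>2) * ennreal (disk_moment R k))" for R
  proof -
    let ?F = "\<lambda>z. indicat_real (cball 0 R) z *\<^sub>R ((cmod (f z))\<^sup>2 * \<phi> (cmod z))"
    have int: "integrable lborel ?F"
      by (intro borel_integrable_compact continuous_intros entire_series_continuous[OF f]) auto
    have "(CLINT z:cball 0 R|lborel. f z * (cnj (f z) * of_real (\<phi> (cmod z)))) = (\<integral>z. complex_of_real (?F z) \<partial>lborel)"
      unfolding set_lebesgue_integral_def
      by (intro Bochner_Integration.integral_cong refl)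
        (auto simp: scaleR_conv_of_real mult.assoc[symmetric] complex_norm_square simp del: of_real_power)
    also have "\<dots> = of_real (integral\<^sup>L lborel ?F)" by (rule integral_complex_of_real)
    finally have "(\<lambda>k. a k * cnj (a k) * of_real (disk_moment R k)) sums of_real (integral\<^sup>L lborel ?F)"
      using disk_pairing[OF f f, of R] by (simp only:)
    then have "(\<lambda>k. complex_of_real ((cmod (a k))\<^sup>2 * disk_moment R k)) sums of_real (integral\<^sup>L lborel ?F)"
      by (simp only: of_real_mult complex_norm_square)
    then have "(\<lambda>k. (cmod (a k))\<^sup>2 * disk_moment R k) sums integral\<^sup>L lborel ?F"
      by (simp only: sums_of_real_iff)
    then have "(\<Sum>k. ennreal ((cmod (a k))\<^sup>2 * disk_moment R k)) = ennreal (integral\<^sup>L lborel ?F)"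
      by (intro suminf_ennreal_eq) (auto simp: disk_moment_nonneg)
    also have "\<dots> = (\<integral>\<^sup>+z. ennreal (?F z) \<partial>lborel)"
      using int by (intro nn_integral_eq_integral[symmetric]) (auto simp: nonneg)
    finally show ?thesis by (simp add: ennreal_mult disk_moment_nonneg)
  qed
  have "(\<integral>\<^sup>+z. ennreal ((cmod (f z))\<^sup>2 * \<phi> (cmod z)) \<partial>lborel)
     = (SUP N. \<Sum>k. ennreal ((cmod (a k))\<^sup>2) * ennreal (disk_moment (real N) k))"
    by (subst nn_integral_SUP_disks) (auto simp: nonneg disk)
  also have "\<dots> = (\<Sum>k. SUP N. ennreal ((cmod (a k))\<^sup>2) * ennreal (disk_moment (real N) k))"
    by (intro ennreal_suminf_SUP_eq[symmetric])
      (auto simp: incseq_def intro!: mult_left_mono ennreal_leI disk_moment_mono)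
  also have "\<dots> = (\<Sum>k. ennreal ((cmod (a k))\<^sup>2) * (\<integral>\<^sup>+z. ennreal (cmod z ^ (2 * k) * \<phi> (cmod z)) \<partial>lborel))"
    unfolding nn_integral_power_eq_SUP SUP_mult_left_ennreal ..
  finally show ?thesis .
qed

lemma disk_moment_le:
  assumes "integrable lborel (\<lambda>z::complex. cmod z ^ (2 * k) * \<phi> (cmod z))"
  shows "disk_moment R k \<le> (\<integral>z. cmod (z::complex) ^ (2 * k) * \<phi> (cmod z) \<partial>lborel)"
  unfolding disk_moment_def set_lebesgue_integral_def
  using integrable_disk_moment[of R k] assms unfolding set_integrable_def
  by (intro Bochner_Integration.integral_mono) (auto simp: nonneg split: split_indicator)

lemma disk_moment_tendsto:
  assumes "integrable lborel (\<lambda>z::complex. cmod z ^ (2 * k) * \<phi> (cmod z))"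
  shows "(\<lambda>N. disk_moment (real N) k) \<longlonglongrightarrow> (\<integral>z. cmod (z::complex) ^ (2 * k) * \<phi> (cmod z) \<partial>lborel)"
proof -
  let ?F = "\<lambda>z::complex. complex_of_real (cmod z ^ (2 * k) * \<phi> (cmod z))"
  have "(\<lambda>N. CLINT z:cball 0 (real N)|lborel. ?F z) \<longlonglongrightarrow> (\<integral>z. ?F z \<partial>lborel)"
    using assms by (intro disk_integral_tendsto integrable_of_real)
  moreover have "(CLINT z:cball 0 (real N)|lborel. ?F z) = of_real (disk_moment (real N) k)" for N
    unfolding disk_moment_def set_lebesgue_integral_def integral_complex_of_real[symmetric]
    by (intro Bochner_Integration.integral_cong refl) (simp add: scaleR_conv_of_real)
  ultimately show ?thesis by (simp only: integral_complex_of_real tendsto_of_real_iff)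
qed

text \<open>
  Integrability of the product is weaker than square integrability of both factors. This matters
  for a symbol \<open>b\<close>, which in general lies outside the Fock space.
\<close>

lemma monomial_pairing:
  assumes g: "entire_series b g" 
    and int: "integrable lborel (\<lambda>z. z ^ n * (cnj (g z) * of_real (\<phi> (cmod z))))"
    and mom: "integrable lborel (\<lambda>z::complex. cmod z ^ (2 * n) * \<phi> (cmod z))"
  shows "(\<integral>z. z ^ n * (cnj (g z) * of_real (\<phi> (cmod z))) \<partial>lborel)
    = cnj (b n) * of_real (\<integral>z. cmod (z::complex) ^ (2 * n) * \<phi> (cmod z) \<partial>lborel)"
proof (rule LIMSEQ_unique)
  show "(\<lambda>N. cnj (b n) * of_real (disk_moment (real N) n)) \<longlonglongrightarrow> (\<integral>z. z ^ n * (cnj (g z) * of_real (\<phi> (cmod z))) \<partial>lborel)"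
    using disk_integral_tendsto[OF int] by (simp only: disk_monomial_pairing[OF g])
  show "(\<lambda>N. cnj (b n) * of_real (disk_moment (real N) n)) \<longlonglongrightarrow> cnj (b n) * of_real (\<integral>z. cmod (z::complex) ^ (2 * n) * \<phi> (cmod z) \<partial>lborel)"
    by (intro tendsto_intros disk_moment_tendsto mom)
qed

end

section \<open>Bases of the Fock space and the Hilbert-Schmidt sum\<close>

lemma ennreal_suminf_commute:
  fixes f :: "nat \<Rightarrow> nat \<Rightarrow> ennreal"
  shows "(\<Sum>i. \<Sum>j. f i j) = (\<Sum>j. \<Sum>i. f i j)"
proof -
  have "(\<Sum>i. \<Sum>j. f i j) = (\<Sum>i. \<integral>\<^sup>+j. f i j \<partial>count_space UNIV)"
    by (simp add: nn_integral_count_space_nat)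
  also have "\<dots> = (\<integral>\<^sup>+j. (\<Sum>i. f i j) \<partial>count_space UNIV)"
    by (rule nn_integral_suminf[symmetric]) simp
  finally show ?thesis by (simp add: nn_integral_count_space_nat)
qed

lemma ennreal_suminf_le_if_partial_sums_le:
  fixes f g :: "nat \<Rightarrow> real"
  assumes f: "\<And>n. f n \<ge> 0" and g: "\<And>n. g n \<ge> 0"
    and bound: "\<And>B. (\<And>M. (\<Sum>m<M. g m) \<le> B) \<Longrightarrow> (\<And>N. (\<Sum>n<N. f n) \<le> B)"
  shows "(\<Sum>n. ennreal (f n)) \<le> (\<Sum>n. ennreal (g n))"
proof (cases "(\<Sum>n. ennreal (g n)) = top")
  case False
  then obtain B where B: "B \<ge> 0" "(\<Sum>n. ennreal (g n)) = ennreal B"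
    by (cases "\<Sum>n. ennreal (g n)") auto
  have "ennreal (\<Sum>m<M. g m) \<le> ennreal B" for M
    unfolding B(2)[symmetric] suminf_eq_SUP using g by (intro SUP_upper2[of M]) (auto simp: sum_ennreal)
  then have "(\<Sum>m<M. g m) \<le> B" for M using B(1) by (simp add: ennreal_le_iff)
  from bound[OF this] show ?thesis
    unfolding B(2) unfolding suminf_eq_SUP using f by (intro SUP_least) (simp add: sum_ennreal ennreal_leI)
qed simp

context
  fixes \<alpha> :: real and l :: nat
begin

lemma L2_spaceD:
  assumes "f \<in> L2_space \<alpha> l"
  shows "f \<in> borel_measurable borel"
    "integrable lborel (\<lambda>z. (cmod (f z))\<^sup>2 * exp (- \<alpha> * cmod z ^ (2 * l)))"
  using assms by (auto simp: L2_space_def)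

lemma L2_norm_nonneg: "L2_norm \<alpha> l f \<ge> 0"
  by (auto simp: L2_norm_def)

lemma L2_norm_square: "(L2_norm \<alpha> l f)\<^sup>2 = (\<integral>z. (cmod (f z))\<^sup>2 * exp (- \<alpha> * cmod z ^ (2 * l)) \<partial>lborel)"
  unfolding L2_norm_def by (intro real_sqrt_pow2 integral_nonneg_AE AE_I2) auto

lemma L2_norm_square_nn_integral:
  assumes "f \<in> L2_space \<alpha> l"
  shows "ennreal ((L2_norm \<alpha> l f)\<^sup>2) = (\<integral>\<^sup>+z. ennreal ((cmod (f z))\<^sup>2 * exp (- \<alpha> * cmod z ^ (2 * l))) \<partial>lborel)"
  unfolding L2_norm_square using L2_spaceD(2)[OF assms] by (intro nn_integral_eq_integral[symmetric]) auto

lemma L2_spaceI: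
  assumes "f \<in> borel_measurable borel"
    "(\<integral>\<^sup>+z. ennreal ((cmod (f z))\<^sup>2 * exp (- \<alpha> * cmod z ^ (2 * l))) \<partial>lborel) < \<infinity>"
  shows "f \<in> L2_space \<alpha> l"
  using assms unfolding L2_space_def by (auto intro!: integrableI_nonneg)

lemma L2_space_add:
  assumes f: "f \<in> L2_space \<alpha> l" and g: "g \<in> L2_space \<alpha> l"
  shows "(\<lambda>z. f z + g z) \<in> L2_space \<alpha> l"
proof -
  note [measurable] = L2_spaceD(1)[OF f] L2_spaceD(1)[OF g]
  let ?w = "\<lambda>z. exp (- \<alpha> * cmod z ^ (2 * l))"
  have "integrable lborel (\<lambda>z. (cmod (f z + g z))\<^sup>2 * ?w z)"
  proof (rule Bochner_Integration.integrable_bound)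
    show "integrable lborel (\<lambda>z. 2 * ((cmod (f z))\<^sup>2 * ?w z) + 2 * ((cmod (g z))\<^sup>2 * ?w z))"
      using L2_spaceD(2)[OF f] L2_spaceD(2)[OF g] by (intro Bochner_Integration.integrable_add integrable_mult_right)
    have "(cmod (f z + g z))\<^sup>2 \<le> 2 * (cmod (f z))\<^sup>2 + 2 * (cmod (g z))\<^sup>2" for z
    proof -
      have "(cmod (f z + g z))\<^sup>2 \<le> (cmod (f z) + cmod (g z))\<^sup>2"
        by (intro power_mono norm_triangle_ineq) auto
      also have "\<dots> \<le> 2 * (cmod (f z))\<^sup>2 + 2 * (cmod (g z))\<^sup>2"
        using zero_le_power2[of "cmod (f z) - cmod (g z)"] by (simp add: power2_eq_square algebra_simps)
      finally show ?thesis .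
    qed
    then have "(cmod (f z + g z))\<^sup>2 * ?w z \<le> (2 * (cmod (f z))\<^sup>2 + 2 * (cmod (g z))\<^sup>2) * ?w z" for z
      by (intro mult_right_mono) auto
    then show "AE z in lborel. norm ((cmod (f z + g z))\<^sup>2 * ?w z) \<le> norm (2 * ((cmod (f z))\<^sup>2 * ?w z) + 2 * ((cmod (g z))\<^sup>2 * ?w z))"
      by (intro AE_I2) (simp add: algebra_simps)
  qed auto
  then show ?thesis by (simp add: L2_space_def)
qed

lemma L2_space_scale:
  assumes f: "f \<in> L2_space \<alpha> l"
  shows "(\<lambda>z. c * f z) \<in> L2_space \<alpha> l"
proof -
  note [measurable] = L2_spaceD(1)[OF f]
  have "integrable lborel (\<lambda>z. (cmod c)\<^sup>2 * ((cmod (f z))\<^sup>2 * exp (- \<alpha> * cmod z ^ (2 * l))))"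
    using L2_spaceD(2)[OF f] by (intro integrable_mult_right)
  then show ?thesis by (simp add: L2_space_def norm_mult power_mult_distrib mult.assoc)
qed

lemma L2_space_cnj: "f \<in> L2_space \<alpha> l \<Longrightarrow> (\<lambda>z. cnj (f z)) \<in> L2_space \<alpha> l"
  by (auto simp: L2_space_def intro: measurable_compose[OF _ borel_measurable_continuous_onI[OF continuous_on_cnj[OF continuous_on_id]]])

lemma L2_norm_cnj: "L2_norm \<alpha> l (\<lambda>z. cnj (f z)) = L2_norm \<alpha> l f"
  by (simp add: L2_norm_def)

lemma L2_space_sum:
  assumes "\<And>i. i \<in> I \<Longrightarrow> f i \<in> L2_space \<alpha> l"
  shows "(\<lambda>z. \<Sum>i\<in>I. c i * f i z) \<in> L2_space \<alpha> l"
  using assms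
proof (induction I rule: infinite_finite_induct)
  case (insert i I)
  then show ?case using L2_space_add[OF L2_space_scale[of "f i" "c i"]] by simp
qed (auto simp: L2_space_def)

lemma L2_space_diff:
  assumes f: "f \<in> L2_space \<alpha> l" and g: "g \<in> L2_space \<alpha> l"
  shows "(\<lambda>z. f z - g z) \<in> L2_space \<alpha> l"
  using L2_space_add[OF f L2_space_scale[OF g, of "-1"]] by simp

lemma L2_inner_integrable:
  assumes f: "f \<in> L2_space \<alpha> l" and g: "g \<in> L2_space \<alpha> l"
  shows "integrable lborel (\<lambda>z. f z * cnj (g z) * of_real (exp (- \<alpha> * cmod z ^ (2 * l))))"
proof (rule Bochner_Integration.integrable_bound)
  note [measurable] = L2_spaceD(1)[OF f] L2_spaceD(1)[OF L2_space_cnj[OF g]]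
  let ?w = "\<lambda>z. exp (- \<alpha> * cmod z ^ (2 * l))"
  show "integrable lborel (\<lambda>z. (cmod (f z))\<^sup>2 * ?w z + (cmod (g z))\<^sup>2 * ?w z)"
    using L2_spaceD(2)[OF f] L2_spaceD(2)[OF g] by (intro Bochner_Integration.integrable_add)
  have "cmod (f z) * cmod (g z) \<le> (cmod (f z))\<^sup>2 + (cmod (g z))\<^sup>2" for z
  proof -
    have "0 \<le> cmod (f z) * cmod (g z)" by simp
    then show ?thesis using zero_le_power2[of "cmod (f z) - cmod (g z)"]
      unfolding power2_diff by linarith
  qed
  then have "cmod (f z) * cmod (g z) * ?w z \<le> ((cmod (f z))\<^sup>2 + (cmod (g z))\<^sup>2) * ?w z" for z
    by (intro mult_right_mono) auto
  then show "AE z in lborel. norm (f z * cnj (g z) * of_real (?w z)) \<le> norm ((cmod (f z))\<^sup>2 * ?w z + (cmod (g z))\<^sup>2 * ?w z)"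
    by (intro AE_I2) (simp add: norm_mult algebra_simps)
  show "(\<lambda>z. f z * cnj (g z) * of_real (exp (- \<alpha> * cmod z ^ (2 * l)))) \<in> borel_measurable lborel"
    by (intro borel_measurable_times measurable_compose[OF _ borel_measurable_of_real]) auto
qed

lemma L2_inner_add_left:
  assumes "f \<in> L2_space \<alpha> l" "g \<in> L2_space \<alpha> l" "h \<in> L2_space \<alpha> l"
  shows "L2_inner \<alpha> l (\<lambda>z. f z + g z) h = L2_inner \<alpha> l f h + L2_inner \<alpha> l g h"
  unfolding L2_inner_def
  using Bochner_Integration.integral_add[OF L2_inner_integrable[OF assms(1,3)] L2_inner_integrable[OF assms(2,3)]]
  by (simp add: algebra_simps)

lemma L2_inner_scale_left: "L2_inner \<alpha> l (\<lambda>z. c * f z) h = c * L2_inner \<alpha> l f h"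
  unfolding L2_inner_def by (simp add: mult.assoc)

lemma L2_inner_cnj_commute: "cnj (L2_inner \<alpha> l f g) = L2_inner \<alpha> l g f"
  unfolding L2_inner_def Bochner_Integration.integral_cnj[symmetric]
  by (intro Bochner_Integration.integral_cong refl) (simp add: mult_ac)

lemma L2_inner_cnj_args: "L2_inner \<alpha> l (\<lambda>z. cnj (f z)) (\<lambda>z. cnj (g z)) = cnj (L2_inner \<alpha> l f g)"
  unfolding L2_inner_def Bochner_Integration.integral_cnj[symmetric]
  by (intro Bochner_Integration.integral_cong refl) (simp add: mult_ac)

lemma L2_inner_self: "L2_inner \<alpha> l f f = of_real ((L2_norm \<alpha> l f)\<^sup>2)"
  unfolding L2_inner_def L2_norm_square integral_complex_of_real[symmetric]
  by (intro Bochner_Integration.integral_cong refl) (simp only: complex_norm_square of_real_mult)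

lemma L2_inner_diff_left:
  assumes "f \<in> L2_space \<alpha> l" "g \<in> L2_space \<alpha> l" "h \<in> L2_space \<alpha> l"
  shows "L2_inner \<alpha> l (\<lambda>z. f z - g z) h = L2_inner \<alpha> l f h - L2_inner \<alpha> l g h"
  using L2_inner_add_left[OF assms(1) L2_space_scale[OF assms(2), of "-1"] assms(3)]
  by (simp add: L2_inner_scale_left[of "-1", simplified])

lemma L2_inner_sum_left:
  assumes "finite I" "\<And>i. i \<in> I \<Longrightarrow> f i \<in> L2_space \<alpha> l" "h \<in> L2_space \<alpha> l"
  shows "L2_inner \<alpha> l (\<lambda>z. \<Sum>i\<in>I. c i * f i z) h = (\<Sum>i\<in>I. c i * L2_inner \<alpha> l (f i) h)"
  using assms(1,2)
proof (induction I rule: finite_induct)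
  case (insert i I)
  have "L2_inner \<alpha> l (\<lambda>z. c i * f i z + (\<Sum>i\<in>I. c i * f i z)) h
      = L2_inner \<alpha> l (\<lambda>z. c i * f i z) h + L2_inner \<alpha> l (\<lambda>z. \<Sum>i\<in>I. c i * f i z) h"
    using insert assms(3) by (intro L2_inner_add_left L2_space_scale L2_space_sum) auto
  then show ?case using insert by (simp add: L2_inner_scale_left)
qed (simp add: L2_inner_def)

lemma L2_cauchy_schwarz:
  assumes f: "f \<in> L2_space \<alpha> l" and g: "g \<in> L2_space \<alpha> l"
  shows "cmod (L2_inner \<alpha> l f g) \<le> L2_norm \<alpha> l f * L2_norm \<alpha> l g"
proof -
  let ?w = "\<lambda>z. exp (- \<alpha> * cmod z ^ (2 * l))"
  let ?a = "\<lambda>z. ennreal (cmod (f z) * sqrt (?w z))" and ?b = "\<lambda>z. ennreal (cmod (g z) * sqrt (?w z))"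
  note [measurable] = L2_spaceD(1)[OF f] L2_spaceD(1)[OF g]
  have "ennreal (cmod (L2_inner \<alpha> l f g)) \<le> (\<integral>\<^sup>+z. ennreal (cmod (f z * cnj (g z) * of_real (?w z))) \<partial>lborel)"
    unfolding L2_inner_def using L2_inner_integrable[OF f g] by (rule integral_norm_bound_ennreal)
  also have "\<dots> = (\<integral>\<^sup>+z. ?a z * ?b z \<partial>lborel)"
  proof (rule nn_integral_cong)
    fix z
    have "sqrt (?w z) * sqrt (?w z) = ?w z" by simp
    then have "cmod (f z * cnj (g z) * of_real (?w z)) = (cmod (f z) * sqrt (?w z)) * (cmod (g z) * sqrt (?w z))"
      by (simp add: norm_mult mult_ac)
    then show "ennreal (cmod (f z * cnj (g z) * of_real (?w z))) = ?a z * ?b z"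
      by (simp add: ennreal_mult)
  qed
  finally have "(ennreal (cmod (L2_inner \<alpha> l f g)))\<^sup>2 \<le> (\<integral>\<^sup>+z. ?a z * ?b z \<partial>lborel)\<^sup>2"
    by (intro power_mono) auto
  also have "\<dots> \<le> (\<integral>\<^sup>+z. (?a z)\<^sup>2 \<partial>lborel) * (\<integral>\<^sup>+z. (?b z)\<^sup>2 \<partial>lborel)"
    by (intro Cauchy_Schwarz_nn_integral) measurable
  also have "\<dots> = ennreal ((L2_norm \<alpha> l f)\<^sup>2) * ennreal ((L2_norm \<alpha> l g)\<^sup>2)"
    unfolding L2_norm_square_nn_integral[OF f] L2_norm_square_nn_integral[OF g]
    by (simp add: ennreal_power power_mult_distrib)
  finally have "(cmod (L2_inner \<alpha> l f g))\<^sup>2 \<le> (L2_norm \<alpha> l f * L2_norm \<alpha> l g)\<^sup>2"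
    by (simp add: ennreal_power power_mult_distrib flip: ennreal_mult)
  then show ?thesis using L2_norm_nonneg by (meson power2_le_imp_le mult_nonneg_nonneg)
qed

lemma Fock_L2: "f \<in> Fock \<alpha> l \<Longrightarrow> f \<in> L2_space \<alpha> l"
  by (simp add: Fock_def)

lemma Fock_add: "f \<in> Fock \<alpha> l \<Longrightarrow> g \<in> Fock \<alpha> l \<Longrightarrow> (\<lambda>z. f z + g z) \<in> Fock \<alpha> l"
  by (auto simp: Fock_def intro!: L2_space_add holomorphic_intros)

lemma Fock_scale: "f \<in> Fock \<alpha> l \<Longrightarrow> (\<lambda>z. c * f z) \<in> Fock \<alpha> l"
  by (auto simp: Fock_def intro!: L2_space_scale holomorphic_intros)

lemma Fock_sum: "(\<And>i. i \<in> I \<Longrightarrow> f i \<in> Fock \<alpha> l) \<Longrightarrow> (\<lambda>z. \<Sum>i\<in>I. c i * f i z) \<in> Fock \<alpha> l"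
  by (auto simp: Fock_def intro!: L2_space_sum holomorphic_intros)

lemma Fock_diff: "f \<in> Fock \<alpha> l \<Longrightarrow> g \<in> Fock \<alpha> l \<Longrightarrow> (\<lambda>z. f z - g z) \<in> Fock \<alpha> l"
  by (auto simp: Fock_def intro!: L2_space_diff holomorphic_intros)

lemma Fock_onbD:
  assumes "Fock_onb \<alpha> l e"
  shows "e m \<in> Fock \<alpha> l" "L2_inner \<alpha> l (e m) (e n) = (if m = n then 1 else 0)"
    "f \<in> Fock \<alpha> l \<Longrightarrow> (\<lambda>N. L2_norm \<alpha> l (\<lambda>z. f z - (\<Sum>m<N. L2_inner \<alpha> l f (e m) * e m z))) \<longlonglongrightarrow> 0"
  using assms by (auto simp: Fock_onb_def)

lemma L2_norm_square_orthonormal_sum: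
  assumes e: "Fock_onb \<alpha> l e"
  shows "(L2_norm \<alpha> l (\<lambda>z. \<Sum>m<N. c m * e m z))\<^sup>2 = (\<Sum>m<(N::nat). (cmod (c m))\<^sup>2)"
proof -
  let ?S = "\<lambda>z. \<Sum>m<N. c m * e m z"
  note eL = Fock_L2[OF Fock_onbD(1)[OF e]]
  have SL: "?S \<in> L2_space \<alpha> l" using eL by (intro L2_space_sum)
  have inner_S: "L2_inner \<alpha> l ?S (e n) = c n" if "n < N" for n
    using that eL by (simp add: L2_inner_sum_left Fock_onbD(2)[OF e] if_distrib[of "\<lambda>x. c _ * x"] sum.delta cong: if_cong)
  have "complex_of_real ((L2_norm \<alpha> l ?S)\<^sup>2) = (\<Sum>m<N. c m * L2_inner \<alpha> l (e m) ?S)"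
    unfolding L2_inner_self[symmetric] using eL SL by (subst L2_inner_sum_left) auto
  also have "\<dots> = (\<Sum>m<N. c m * cnj (c m))"
    using inner_S by (intro sum.cong refl) (simp flip: L2_inner_cnj_commute[of ?S])
  also have "\<dots> = of_real (\<Sum>m<N. (cmod (c m))\<^sup>2)"
    by (simp add: complex_norm_square del: of_real_power)
  finally show ?thesis by (simp only: of_real_eq_iff)
qed

lemma orthonormal_remainder:
  assumes e: "Fock_onb \<alpha> l e" and f: "f \<in> Fock \<alpha> l"
  shows "(L2_norm \<alpha> l (\<lambda>z. f z - (\<Sum>m<N. L2_inner \<alpha> l f (e m) * e m z)))\<^sup>2
    = (L2_norm \<alpha> l f)\<^sup>2 - (\<Sum>m<(N::nat). (cmod (L2_inner \<alpha> l f (e m)))\<^sup>2)"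
proof -
  let ?c = "\<lambda>m. L2_inner \<alpha> l f (e m)"
  let ?S = "\<lambda>z. \<Sum>m<N. ?c m * e m z" and ?A = "\<Sum>m<N. (cmod (?c m))\<^sup>2"
  note eL = Fock_L2[OF Fock_onbD(1)[OF e]] and fL = Fock_L2[OF f]
  have SL: "?S \<in> L2_space \<alpha> l" using eL by (intro L2_space_sum)
  have DL: "(\<lambda>z. f z - ?S z) \<in> L2_space \<alpha> l" using fL SL by (rule L2_space_diff)
  have Sf: "L2_inner \<alpha> l ?S f = of_real ?A"
  proof -
    have "L2_inner \<alpha> l ?S f = (\<Sum>m<N. ?c m * L2_inner \<alpha> l (e m) f)"
      using eL fL by (intro L2_inner_sum_left) auto
    also have "\<dots> = (\<Sum>m<N. ?c m * cnj (?c m))" by (simp add: L2_inner_cnj_commute)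
    finally show ?thesis by (simp add: complex_norm_square del: of_real_power)
  qed
  then have fS: "L2_inner \<alpha> l f ?S = of_real ?A"
    using L2_inner_cnj_commute[of ?S f] by simp
  have SS: "L2_inner \<alpha> l ?S ?S = of_real ?A"
    unfolding L2_inner_self L2_norm_square_orthonormal_sum[OF e] ..
  have "complex_of_real ((L2_norm \<alpha> l (\<lambda>z. f z - ?S z))\<^sup>2)
      = L2_inner \<alpha> l f (\<lambda>z. f z - ?S z) - L2_inner \<alpha> l ?S (\<lambda>z. f z - ?S z)"
    unfolding L2_inner_self[symmetric] by (rule L2_inner_diff_left[OF fL SL DL])
  also have "L2_inner \<alpha> l f (\<lambda>z. f z - ?S z) = cnj (L2_inner \<alpha> l f f - L2_inner \<alpha> l ?S f)"
    unfolding L2_inner_diff_left[OF fL SL fL, symmetric] by (simp only: L2_inner_cnj_commute)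
  also have "L2_inner \<alpha> l ?S (\<lambda>z. f z - ?S z) = cnj (L2_inner \<alpha> l f ?S - L2_inner \<alpha> l ?S ?S)"
    unfolding L2_inner_diff_left[OF fL SL SL, symmetric] by (simp only: L2_inner_cnj_commute)
  finally have "complex_of_real ((L2_norm \<alpha> l (\<lambda>z. f z - ?S z))\<^sup>2) = of_real ((L2_norm \<alpha> l f)\<^sup>2 - ?A)"
    unfolding fS SS Sf L2_inner_self[of f] by simp
  then show ?thesis by (simp only: of_real_eq_iff)
qed

lemma Fock_onb_parseval:
  assumes e: "Fock_onb \<alpha> l e" and f: "f \<in> Fock \<alpha> l"
  shows "(\<lambda>m. (cmod (L2_inner \<alpha> l f (e m)))\<^sup>2) sums (L2_norm \<alpha> l f)\<^sup>2"
proof -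
  have "(\<lambda>N. (L2_norm \<alpha> l f)\<^sup>2 - (L2_norm \<alpha> l (\<lambda>z. f z - (\<Sum>m<N. L2_inner \<alpha> l f (e m) * e m z)))\<^sup>2)
     \<longlonglongrightarrow> (L2_norm \<alpha> l f)\<^sup>2 - 0\<^sup>2"
    by (intro tendsto_intros Fock_onbD(3)[OF e f])
  then show ?thesis unfolding sums_def orthonormal_remainder[OF e f] by simp
qed

lemma bessel_inequality:
  assumes e: "Fock_onb \<alpha> l e" and f: "f \<in> Fock \<alpha> l"
  shows "(\<Sum>m<N. (cmod (L2_inner \<alpha> l f (e m)))\<^sup>2) \<le> (L2_norm \<alpha> l f)\<^sup>2"
  using orthonormal_remainder[OF e f, of N]
    zero_le_power2[of "L2_norm \<alpha> l (\<lambda>z. f z - (\<Sum>m<N. L2_inner \<alpha> l f (e m) * e m z))"]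
  by linarith

text \<open>
  For an orthonormal basis the sum of the \<open>\<bar>\<Lambda> (e n)\<bar>\<^sup>2\<close> is the squared norm of the functional
  \<open>\<Lambda>\<close>, whatever the basis. To see one inequality, test \<open>\<Lambda>\<close> on the combination \<open>f\<close> of the \<open>e n\<close>
  with coefficients \<open>cnj (\<Lambda> (e n))\<close>: then \<open>\<Lambda> f\<close> and the squared norm of \<open>f\<close> are both the partial
  sum \<open>S\<close>, while expanding \<open>f\<close> in the other basis and applying Cauchy-Schwarz gives
  \<open>S \<le> sqrt S * sqrt B\<close>.
\<close>

lemma functional_square_sum_le:
  assumes e: "Fock_onb \<alpha> l e" and e': "Fock_onb \<alpha> l e'"
    and add: "\<And>f g. f \<in> Fock \<alpha> l \<Longrightarrow> g \<in> Fock \<alpha> l \<Longrightarrow> \<Lambda> (\<lambda>z. f z + g z) = \<Lambda> f + \<Lambda> g"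
    and scale: "\<And>f c. f \<in> Fock \<alpha> l \<Longrightarrow> \<Lambda> (\<lambda>z. c * f z) = c * (\<Lambda> f :: complex)"
    and bounded: "\<And>f. f \<in> Fock \<alpha> l \<Longrightarrow> cmod (\<Lambda> f) \<le> C * L2_norm \<alpha> l f"
    and B: "\<And>M. (\<Sum>m<M. (cmod (\<Lambda> (e' m)))\<^sup>2) \<le> B"
  shows "(\<Sum>n<(N::nat). (cmod (\<Lambda> (e n)))\<^sup>2) \<le> B"
proof -
  have zero: "\<Lambda> (\<lambda>z. 0) = 0" using scale[of "e 0" 0] Fock_onbD(1)[OF e] by simp
  have lin: "\<Lambda> (\<lambda>z. \<Sum>m<M. c m * u m z) = (\<Sum>m<M. c m * \<Lambda> (u m))" if "Fock_onb \<alpha> l u" for M :: nat and c u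
  proof (induction M)
    case (Suc M)
    have "\<Lambda> (\<lambda>z. (\<Sum>m<M. c m * u m z) + c M * u M z) = \<Lambda> (\<lambda>z. \<Sum>m<M. c m * u m z) + \<Lambda> (\<lambda>z. c M * u M z)"
      using Fock_onbD(1)[OF that] by (intro add Fock_sum Fock_scale)
    then show ?case using Suc scale[OF Fock_onbD(1)[OF that]] by simp
  qed (simp add: zero)
  define S where "S = (\<Sum>n<N. (cmod (\<Lambda> (e n)))\<^sup>2)"
  have S0: "S \<ge> 0" by (simp add: S_def sum_nonneg)
  have B0: "B \<ge> 0" using B[of 0] by simp
  \<comment> \<open>The extremal element for \<open>\<Lambda>\<close> in the span of \<open>e 0, ..., e (N - 1)\<close>.\<close>
  define f where "f = (\<lambda>z. \<Sum>n<N. cnj (\<Lambda> (e n)) * e n z)"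
  have fF: "f \<in> Fock \<alpha> l" unfolding f_def using Fock_onbD(1)[OF e] by (intro Fock_sum)
  have nf: "(L2_norm \<alpha> l f)\<^sup>2 = S" unfolding f_def L2_norm_square_orthonormal_sum[OF e] S_def by simp
  have "\<Lambda> f = of_real S"
    unfolding f_def lin[OF e] S_def of_real_sum complex_norm_square
    by (intro sum.cong refl) (rule mult.commute)
  define P where "P = (\<lambda>M z. \<Sum>m<M. L2_inner \<alpha> l f (e' m) * e' m z)"
  have PF: "P M \<in> Fock \<alpha> l" for M unfolding P_def using Fock_onbD(1)[OF e'] by (intro Fock_sum)
  have "(\<lambda>M. \<Lambda> (\<lambda>z. f z - P M z)) \<longlonglongrightarrow> 0"
  proof (rule tendsto_norm_zero_cancel, rule tendsto_sandwich[OF _ _ tendsto_const[of 0]])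
    show "(\<lambda>M. C * L2_norm \<alpha> l (\<lambda>z. f z - P M z)) \<longlonglongrightarrow> 0"
      using tendsto_mult_left[OF Fock_onbD(3)[OF e' fF], of C] by (simp add: P_def)
    show "\<forall>\<^sub>F M in sequentially. cmod (\<Lambda> (\<lambda>z. f z - P M z)) \<le> C * L2_norm \<alpha> l (\<lambda>z. f z - P M z)"
      by (intro always_eventually allI bounded Fock_diff fF PF)
  qed auto
  moreover have "\<Lambda> (\<lambda>z. f z - P M z) = \<Lambda> f - \<Lambda> (P M)" for M
    using add[OF fF Fock_scale[OF PF[of M], of "-1"]] scale[OF PF[of M], of "-1"] by simp
  ultimately have "(\<lambda>M. \<Lambda> f - \<Lambda> (P M)) \<longlonglongrightarrow> 0" by simp
  from tendsto_diff[OF tendsto_const[of "\<Lambda> f"] this] have "(\<lambda>M. \<Lambda> (P M)) \<longlonglongrightarrow> \<Lambda> f" by simp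
  then have lim: "(\<lambda>M. cmod (\<Lambda> (P M))) \<longlonglongrightarrow> S"
    using \<open>\<Lambda> f = of_real S\<close> S0 tendsto_norm by fastforce
  have "cmod (\<Lambda> (P M)) \<le> sqrt S * sqrt B" for M
  proof -
    have "cmod (\<Lambda> (P M)) \<le> (\<Sum>m<M. \<bar>cmod (L2_inner \<alpha> l f (e' m))\<bar> * \<bar>cmod (\<Lambda> (e' m))\<bar>)"
      unfolding P_def lin[OF e'] by (rule order_trans[OF norm_sum]) (simp add: norm_mult)
    also have "\<dots> \<le> L2_set (\<lambda>m. cmod (L2_inner \<alpha> l f (e' m))) {..<M} * L2_set (\<lambda>m. cmod (\<Lambda> (e' m))) {..<M}"
      by (rule L2_set_mult_ineq)
    also have "\<dots> \<le> sqrt S * sqrt B"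
      unfolding L2_set_def nf[symmetric] using bessel_inequality[OF e' fF] B
      by (intro mult_mono real_sqrt_le_mono) (auto intro!: sum_nonneg)
    finally show ?thesis .
  qed
  then have "S \<le> sqrt S * sqrt B" by (intro LIMSEQ_le_const2[OF lim]) auto
  then have le: "sqrt S * sqrt S \<le> sqrt S * sqrt B" using S0 by simp
  have "sqrt S \<le> sqrt B"
  proof (cases "S = 0")
    case False
    then have "sqrt S > 0" using S0 by simp
    with le show ?thesis by (rule mult_left_le_imp_le)
  qed (use B0 in simp)
  then show ?thesis by (simp add: S_def)
qed

lemma cnj_Fock_parseval:
  assumes e: "Fock_onb \<alpha> l e" and v: "v \<in> cnj_Fock \<alpha> l"
  shows "ennreal ((L2_norm \<alpha> l v)\<^sup>2) = (\<Sum>k. ennreal ((cmod (L2_inner \<alpha> l v (\<lambda>z. cnj (e k z))))\<^sup>2))"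
proof -
  obtain g where g: "g \<in> Fock \<alpha> l" and vg: "v = (\<lambda>z. cnj (g z))" using v by (auto simp: cnj_Fock_def)
  show ?thesis
    using Fock_onb_parseval[OF e g] unfolding vg L2_inner_cnj_args L2_norm_cnj
    by (subst suminf_ennreal_eq) auto
qed

lemma cnj_Fock_L2: "v \<in> cnj_Fock \<alpha> l \<Longrightarrow> v \<in> L2_space \<alpha> l"
  by (auto simp: cnj_Fock_def intro!: L2_space_cnj dest: Fock_L2)

text \<open>
  Expanding each \<open>T (e m)\<close> in the conjugated basis turns the sum into a double sum of squared
  values of the functionals \<open>f \<mapsto> \<langle>T f, v\<rangle>\<close>. Summed over \<open>m\<close> first, each of them is independent
  of the basis. Working with functionals takes the place of the adjoint operator.
\<close>

lemma hilbert_schmidt_sum_basis_independent: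
  assumes T: "Fock_bounded_op \<alpha> l T" and e: "Fock_onb \<alpha> l e" and e': "Fock_onb \<alpha> l e'"
  shows "(\<Sum>m. ennreal ((L2_norm \<alpha> l (T (e m)))\<^sup>2)) = (\<Sum>m. ennreal ((L2_norm \<alpha> l (T (e' m)))\<^sup>2))"
proof -
  have T1: "T f \<in> cnj_Fock \<alpha> l" if "f \<in> Fock \<alpha> l" for f using T that by (auto simp: Fock_bounded_op_def)
  obtain C where C: "\<And>f. f \<in> Fock \<alpha> l \<Longrightarrow> L2_norm \<alpha> l (T f) \<le> C * L2_norm \<alpha> l f"
    using T unfolding Fock_bounded_op_def by blast
  have le: "(\<Sum>m. ennreal ((cmod (L2_inner \<alpha> l (T (u m)) v))\<^sup>2)) \<le> (\<Sum>m. ennreal ((cmod (L2_inner \<alpha> l (T (u' m)) v))\<^sup>2))"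
    if u: "Fock_onb \<alpha> l u" and u': "Fock_onb \<alpha> l u'" and v: "v \<in> L2_space \<alpha> l" for u u' v
  proof (rule ennreal_suminf_le_if_partial_sums_le)
    fix B N assume B: "\<And>M. (\<Sum>m<M. (cmod (L2_inner \<alpha> l (T (u' m)) v))\<^sup>2) \<le> B"
    show "(\<Sum>n<N. (cmod (L2_inner \<alpha> l (T (u n)) v))\<^sup>2) \<le> B"
    proof (rule functional_square_sum_le[OF u u', where \<Lambda> = "\<lambda>f. L2_inner \<alpha> l (T f) v" and C = "C * L2_norm \<alpha> l v"])
      fix f g assume f: "f \<in> Fock \<alpha> l" and g: "g \<in> Fock \<alpha> l"
      have "T (\<lambda>z. f z + g z) = (\<lambda>z. T f z + T g z)" using T f g by (auto simp: Fock_bounded_op_def)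
      then show "L2_inner \<alpha> l (T (\<lambda>z. f z + g z)) v = L2_inner \<alpha> l (T f) v + L2_inner \<alpha> l (T g) v"
        using T1 f g v by (simp add: L2_inner_add_left cnj_Fock_L2)
    next
      fix f c assume f: "f \<in> Fock \<alpha> l"
      have "T (\<lambda>z. c * f z) = (\<lambda>z. c * T f z)" using T f by (auto simp: Fock_bounded_op_def)
      then show "L2_inner \<alpha> l (T (\<lambda>z. c * f z)) v = c * L2_inner \<alpha> l (T f) v"
        by (simp add: L2_inner_scale_left)
    next
      fix f assume f: "f \<in> Fock \<alpha> l"
      have "cmod (L2_inner \<alpha> l (T f) v) \<le> L2_norm \<alpha> l (T f) * L2_norm \<alpha> l v"
        by (intro L2_cauchy_schwarz cnj_Fock_L2 T1 f v)
      also have "\<dots> \<le> C * L2_norm \<alpha> l f * L2_norm \<alpha> l v"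
        using C[OF f] L2_norm_nonneg by (intro mult_right_mono)
      finally show "cmod (L2_inner \<alpha> l (T f) v) \<le> C * L2_norm \<alpha> l v * L2_norm \<alpha> l f"
        by (simp add: mult_ac)
    qed (rule B)
  qed auto
  let ?v = "\<lambda>k z. cnj (e k z)"
  have vL: "?v k \<in> L2_space \<alpha> l" for k using Fock_onbD(1)[OF e] by (intro L2_space_cnj Fock_L2)
  have double: "(\<Sum>m. ennreal ((L2_norm \<alpha> l (T (u m)))\<^sup>2))
      = (\<Sum>k. \<Sum>m. ennreal ((cmod (L2_inner \<alpha> l (T (u m)) (?v k)))\<^sup>2))" if u: "Fock_onb \<alpha> l u" for u
    by (subst ennreal_suminf_commute) (simp only: cnj_Fock_parseval[OF e T1[OF Fock_onbD(1)[OF u]]])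
  show ?thesis
    unfolding double[OF e] double[OF e']
    using le[OF e e' vL] le[OF e' e vL] by (intro arg_cong[where f = suminf] ext antisym)
qed

lemma hilbert_schmidt_in_basis:
  assumes T: "hilbert_schmidt \<alpha> l T" and u: "Fock_onb \<alpha> l u"
  shows "summable (\<lambda>m. (L2_norm \<alpha> l (T (u m)))\<^sup>2)"
    and "hilbert_schmidt_norm \<alpha> l T = sqrt (\<Sum>m. (L2_norm \<alpha> l (T (u m)))\<^sup>2)"
proof -
  obtain e where bd: "Fock_bounded_op \<alpha> l T" and e: "Fock_onb \<alpha> l e"
    and s: "summable (\<lambda>m. (L2_norm \<alpha> l (T (e m)))\<^sup>2)"
    using T by (auto simp: hilbert_schmidt_def)
  have *: "summable (\<lambda>m. (L2_norm \<alpha> l (T (u m)))\<^sup>2) \<and>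
     (\<Sum>m. (L2_norm \<alpha> l (T (u m)))\<^sup>2) = (\<Sum>m. (L2_norm \<alpha> l (T (e m)))\<^sup>2)" if u: "Fock_onb \<alpha> l u" for u
  proof -
    have eq: "(\<Sum>m. ennreal ((L2_norm \<alpha> l (T (u m)))\<^sup>2)) = ennreal (\<Sum>m. (L2_norm \<alpha> l (T (e m)))\<^sup>2)"
      unfolding hilbert_schmidt_sum_basis_independent[OF bd u e] using s by (intro suminf_ennreal2) auto
    then have su: "summable (\<lambda>m. (L2_norm \<alpha> l (T (u m)))\<^sup>2)"
      by (intro summable_suminf_not_top) auto
    have "ennreal (\<Sum>m. (L2_norm \<alpha> l (T (u m)))\<^sup>2) = ennreal (\<Sum>m. (L2_norm \<alpha> l (T (e m)))\<^sup>2)"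
      unfolding eq[symmetric] using su by (intro suminf_ennreal2[symmetric]) auto
    then show ?thesis using su s by (auto simp: suminf_nonneg)
  qed
  show "summable (\<lambda>m. (L2_norm \<alpha> l (T (u m)))\<^sup>2)" using *[OF u] by simp
  have "Fock_onb \<alpha> l (SOME e. Fock_onb \<alpha> l e)" using someI[of "Fock_onb \<alpha> l", OF u] .
  then show "hilbert_schmidt_norm \<alpha> l T = sqrt (\<Sum>m. (L2_norm \<alpha> l (T (u m)))\<^sup>2)"
    unfolding hilbert_schmidt_norm_def using *[OF u] * by simp
qed

end

section \<open>Moments, the Bergman kernel and the two coefficient weights\<close>

definition moment :: "real \<Rightarrow> nat \<Rightarrow> nat \<Rightarrow> real" where
  "moment \<alpha> l k = (\<integral>z. cmod z ^ (2 * k) * exp (- \<alpha> * cmod z ^ (2 * l)) \<partial>lborel)"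

lemma
  assumes "\<alpha> > 0" "l \<ge> 1"
  shows moment_integrable: "integrable lborel (\<lambda>z::complex. cmod z ^ (2 * k) * exp (- \<alpha> * cmod z ^ (2 * l)))"
    and nn_integral_moment: "(\<integral>\<^sup>+z. ennreal (cmod z ^ (2 * k) * exp (- \<alpha> * cmod z ^ (2 * l))) \<partial>lborel) = ennreal (moment \<alpha> l k)"
    and moment_eq: "moment \<alpha> l k = pi / real l * \<alpha> powr (- (real (k + 1) / real l)) * Gamma (real (k + 1) / real l)"
    and moment_pos: "moment \<alpha> l k > 0"
proof -
  let ?I = "pi / real l * \<alpha> powr (- (real (k + 1) / real l)) * Gamma (real (k + 1) / real l)"
  have pos: "?I > 0" using assms by (intro mult_pos_pos Gamma_real_pos) auto
  have "integrable lborel (\<lambda>z::complex. cmod z ^ (2 * k) * exp (- \<alpha> * cmod z ^ (2 * l))) \<and> moment \<alpha> l k = ?I"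
    unfolding moment_def
    by (rule nn_integral_eq_integrable[THEN iffD1])
      (use pos nn_integral_radial_power[OF assms, of k] in auto)
  then show int: "integrable lborel (\<lambda>z::complex. cmod z ^ (2 * k) * exp (- \<alpha> * cmod z ^ (2 * l)))" and eq: "moment \<alpha> l k = ?I"
    by auto
  show "moment \<alpha> l k > 0" using eq pos by simp
  show "(\<integral>\<^sup>+z. ennreal (cmod z ^ (2 * k) * exp (- \<alpha> * cmod z ^ (2 * l))) \<partial>lborel) = ennreal (moment \<alpha> l k)"
    unfolding eq by (rule nn_integral_radial_power[OF assms])
qed

text \<open>
  The right-hand side only keeps the annulus of radii between \<open>R\<close> and \<open>R + 1\<close>, whose area is at
  least \<open>pi\<close>.
\<close>

lemma moment_lower_bound:
  assumes "\<alpha> > 0" "l \<ge> 1" and R: "R \<ge> 0"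
  shows "R ^ (2 * k) * (pi * exp (- \<alpha> * (R + 1) ^ (2 * l))) \<le> moment \<alpha> l k"
proof -
  let ?A = "cball (0::complex) (R + 1) - cball 0 R"
  let ?c = "R ^ (2 * k) * exp (- \<alpha> * (R + 1) ^ (2 * l))"
  have fin: "emeasure lborel ?A < \<infinity>"
    by (intro emeasure_bounded_finite bounded_diff bounded_cball)
  have "measure lborel ?A = measure lborel (cball (0::complex) (R + 1)) - measure lborel (cball (0::complex) R)"
    using emeasure_lborel_cball_finite[of "0::complex" "R + 1"]
    by (intro measure_Diff) auto
  also have "\<dots> = pi * (R + 1)\<^sup>2 - pi * R\<^sup>2"
    using R by (simp add: content_cball unit_ball_vol_2)
  finally have "pi \<le> measure lborel ?A"
    using R by (simp add: power2_eq_square algebra_simps)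
  then have "?c * pi \<le> ?c * measure lborel ?A" using R by (intro mult_left_mono) auto
  also have "\<dots> = (\<integral>z. ?c * indicator ?A z \<partial>lborel)" by simp
  also have "\<dots> \<le> moment \<alpha> l k" unfolding moment_def
  proof (rule Bochner_Integration.integral_mono)
    show "integrable lborel (\<lambda>z. ?c * indicator ?A z)"
      using fin by (intro integrable_mult_right integrable_real_indicator) auto
    show "?c * indicator ?A z \<le> cmod z ^ (2 * k) * exp (- \<alpha> * cmod z ^ (2 * l))" for z
    proof (cases "z \<in> ?A")
      case True
      then have z: "R \<le> cmod z" "cmod z \<le> R + 1" by auto
      have "R ^ (2 * k) \<le> cmod z ^ (2 * k)" using z R by (intro power_mono)
      moreover have "cmod z ^ (2 * l) \<le> (R + 1) ^ (2 * l)" using z by (intro power_mono) auto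
      then have "exp (- \<alpha> * (R + 1) ^ (2 * l)) \<le> exp (- \<alpha> * cmod z ^ (2 * l))" using assms by simp
      ultimately show ?thesis using True R by (simp add: mult_mono)
    qed simp
  qed (rule moment_integrable[OF assms(1,2)])
  finally show ?thesis by (simp add: mult_ac)
qed

text \<open>
  The lower bound with \<open>R\<^sup>2 = 2 * t\<close> makes the series geometric with ratio \<open>1 / 2\<close>.
\<close>

lemma
  assumes "\<alpha> > 0" "l \<ge> 1" and t: "t \<ge> 0"
  shows moment_series_summable: "summable (\<lambda>m. t ^ m / moment \<alpha> l m)"
    and moment_series_le: "(\<Sum>m. t ^ m / moment \<alpha> l m) \<le> 2 / pi * exp (\<alpha> * (sqrt (2 * t) + 1) ^ (2 * l))"
proof -
  let ?J = "pi * exp (- \<alpha> * (sqrt (2 * t) + 1) ^ (2 * l))"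
  have J: "?J > 0" by simp
  have le: "t ^ m / moment \<alpha> l m \<le> (1 / 2) ^ m * (1 / ?J)" for m
  proof -
    have "sqrt (2 * t) ^ (2 * m) = (2 * t) ^ m" using t by (simp add: power_mult)
    then have "(2 * t) ^ m * ?J \<le> moment \<alpha> l m"
      using moment_lower_bound[OF assms(1,2), of "sqrt (2 * t)" m] t by simp
    then have "t ^ m * ?J \<le> (1 / 2) ^ m * moment \<alpha> l m"
      by (simp add: power_mult_distrib power_one_over field_simps)
    then show ?thesis using J moment_pos[OF assms(1,2), of m] by (simp add: field_simps)
  qed
  have nn: "t ^ m / moment \<alpha> l m \<ge> 0" for m
    using t moment_pos[OF assms(1,2), of m] by simp
  have geo: "(\<lambda>m. (1 / 2) ^ m * (1 / ?J)) sums (1 / (1 - 1 / 2) * (1 / ?J))"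
    by (intro sums_mult2 geometric_sums) simp
  show s: "summable (\<lambda>m. t ^ m / moment \<alpha> l m)"
    using le nn by (intro summable_comparison_test'[OF sums_summable[OF geo], of 0]) (simp only: real_norm_def abs_of_nonneg)
  have "(\<Sum>m. t ^ m / moment \<alpha> l m) \<le> 1 / (1 - 1 / 2) * (1 / ?J)"
    using suminf_le[OF le s sums_summable[OF geo]] unfolding sums_unique[OF geo, symmetric] .
  also have "\<dots> = 2 / pi * exp (\<alpha> * (sqrt (2 * t) + 1) ^ (2 * l))"
    by (simp add: exp_minus field_simps)
  finally show "(\<Sum>m. t ^ m / moment \<alpha> l m) \<le> 2 / pi * exp (\<alpha> * (sqrt (2 * t) + 1) ^ (2 * l))" .
qed

text \<open>
  The left-hand side grows like \<open>r ^ l\<close>, so it is eventually below any multiple of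
  \<open>r ^ (2 * l)\<close>.
\<close>

lemma subcritical_exponent_bound:
  fixes \<alpha> \<rho> :: real
  assumes "\<alpha> > 0" "l \<ge> 1" and \<rho>: "\<rho> \<ge> 0"
  shows "\<exists>C. \<forall>r\<ge>0. \<alpha> * (sqrt (2 * (\<rho> * r)) + 1) ^ (2 * l) \<le> \<alpha> / 4 * r ^ (2 * l) + C"
proof (intro exI allI impI)
  fix r :: real assume r: "r \<ge> 0"
  \<comment> \<open>Beyond this radius the linear base \<open>4 * \<rho> * r + 2\<close> is at most \<open>r\<^sup>2 / 4\<close>.\<close>
  define r0 where "r0 = 16 * \<rho> + 4"
  have "(sqrt (2 * (\<rho> * r)) + 1)\<^sup>2 \<le> 4 * \<rho> * r + 2"
  proof -
    have "0 \<le> (sqrt (2 * (\<rho> * r)) - 1)\<^sup>2" by simp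
    then have "(sqrt (2 * (\<rho> * r)) + 1)\<^sup>2 \<le> 2 * (sqrt (2 * (\<rho> * r)))\<^sup>2 + 2"
      by (simp add: power2_eq_square algebra_simps)
    then show ?thesis using r \<rho> by simp
  qed
  then have base: "(sqrt (2 * (\<rho> * r)) + 1) ^ (2 * l) \<le> (4 * \<rho> * r + 2) ^ l"
    unfolding power_mult by (intro power_mono) auto
  show "\<alpha> * (sqrt (2 * (\<rho> * r)) + 1) ^ (2 * l) \<le> \<alpha> / 4 * r ^ (2 * l) + \<alpha> * (4 * \<rho> * r0 + 2) ^ l"
  proof (cases "r \<le> r0")
    case True
    have "(4 * \<rho> * r + 2) ^ l \<le> (4 * \<rho> * r0 + 2) ^ l"
      using True \<rho> r by (intro power_mono) (auto intro!: mult_left_mono)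
    with base have "\<alpha> * (sqrt (2 * (\<rho> * r)) + 1) ^ (2 * l) \<le> \<alpha> * (4 * \<rho> * r0 + 2) ^ l"
      using assms by (intro mult_left_mono) auto
    then show ?thesis using assms r by (simp add: add_increasing)
  next
    case False
    then have "(16 * \<rho> + 4) * r \<le> r * r" using r by (intro mult_right_mono) (auto simp: r0_def)
    moreover have "r \<ge> 4" using False \<rho> by (simp add: r0_def)
    ultimately have "4 * \<rho> * r + 2 \<le> r\<^sup>2 / 4" by (simp add: power2_eq_square algebra_simps)
    then have "(4 * \<rho> * r + 2) ^ l \<le> (r\<^sup>2 / 4) ^ l" using \<rho> r by (intro power_mono) auto
    also have "\<dots> = r ^ (2 * l) / 4 ^ l" by (simp add: power_divide power_mult)
    also have "\<dots> \<le> r ^ (2 * l) / 4"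
    proof -
      have "(4::real) ^ 1 \<le> 4 ^ l" using assms by (intro power_increasing) auto
      then show ?thesis using r by (intro divide_left_mono) auto
    qed
    finally have "\<alpha> * (sqrt (2 * (\<rho> * r)) + 1) ^ (2 * l) \<le> \<alpha> * (r ^ (2 * l) / 4)"
      using base assms by (intro mult_left_mono) auto
    moreover have "\<alpha> * (4 * \<rho> * r0 + 2) ^ l \<ge> 0" using assms by (simp add: r0_def)
    ultimately show ?thesis by simp
  qed
qed

text \<open>
  For fixed \<open>z\<close> the kernel uses up at most \<open>\<alpha> / 4\<close> of the exponent \<open>\<alpha>\<close> of the weight.
\<close>

lemma kernel_majorant:
  fixes z :: complex
  assumes "\<alpha> > 0" "l \<ge> 1"
  shows "\<exists>C. \<forall>w. (\<Sum>m. (cmod z * cmod w) ^ m / moment \<alpha> l m) \<le> C * exp (\<alpha> / 4 * cmod w ^ (2 * l))"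
proof -
  obtain C where C: "\<And>r. r \<ge> 0 \<Longrightarrow> \<alpha> * (sqrt (2 * (cmod z * r)) + 1) ^ (2 * l) \<le> \<alpha> / 4 * r ^ (2 * l) + C"
    using subcritical_exponent_bound[OF assms, of "cmod z"] by auto
  have "(\<Sum>m. (cmod z * cmod w) ^ m / moment \<alpha> l m) \<le> 2 / pi * exp C * exp (\<alpha> / 4 * cmod w ^ (2 * l))" for w
  proof -
    have "(\<Sum>m. (cmod z * cmod w) ^ m / moment \<alpha> l m) \<le> 2 / pi * exp (\<alpha> * (sqrt (2 * (cmod z * cmod w)) + 1) ^ (2 * l))"
      using assms by (intro moment_series_le) auto
    also have "\<dots> \<le> 2 / pi * exp (\<alpha> / 4 * cmod w ^ (2 * l) + C)"
      using C[of "cmod w"] by (intro mult_left_mono) auto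
    finally show ?thesis by (simp add: exp_add mult_ac)
  qed
  then show ?thesis by blast
qed

text \<open>
  The coefficients of the kernel are the reciprocals of the moments.
\<close>

lemma Bergman_kernel_sums:
  assumes "\<alpha> > 0" "l \<ge> 1"
  shows "(\<lambda>m. w ^ m * cnj z ^ m / of_real (moment \<alpha> l m)) sums Bergman_kernel \<alpha> l w z"
proof -
  let ?c = "complex_of_real (real l * \<alpha> powr (1 / real l) / pi)"
  let ?t = "\<lambda>m. complex_of_real (\<alpha> powr (real m / real l)) * w ^ m * cnj z ^ m / of_real (Gamma (real (m + 1) / real l))"
  have c0: "?c \<noteq> 0" using assms by simp
  have "(1::real) / moment \<alpha> l m = (real l * \<alpha> powr (1 / real l) / pi) * (\<alpha> powr (real m / real l) / Gamma (real (m + 1) / real l))" for m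
  proof -
    have "\<alpha> powr (- (real (m + 1) / real l)) = 1 / (\<alpha> powr (1 / real l) * \<alpha> powr (real m / real l))"
      unfolding powr_add[symmetric] powr_minus_divide[symmetric] by (simp add: add_divide_distrib)
    moreover have "1 / (p / L * (1 / (a * b)) * G) = L * a / p * (b / G)" if "L > 0" "p > 0" "a > 0" for p L a b G :: real
      using that by (simp add: field_simps)
    ultimately show ?thesis unfolding moment_eq[OF assms] using assms by simp
  qed
  then have eq: "w ^ m * cnj z ^ m / of_real (moment \<alpha> l m) = ?c * ?t m" for m
  proof -
    assume *: "\<And>m. (1::real) / moment \<alpha> l m = (real l * \<alpha> powr (1 / real l) / pi) * (\<alpha> powr (real m / real l) / Gamma (real (m + 1) / real l))"
    have "w ^ m * cnj z ^ m / of_real (moment \<alpha> l m) = w ^ m * cnj z ^ m * of_real (1 / moment \<alpha> l m)"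
      by simp
    also have "\<dots> = ?c * ?t m" unfolding * by simp
    finally show ?thesis .
  qed
  have "summable (\<lambda>m. w ^ m * cnj z ^ m / of_real (moment \<alpha> l m))"
  proof (rule summable_norm_cancel)
    have "norm (w ^ m * cnj z ^ m / of_real (moment \<alpha> l m)) = (cmod z * cmod w) ^ m / moment \<alpha> l m" for m
      using moment_pos[OF assms, of m] by (simp add: norm_mult norm_power norm_divide power_mult_distrib mult_ac)
    then show "summable (\<lambda>m. norm (w ^ m * cnj z ^ m / of_real (moment \<alpha> l m)))"
      using moment_series_summable[OF assms, of "cmod z * cmod w"] by simp
  qed
  then have s: "summable (\<lambda>m. ?c * ?t m)" by (simp only: eq)
  then have "summable ?t" using c0 by (subst (asm) summable_cmult_iff) auto
  then have "(\<lambda>m. ?c * ?t m) sums (?c * (\<Sum>m. ?t m))"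
    by (intro sums_mult summable_sums)
  then show ?thesis unfolding eq Bergman_kernel_def .
qed

definition delta_weight :: "real \<Rightarrow> nat \<Rightarrow> real \<Rightarrow> real" where
  "delta_weight \<beta> l r = exp (- \<beta> * r ^ (2 * l)) * (1 + r) ^ (2 * (l - 1))"

text \<open>
  Replacing \<open>1 + r\<close> by \<open>r\<close> in the weight shifts the moment by \<open>l - 1\<close>. In the converse direction
  the unit disc contributes at most a constant, and all moments are bounded below.
\<close>

lemma nn_integral_delta_weight:
  assumes "\<beta> > 0" "l \<ge> 1"
  defines "D \<equiv> \<lambda>k. \<integral>\<^sup>+z. ennreal (cmod z ^ (2 * k) * delta_weight \<beta> l (cmod z)) \<partial>lborel"
  shows "ennreal (moment \<beta> l (k + l - 1)) \<le> D k"
    and "\<exists>C>0. \<forall>k. D k \<le> ennreal (C * moment \<beta> l (k + l - 1))"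
proof -
  have split: "r ^ (2 * (k + l - 1)) = r ^ (2 * k) * r ^ (2 * (l - 1))" for r :: real and k
    using assms(2) by (simp flip: power_add distrib_left)
  show "ennreal (moment \<beta> l (k + l - 1)) \<le> D k"
    unfolding D_def nn_integral_moment[OF assms(1,2), symmetric] delta_weight_def split
  proof (intro nn_integral_mono ennreal_leI)
    fix z :: complex
    have "cmod z ^ (2 * (l - 1)) \<le> (1 + cmod z) ^ (2 * (l - 1))" by (intro power_mono) auto
    then have "cmod z ^ (2 * k) * exp (- \<beta> * cmod z ^ (2 * l)) * cmod z ^ (2 * (l - 1))
        \<le> cmod z ^ (2 * k) * exp (- \<beta> * cmod z ^ (2 * l)) * (1 + cmod z) ^ (2 * (l - 1))"
      by (intro mult_left_mono) auto
    then show "cmod z ^ (2 * k) * cmod z ^ (2 * (l - 1)) * exp (- \<beta> * cmod z ^ (2 * l))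
        \<le> cmod z ^ (2 * k) * (exp (- \<beta> * cmod z ^ (2 * l)) * (1 + cmod z) ^ (2 * (l - 1)))"
      by (simp add: mult_ac)
  qed
  \<comment> \<open>The lower bound for moments that belongs to the annulus of radii between 1 and 2.\<close>
  define J where "J = pi * exp (- \<beta> * 2 ^ (2 * l))"
  have J: "J > 0" by (simp add: J_def)
  have Jle: "J \<le> moment \<beta> l j" for j
    using moment_lower_bound[OF assms(1,2), of 1 j] by (simp add: J_def)
  \<comment> \<open>On the unit disc \<open>(1 + r) ^ (2 * (l - 1)) \<le> 4 ^ (l - 1)\<close>, and outside it \<open>1 + r \<le> 2 * r\<close>.\<close>
  define C where "C = 4 ^ (l - 1) * (moment \<beta> l 0 / J + 1)"
  have m0: "moment \<beta> l 0 > 0" using moment_pos[OF assms(1,2)] .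
  have "C > 0" unfolding C_def using J m0 by (intro mult_pos_pos add_nonneg_pos) auto
  moreover have "D k \<le> ennreal (C * moment \<beta> l (k + l - 1))" for k
  proof -
    have "D k \<le> (\<integral>\<^sup>+z. ennreal (4 ^ (l - 1)) * (ennreal (cmod z ^ (2 * 0) * exp (- \<beta> * cmod z ^ (2 * l)))
         + ennreal (cmod z ^ (2 * (k + l - 1)) * exp (- \<beta> * cmod z ^ (2 * l)))) \<partial>lborel)"
      unfolding D_def
    proof (intro nn_integral_mono)
      fix z :: complex
      let ?r = "cmod z"
      have "?r ^ (2 * k) * (1 + ?r) ^ (2 * (l - 1)) \<le> 4 ^ (l - 1) * (1 + ?r ^ (2 * (k + l - 1)))"
      proof (cases "?r \<le> 1")
        case True
        have "?r ^ (2 * k) \<le> 1" using True by (intro power_le_one) auto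
        moreover have "(1 + ?r) ^ (2 * (l - 1)) \<le> 2 ^ (2 * (l - 1))" using True by (intro power_mono) auto
        ultimately have "?r ^ (2 * k) * (1 + ?r) ^ (2 * (l - 1)) \<le> 1 * 2 ^ (2 * (l - 1))"
          by (intro mult_mono) auto
        also have "\<dots> = 4 ^ (l - 1) * 1" by (simp add: power_mult)
        also have "\<dots> \<le> 4 ^ (l - 1) * (1 + ?r ^ (2 * (k + l - 1)))" by (intro mult_left_mono) auto
        finally show ?thesis .
      next
        case False
        have "(1 + ?r) ^ (2 * (l - 1)) \<le> (2 * ?r) ^ (2 * (l - 1))" using False by (intro power_mono) auto
        then have "?r ^ (2 * k) * (1 + ?r) ^ (2 * (l - 1)) \<le> ?r ^ (2 * k) * (2 * ?r) ^ (2 * (l - 1))"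
          by (intro mult_left_mono) auto
        also have "\<dots> = 4 ^ (l - 1) * ?r ^ (2 * (k + l - 1))"
          unfolding split power_mult_distrib power_mult[of "2::real" 2] by simp
        also have "\<dots> \<le> 4 ^ (l - 1) * (1 + ?r ^ (2 * (k + l - 1)))" by (intro mult_left_mono) auto
        finally show ?thesis .
      qed
      then have "?r ^ (2 * k) * (1 + ?r) ^ (2 * (l - 1)) * exp (- \<beta> * ?r ^ (2 * l)) \<le> 4 ^ (l - 1) * (1 + ?r ^ (2 * (k + l - 1))) * exp (- \<beta> * ?r ^ (2 * l))"
        by (intro mult_right_mono) auto
      then have "?r ^ (2 * k) * delta_weight \<beta> l ?r \<le> 4 ^ (l - 1) * (?r ^ (2 * 0) * exp (- \<beta> * ?r ^ (2 * l))
         + ?r ^ (2 * (k + l - 1)) * exp (- \<beta> * ?r ^ (2 * l)))"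
        by (simp add: delta_weight_def algebra_simps)
      then have "ennreal (?r ^ (2 * k) * delta_weight \<beta> l ?r) \<le> ennreal (4 ^ (l - 1) * (?r ^ (2 * 0) * exp (- \<beta> * ?r ^ (2 * l))
         + ?r ^ (2 * (k + l - 1)) * exp (- \<beta> * ?r ^ (2 * l))))"
        by (rule ennreal_leI)
      then show "ennreal (?r ^ (2 * k) * delta_weight \<beta> l ?r) \<le> ennreal (4 ^ (l - 1)) * (ennreal (?r ^ (2 * 0) * exp (- \<beta> * ?r ^ (2 * l)))
         + ennreal (?r ^ (2 * (k + l - 1)) * exp (- \<beta> * ?r ^ (2 * l))))"
        by (subst (asm) ennreal_mult) (auto simp del: mult_0_right power_0 simp: ennreal_plus)
    qed
    also have "\<dots> = ennreal (4 ^ (l - 1)) * (ennreal (moment \<beta> l 0) + ennreal (moment \<beta> l (k + l - 1)))"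
      by (subst nn_integral_cmult, measurable, subst nn_integral_add, measurable)
        (simp only: nn_integral_moment[OF assms(1,2)])
    also have "\<dots> = ennreal (4 ^ (l - 1) * (moment \<beta> l 0 + moment \<beta> l (k + l - 1)))"
      using moment_pos[OF assms(1,2)] by (simp add: ennreal_mult less_imp_le flip: ennreal_plus)
    also have "\<dots> \<le> ennreal (C * moment \<beta> l (k + l - 1))"
    proof (rule ennreal_leI)
      have "moment \<beta> l 0 \<le> moment \<beta> l 0 / J * moment \<beta> l (k + l - 1)"
        using Jle[of "k + l - 1"] J m0 by (simp add: field_simps)
      then have "4 ^ (l - 1) * (moment \<beta> l 0 + moment \<beta> l (k + l - 1))
          \<le> 4 ^ (l - 1) * (moment \<beta> l 0 / J * moment \<beta> l (k + l - 1) + moment \<beta> l (k + l - 1))"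
        by (intro mult_left_mono add_right_mono) auto
      then show "4 ^ (l - 1) * (moment \<beta> l 0 + moment \<beta> l (k + l - 1)) \<le> C * moment \<beta> l (k + l - 1)"
        unfolding C_def by (simp only: distrib_right mult_1 mult.assoc)
    qed
    finally show ?thesis .
  qed
  ultimately show "\<exists>C>0. \<forall>k. D k \<le> ennreal (C * moment \<beta> l (k + l - 1))" by blast
qed

text \<open>
  The factor of \<open>\<bar>\<beta> k\<bar>\<^sup>2\<close> in the squared Hilbert-Schmidt norm.
\<close>

definition hankel_coeff_weight :: "real \<Rightarrow> nat \<Rightarrow> nat \<Rightarrow> real" where
  "hankel_coeff_weight \<alpha> l k = (\<Sum>m\<le>k. (moment \<alpha> l k)\<^sup>2 / (moment \<alpha> l m * moment \<alpha> l (k - m)))"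

text \<open>
  The powers of \<open>\<alpha>\<close> in \<open>moment \<alpha> l m * moment \<alpha> l (k - m)\<close> add up to an exponent independent of
  \<open>m\<close>, which leaves the convolution of reciprocal Gamma values.
\<close>

lemma hankel_coeff_weight_eq:
  assumes "\<alpha> > 0" "l \<ge> 1"
  shows "hankel_coeff_weight \<alpha> l k
     = \<alpha> powr (- (real k / real l)) * (Gamma (real (k + 1) / real l) ^ 2 * rGamma_convolution l (k + 2))"
proof -
  have summand: "(moment \<alpha> l k)\<^sup>2 / (moment \<alpha> l m * moment \<alpha> l (k - m))
     = \<alpha> powr (- (real k / real l)) * Gamma (real (k + 1) / real l) ^ 2
        * (rGamma (real (m + 1) / real l) * rGamma (real (k + 2 - (m + 1)) / real l))" if m: "m \<le> k" for m
  proof -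
    have p: "(\<alpha> powr (- (real (k + 1) / real l)))\<^sup>2 =
       \<alpha> powr (- (real k / real l)) * (\<alpha> powr (- (real (m + 1) / real l)) * \<alpha> powr (- (real (k - m + 1) / real l)))"
      unfolding power2_eq_square powr_add[symmetric] using m
      by (intro arg_cong[where f = "\<lambda>x. \<alpha> powr x"]) (simp add: of_nat_diff add_divide_distrib diff_divide_distrib)
    have n: "k + 2 - (m + 1) = k - m + 1" using m by simp
    have g: "Gamma (real (m + 1) / real l) > 0" "Gamma (real (k - m + 1) / real l) > 0"
      using assms by (auto intro!: Gamma_real_pos)
    have q: "\<alpha> powr (- (real (m + 1) / real l)) > 0" "\<alpha> powr (- (real (k - m + 1) / real l)) > 0" "pi / real l > 0"
      using assms by auto
    have alg: "(c * A * G)\<^sup>2 / ((c * P * X) * (c * Q * Y)) = a * G ^ 2 * (inverse X * inverse Y)"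
      if "A ^ 2 = a * (P * Q)" "P > 0" "Q > 0" "c > 0" "X > 0" "Y > 0" for c A G P X Q Y a :: real
    proof -
      have "(c * A * G)\<^sup>2 = c\<^sup>2 * (a * (P * Q)) * G\<^sup>2" by (simp add: power_mult_distrib that(1))
      then show ?thesis using that by (simp add: field_simps power2_eq_square)
    qed
    show ?thesis unfolding moment_eq[OF assms] n rGamma_inverse_Gamma
      by (rule alg[OF p q g])
  qed
  have "hankel_coeff_weight \<alpha> l k = (\<Sum>m\<le>k. \<alpha> powr (- (real k / real l)) * Gamma (real (k + 1) / real l) ^ 2
        * (rGamma (real (m + 1) / real l) * rGamma (real (k + 2 - (m + 1)) / real l)))"
    unfolding hankel_coeff_weight_def by (intro sum.cong refl summand) auto
  also have "\<dots> = \<alpha> powr (- (real k / real l)) * Gamma (real (k + 1) / real l) ^ 2 * rGamma_convolution l (k + 2)"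
    unfolding rGamma_convolution_def sum_distrib_left
    by (rule sum.reindex_bij_witness[of _ "\<lambda>i. i - 1" "\<lambda>m. m + 1"]) auto
  finally show ?thesis by simp
qed

text \<open>
  The weight with parameter \<open>\<alpha> / 2\<close> supplies the factor \<open>2 powr (k / l)\<close>, and the polynomial
  factor shifts the argument of Gamma from \<open>(k + 1) / l\<close> to \<open>(k + l) / l\<close>; this is how the
  convolution grows.
\<close>

lemma hankel_coeff_weight_comparable:
  assumes "\<alpha> > 0" "l \<ge> 1"
  defines "D \<equiv> \<lambda>k. \<integral>\<^sup>+z. ennreal (cmod z ^ (2 * k) * delta_weight (\<alpha> / 2) l (cmod z)) \<partial>lborel"
  shows "\<exists>C>0. \<forall>k. ennreal (hankel_coeff_weight \<alpha> l k) \<le> ennreal C * D k"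
    and "\<exists>C>0. \<forall>k. D k \<le> ennreal C * ennreal (hankel_coeff_weight \<alpha> l k)"
proof -
  let ?R = "\<lambda>k. 2 powr (real k / real l) * Gamma (real (k + l) / real l)"
  let ?S = "\<lambda>k. Gamma (real (k + 1) / real l) ^ 2 * rGamma_convolution l (k + 2)"
  have half: "\<alpha> / 2 > 0" using assms by simp
  define c where "c = 2 * pi / (real l * \<alpha>)"
  have c: "c > 0" using assms by (simp add: c_def)
  have mom: "moment (\<alpha> / 2) l (k + l - 1) = c * (\<alpha> powr (- (real k / real l)) * ?R k)" for k
  proof -
    have "(\<alpha> / 2) powr (- (real (k + l) / real l)) = (\<alpha> / 2) powr (- (real k / real l) - 1)"
      using assms by (simp add: add_divide_distrib)
    also have "\<dots> = (\<alpha> / 2) powr (- (real k / real l)) / (\<alpha> / 2)" using assms by (simp add: powr_diff)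
    also have "(\<alpha> / 2) powr (- (real k / real l)) = \<alpha> powr (- (real k / real l)) * 2 powr (real k / real l)"
      using assms by (simp add: powr_divide powr_minus field_simps)
    finally have e: "(\<alpha> / 2) powr (- (real (k + l) / real l)) = \<alpha> powr (- (real k / real l)) * 2 powr (real k / real l) / (\<alpha> / 2)" .
    have i: "k + l - 1 + 1 = k + l" using assms by simp
    show ?thesis unfolding moment_eq[OF half assms(2)] i e c_def using assms by (simp add: field_simps)
  qed
  note W = hankel_coeff_weight_eq[OF assms(1,2)]
  obtain C1 where C1: "C1 > 0" "\<And>k. ?S k \<le> C1 * ?R k" using Gamma_convolution_comparable(1)[OF assms(2)] by auto
  obtain C2 where C2: "C2 > 0" "\<And>k. ?R k \<le> C2 * ?S k" using Gamma_convolution_comparable(2)[OF assms(2)] by auto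
  obtain C3 where C3: "C3 > 0" "\<And>k. D k \<le> ennreal (C3 * moment (\<alpha> / 2) l (k + l - 1))"
    using nn_integral_delta_weight(2)[OF half assms(2)] unfolding D_def by auto
  have apos: "\<alpha> powr (- (real k / real l)) \<ge> 0" for k by simp
  have "ennreal (hankel_coeff_weight \<alpha> l k) \<le> ennreal (C1 / c) * D k" for k
  proof -
    have "hankel_coeff_weight \<alpha> l k \<le> \<alpha> powr (- (real k / real l)) * (C1 * ?R k)"
      unfolding W by (intro mult_left_mono C1(2) apos)
    also have "\<dots> = C1 / c * moment (\<alpha> / 2) l (k + l - 1)" unfolding mom using c by simp
    finally have "ennreal (hankel_coeff_weight \<alpha> l k) \<le> ennreal (C1 / c) * ennreal (moment (\<alpha> / 2) l (k + l - 1))"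
      using C1(1) c moment_pos[OF half assms(2), of "k + l - 1"] by (subst ennreal_mult[symmetric]) (simp_all only: ennreal_leI divide_nonneg_pos less_imp_le)
    also have "\<dots> \<le> ennreal (C1 / c) * D k"
      unfolding D_def by (intro mult_left_mono nn_integral_delta_weight(1)[OF half assms(2)]) auto
    finally show ?thesis .
  qed
  then show "\<exists>C>0. \<forall>k. ennreal (hankel_coeff_weight \<alpha> l k) \<le> ennreal C * D k"
    using C1(1) c by (intro exI[of _ "C1 / c"]) auto
  have "D k \<le> ennreal (C3 * c * C2) * ennreal (hankel_coeff_weight \<alpha> l k)" for k
  proof -
    have "D k \<le> ennreal (C3 * moment (\<alpha> / 2) l (k + l - 1))" by (rule C3(2))
    also have "\<dots> \<le> ennreal (C3 * c * C2 * hankel_coeff_weight \<alpha> l k)"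
    proof (rule ennreal_leI)
      have "\<alpha> powr (- (real k / real l)) * ?R k \<le> \<alpha> powr (- (real k / real l)) * (C2 * ?S k)"
        by (intro mult_left_mono C2(2) apos)
      then have "(C3 * c) * (\<alpha> powr (- (real k / real l)) * ?R k) \<le> (C3 * c) * (\<alpha> powr (- (real k / real l)) * (C2 * ?S k))"
        by (rule mult_left_mono) (use C3(1) c in simp)
      then show "C3 * moment (\<alpha> / 2) l (k + l - 1) \<le> C3 * c * C2 * hankel_coeff_weight \<alpha> l k"
        unfolding mom W by (simp only: mult_ac)
    qed
    finally show ?thesis using C2(1) C3(1) c by (subst (asm) ennreal_mult') auto
  qed
  then show "\<exists>C>0. \<forall>k. D k \<le> ennreal C * ennreal (hankel_coeff_weight \<alpha> l k)"
    using C2(1) C3(1) c by (intro exI[of _ "C3 * c * C2"]) auto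
qed

section \<open>The small Hankel operator in the monomial basis\<close>

lemma ennreal_suminf_diagonals:
  fixes F :: "nat \<Rightarrow> nat \<Rightarrow> ennreal"
  shows "(\<Sum>m. \<Sum>n. F m n) = (\<Sum>k. \<Sum>m\<le>k. F m (k - m))"
proof -
  have "(\<Sum>n. F m n) = (\<Sum>k. if m \<le> k then F m (k - m) else 0)" for m
  proof -
    have "(\<Sum>k. if m \<le> k then F m (k - m) else 0)
        = (\<Sum>n. if m \<le> n + m then F m (n + m - m) else 0) + (\<Sum>k<m. if m \<le> k then F m (k - m) else 0)"
      by (rule suminf_offset) simp
    then show ?thesis by simp
  qed
  then have "(\<Sum>m. \<Sum>n. F m n) = (\<Sum>k. \<Sum>m. if m \<le> k then F m (k - m) else 0)"
    by (simp add: ennreal_suminf_commute[of "\<lambda>m k. if m \<le> k then F m (k - m) else 0"])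
  also have "\<dots> = (\<Sum>k. \<Sum>m\<le>k. F m (k - m))"
  proof (intro arg_cong[where f = suminf] ext)
    fix k
    show "(\<Sum>m. if m \<le> k then F m (k - m) else 0) = (\<Sum>m\<le>k. F m (k - m))"
      by (subst suminf_finite[of "{..k}"]) auto
  qed
  finally show ?thesis .
qed

lemma power_le_fact_mult_exp:
  fixes x :: real
  assumes "x \<ge> 0"
  shows "x ^ n \<le> fact n * exp x"
proof -
  have "x ^ n /\<^sub>R fact n \<le> exp x"
    using sum_le_suminf[OF sums_summable[OF exp_converges[of x]], of "{n}"] assms
    unfolding sums_unique[OF exp_converges[of x], symmetric] by simp
  then show ?thesis by (simp add: divide_simps mult.commute)
qed

lemma monomial_in_E_space:
  assumes "l \<ge> 1"
  shows "(\<lambda>z. c * z ^ n) \<in> E_space l"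
proof -
  have "cmod (c * z ^ n) \<le> (cmod c * fact n) * exp (1 * cmod z ^ l)" for z
  proof -
    have "cmod z ^ n \<le> fact n * exp (cmod z ^ l)"
    proof (cases "cmod z \<le> 1")
      case True
      have "cmod z ^ n \<le> 1 * 1" using True by (simp add: power_le_one)
      also have "\<dots> \<le> fact n * exp (cmod z ^ l)" by (intro mult_mono fact_ge_1) auto
      finally show ?thesis .
    next
      case False
      have "cmod z ^ n \<le> cmod z ^ (l * n)" using False assms by (intro power_increasing) auto
      also have "\<dots> \<le> fact n * exp (cmod z ^ l)"
        unfolding power_mult by (rule power_le_fact_mult_exp) simp
      finally show ?thesis .
    qed
    then have "cmod c * cmod z ^ n \<le> cmod c * (fact n * exp (cmod z ^ l))" by (intro mult_left_mono) auto
    then show ?thesis by (simp add: norm_mult norm_power)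
  qed
  moreover have "(\<lambda>z. c * z ^ n) holomorphic_on UNIV" by (intro holomorphic_intros)
  ultimately show ?thesis unfolding E_space_def mem_Collect_eq using zero_less_one by blast
qed

text \<open>
  The squared modulus of the entry of the small Hankel operator at the \<open>n\<close>-th normalized
  monomial and the conjugate of the \<open>m\<close>-th.
\<close>

definition hankel_entry :: "real \<Rightarrow> nat \<Rightarrow> (nat \<Rightarrow> complex) \<Rightarrow> nat \<Rightarrow> nat \<Rightarrow> real" where
  "hankel_entry \<alpha> l \<beta> m n = (cmod (\<beta> (m + n)))\<^sup>2 * (moment \<alpha> l (m + n))\<^sup>2 / (moment \<alpha> l m * moment \<alpha> l n)"

text \<open>
  The \<open>m\<close>-th coefficient of the image of \<open>f\<close> in powers of \<open>cnj z\<close>, before division by the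
  moment.
\<close>

definition hankel_coeff :: "real \<Rightarrow> nat \<Rightarrow> (complex \<Rightarrow> complex) \<Rightarrow> (complex \<Rightarrow> complex) \<Rightarrow> nat \<Rightarrow> complex" where
  "hankel_coeff \<alpha> l b f m = (\<integral>w. w ^ m * f w * (cnj (b w) * of_real (exp (- \<alpha> * cmod w ^ (2 * l)))) \<partial>lborel)"

text \<open>
  The exponent is \<open>3 / 4 * \<alpha>\<close> instead of \<open>\<alpha>\<close> to leave room for the Bergman kernel.
\<close>

definition hankel_admissible :: "real \<Rightarrow> nat \<Rightarrow> (complex \<Rightarrow> complex) \<Rightarrow> (complex \<Rightarrow> complex) \<Rightarrow> bool" where
  "hankel_admissible \<alpha> l b f \<longleftrightarrow> integrable lborel (\<lambda>w. cmod (f w) * cmod (b w) * exp (- (3 / 4 * \<alpha>) * cmod w ^ (2 * l)))"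

definition normalized_monomial :: "real \<Rightarrow> nat \<Rightarrow> nat \<Rightarrow> complex \<Rightarrow> complex" where
  "normalized_monomial \<alpha> l n = (\<lambda>z. of_real (1 / sqrt (moment \<alpha> l n)) * z ^ n)"

context
  fixes \<alpha> :: real and l :: nat
  assumes \<alpha>: "\<alpha> > 0" and l: "l \<ge> 1"
begin

interpretation fw: radial_weight "\<lambda>r. exp (- \<alpha> * r ^ (2 * l))"
proof unfold_locales
  show "continuous_on UNIV (\<lambda>r. exp (- \<alpha> * r ^ (2 * l)))" by (intro continuous_intros)
qed simp

interpretation dw: radial_weight "delta_weight (\<alpha> / 2) l"
proof unfold_locales
  show "continuous_on UNIV (delta_weight (\<alpha> / 2) l)"
    unfolding delta_weight_def[abs_def] by (intro continuous_intros)
qed (simp add: delta_weight_def)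

lemmas mom_pos = moment_pos[OF \<alpha> l]

lemma Fock_norm_series:
  assumes a: "entire_series a f" and f: "f \<in> Fock \<alpha> l"
  shows "(\<lambda>k. (cmod (a k))\<^sup>2 * moment \<alpha> l k) sums (L2_norm \<alpha> l f)\<^sup>2"
proof -
  let ?t = "\<lambda>k. (cmod (a k))\<^sup>2 * moment \<alpha> l k"
  have t0: "?t k \<ge> 0" for k using mom_pos[of k] by simp
  have "(\<Sum>k. ennreal (?t k)) = ennreal ((L2_norm \<alpha> l f)\<^sup>2)"
    unfolding L2_norm_square_nn_integral[OF Fock_L2[OF f]] fw.parseval_entire[OF a] nn_integral_moment[OF \<alpha> l]
    by (intro arg_cong[where f = suminf] ext ennreal_mult') simp
  moreover from this have "summable ?t" using t0 by (intro summable_suminf_not_top) auto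
  ultimately have "ennreal (suminf ?t) = ennreal ((L2_norm \<alpha> l f)\<^sup>2)"
    using t0 by (subst suminf_ennreal2[symmetric]) auto
  then show ?thesis using \<open>summable ?t\<close> t0 by (simp add: sums_iff suminf_nonneg)
qed

lemma monomial_in_Fock: "(\<lambda>z. z ^ n) \<in> Fock \<alpha> l"
proof -
  have "integrable lborel (\<lambda>z. (cmod (z ^ n))\<^sup>2 * exp (- \<alpha> * cmod z ^ (2 * l)))"
    using moment_integrable[OF \<alpha> l, of n] by (simp add: norm_power power_mult[symmetric] mult.commute)
  then have "(\<lambda>z. z ^ n) \<in> L2_space \<alpha> l"
    unfolding L2_space_def by (auto intro!: borel_measurable_continuous_onI continuous_intros)
  then show ?thesis by (auto simp: Fock_def intro!: holomorphic_intros)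
qed

lemma L2_inner_monomial:
  assumes a: "entire_series a f" and f: "f \<in> Fock \<alpha> l"
  shows "L2_inner \<alpha> l f (\<lambda>z. z ^ n) = a n * of_real (moment \<alpha> l n)"
proof -
  have "L2_inner \<alpha> l (\<lambda>z. z ^ n) f = cnj (a n) * of_real (moment \<alpha> l n)"
    unfolding L2_inner_def moment_def mult.assoc
    using L2_inner_integrable[OF Fock_L2[OF monomial_in_Fock] Fock_L2[OF f]]
    by (intro fw.monomial_pairing[OF a] moment_integrable[OF \<alpha> l]) (simp add: mult.assoc)
  then show ?thesis using L2_inner_cnj_commute[of \<alpha> l "\<lambda>z. z ^ n" f] by simp
qed

lemma L2_inner_scale_right: "L2_inner \<alpha> l f (\<lambda>z. c * g z) = cnj c * L2_inner \<alpha> l f g"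
  using L2_inner_scale_left[of \<alpha> l c g f] by (metis L2_inner_cnj_commute complex_cnj_mult)

text \<open>
  The remainder of the expansion of \<open>f\<close> is the tail of its Taylor series, and by Parseval its
  squared norm is a tail of a convergent series.
\<close>

lemma normalized_monomials_onb: "Fock_onb \<alpha> l (normalized_monomial \<alpha> l)"
  unfolding Fock_onb_def
proof (intro conjI allI ballI)
  let ?u = "normalized_monomial \<alpha> l"
  show "?u m \<in> Fock \<alpha> l" for m
    unfolding normalized_monomial_def by (intro Fock_scale monomial_in_Fock)
  have inner: "L2_inner \<alpha> l f (?u m) = a m * of_real (sqrt (moment \<alpha> l m))"
    if "entire_series a f" "f \<in> Fock \<alpha> l" for f a m
  proof -
    have "moment \<alpha> l m / sqrt (moment \<alpha> l m) = sqrt (moment \<alpha> l m)" using mom_pos[of m] by (simp add: real_div_sqrt)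
    then have "complex_of_real (1 / sqrt (moment \<alpha> l m)) * of_real (moment \<alpha> l m) = of_real (sqrt (moment \<alpha> l m))"
      by (simp flip: of_real_divide of_real_mult)
    then show ?thesis
      unfolding normalized_monomial_def L2_inner_scale_right L2_inner_monomial[OF that]
      by (simp only: complex_cnj_complex_of_real mult.left_commute)
  qed
  show "L2_inner \<alpha> l (?u m) (?u n) = (if m = n then 1 else 0)" for m n
    unfolding normalized_monomial_def[of \<alpha> l m] L2_inner_scale_left inner[OF entire_series_monomial monomial_in_Fock]
    using mom_pos[of n] by auto
  fix f assume f: "f \<in> Fock \<alpha> l"
  then obtain a where a: "entire_series a f" by (auto simp: Fock_def elim: holomorphic_entire_series)
  let ?t = "\<lambda>k. (cmod (a k))\<^sup>2 * moment \<alpha> l k"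
  have proj: "(\<Sum>m<N. L2_inner \<alpha> l f (?u m) * ?u m z) = (\<Sum>m<N. a m * z ^ m)" for N z
    unfolding inner[OF a f] using mom_pos
    by (intro sum.cong refl) (simp add: normalized_monomial_def less_imp_neq[OF mom_pos, symmetric])
  have "(L2_norm \<alpha> l (\<lambda>z. f z - (\<Sum>m<N. a m * z ^ m)))\<^sup>2 = (L2_norm \<alpha> l f)\<^sup>2 - (\<Sum>k<N. ?t k)" for N
  proof -
    have fN: "(\<lambda>z. f z - (\<Sum>m<N. a m * z ^ m)) \<in> Fock \<alpha> l"
      by (intro Fock_diff f Fock_sum monomial_in_Fock)
    have "(\<lambda>k. ?t k - (if k \<in> {..<N} then ?t k else 0)) sums ((L2_norm \<alpha> l f)\<^sup>2 - (\<Sum>k<N. ?t k))"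
      by (intro sums_diff Fock_norm_series[OF a f] sums_If_finite_set) simp
    also have "(\<lambda>k. ?t k - (if k \<in> {..<N} then ?t k else 0)) = (\<lambda>k. (cmod (if k < N then 0 else a k))\<^sup>2 * moment \<alpha> l k)"
      by auto
    finally show ?thesis
      using Fock_norm_series[OF entire_series_diff_partial_sum[OF a] fN] sums_unique2 by blast
  qed
  moreover have "(\<lambda>N. (L2_norm \<alpha> l f)\<^sup>2 - (\<Sum>k<N. ?t k)) \<longlonglongrightarrow> (L2_norm \<alpha> l f)\<^sup>2 - (L2_norm \<alpha> l f)\<^sup>2"
    using Fock_norm_series[OF a f] unfolding sums_def by (intro tendsto_intros)
  ultimately have "(\<lambda>N. sqrt ((L2_norm \<alpha> l (\<lambda>z. f z - (\<Sum>m<N. a m * z ^ m)))\<^sup>2)) \<longlonglongrightarrow> sqrt 0"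
    by (intro tendsto_real_sqrt) simp
  then show "(\<lambda>N. L2_norm \<alpha> l (\<lambda>z. f z - (\<Sum>m<N. L2_inner \<alpha> l f (?u m) * ?u m z))) \<longlonglongrightarrow> 0"
    unfolding proj by (simp add: L2_norm_nonneg)
qed

text \<open>
  The partial sums of the kernel series, multiplied by \<open>f * cnj b\<close> and the weight, are dominated
  by a multiple of the function in \<open>hankel_admissible\<close>: the kernel takes \<open>\<alpha> / 4\<close> of the exponent
  and leaves \<open>3 / 4 * \<alpha>\<close>.
\<close>

lemma
  fixes b f :: "complex \<Rightarrow> complex"
  assumes f: "entire_series a f" and b: "entire_series \<beta> b" and H: "hankel_admissible \<alpha> l b f"
  shows hankel_coeff_integrable: "integrable lborel (\<lambda>w. w ^ m * f w * (cnj (b w) * of_real (exp (- \<alpha> * cmod w ^ (2 * l)))))"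
    and small_Hankel_sums: "(\<lambda>m. cnj z ^ m * hankel_coeff \<alpha> l b f m / of_real (moment \<alpha> l m)) sums small_Hankel \<alpha> l b f z"
proof -
  let ?W = "\<lambda>w. exp (- \<alpha> * cmod w ^ (2 * l))"
  let ?G = "\<lambda>w. f w * (cnj (b w) * complex_of_real (?W w))"
  let ?H = "\<lambda>w. cmod (f w) * cmod (b w) * exp (- (3 / 4 * \<alpha>) * cmod w ^ (2 * l))"
  have Gcont: "continuous_on UNIV ?G"
    by (intro continuous_intros entire_series_continuous[OF f] entire_series_continuous[OF b])
  have gain: "K * cmod (?G w) \<le> C * ?H w" if "K \<le> C * exp (\<alpha> / 4 * cmod w ^ (2 * l))" for K C w
  proof -
    have "K * cmod (?G w) \<le> C * exp (\<alpha> / 4 * cmod w ^ (2 * l)) * cmod (?G w)"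
      using that by (intro mult_right_mono) auto
    also have "\<dots> = C * (cmod (f w) * cmod (b w) * (exp (\<alpha> / 4 * cmod w ^ (2 * l)) * ?W w))"
      by (simp add: norm_mult mult_ac)
    also have "exp (\<alpha> / 4 * cmod w ^ (2 * l)) * ?W w = exp (- (3 / 4 * \<alpha>) * cmod w ^ (2 * l))"
      unfolding exp_add[symmetric] by (intro arg_cong[where f = exp]) (simp add: algebra_simps)
    finally show ?thesis .
  qed
  have Hint: "integrable lborel ?H" using H by (simp add: hankel_admissible_def)
  let ?t = "\<lambda>z m w. w ^ m * cnj z ^ m / of_real (moment \<alpha> l m) * ?G w"
  obtain C where C: "\<And>z w. (\<Sum>m. (cmod z * cmod w) ^ m / moment \<alpha> l m) \<le> C z * exp (\<alpha> / 4 * cmod w ^ (2 * l))"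
    using kernel_majorant[OF \<alpha> l] by metis
  have partial: "cmod (\<Sum>m<N. ?t z m w) \<le> C z * ?H w" for N z w
  proof -
    have s: "summable (\<lambda>m. (cmod z * cmod w) ^ m / moment \<alpha> l m)"
      by (intro moment_series_summable[OF \<alpha> l]) auto
    have nn: "(cmod z * cmod w) ^ m / moment \<alpha> l m \<ge> 0" for m using mom_pos[of m] by simp
    have "cmod (\<Sum>m<N. w ^ m * cnj z ^ m / of_real (moment \<alpha> l m)) \<le> (\<Sum>m<N. (cmod z * cmod w) ^ m / moment \<alpha> l m)"
      using mom_pos by (intro sum_norm_le) (simp add: norm_mult norm_divide norm_power power_mult_distrib mult_ac less_imp_le)
    also have "\<dots> \<le> (\<Sum>m. (cmod z * cmod w) ^ m / moment \<alpha> l m)"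
      using s nn by (intro sum_le_suminf) auto
    finally have "cmod (\<Sum>m<N. w ^ m * cnj z ^ m / of_real (moment \<alpha> l m)) * cmod (?G w) \<le> C z * ?H w"
      using C[of z w] by (intro gain) simp
    then show ?thesis by (simp only: norm_mult[symmetric] sum_distrib_right)
  qed
  have meas: "(\<lambda>w. \<Sum>m<N. ?t z m w) \<in> borel_measurable lborel" for N z
  proof -
    have "continuous_on UNIV (\<lambda>w. \<Sum>m<N. ?t z m w)"
      using mom_pos by (intro continuous_intros Gcont) (auto simp: less_imp_neq[OF mom_pos, symmetric])
    then have "(\<lambda>w. \<Sum>m<N. ?t z m w) \<in> borel_measurable borel" by (rule borel_measurable_continuous_onI)
    then show ?thesis by simp
  qed
  show int: "integrable lborel (\<lambda>w. w ^ m * f w * (cnj (b w) * of_real (?W w)))" for m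
  proof (rule Bochner_Integration.integrable_bound)
    show "integrable lborel (\<lambda>w. (moment \<alpha> l m * C 1) * ?H w)" by (intro integrable_mult_right Hint)
    have "continuous_on UNIV (\<lambda>w. w ^ m * ?G w)" by (intro continuous_intros Gcont)
    then have "(\<lambda>w. w ^ m * ?G w) \<in> borel_measurable borel" by (rule borel_measurable_continuous_onI)
    then show "(\<lambda>w. w ^ m * f w * (cnj (b w) * of_real (?W w))) \<in> borel_measurable lborel" by (simp add: mult.assoc)
    show "AE w in lborel. norm (w ^ m * f w * (cnj (b w) * of_real (?W w))) \<le> norm ((moment \<alpha> l m * C 1) * ?H w)"
    proof (rule AE_I2)
      fix w :: complex
      have s: "summable (\<lambda>k. (cmod 1 * cmod w) ^ k / moment \<alpha> l k)"
        by (intro moment_series_summable[OF \<alpha> l]) auto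
      have "(\<Sum>k\<in>{m}. (cmod 1 * cmod w) ^ k / moment \<alpha> l k) \<le> (\<Sum>k. (cmod 1 * cmod w) ^ k / moment \<alpha> l k)"
        using mom_pos by (intro sum_le_suminf s) (auto simp: less_imp_le)
      also have "\<dots> \<le> C 1 * exp (\<alpha> / 4 * cmod w ^ (2 * l))" by (rule C)
      finally have "cmod w ^ m \<le> (moment \<alpha> l m * C 1) * exp (\<alpha> / 4 * cmod w ^ (2 * l))"
        using mom_pos[of m] by (simp add: field_simps)
      then have "cmod w ^ m * cmod (?G w) \<le> (moment \<alpha> l m * C 1) * ?H w" by (rule gain)
      then have "norm (w ^ m * f w * (cnj (b w) * of_real (?W w))) \<le> (moment \<alpha> l m * C 1) * ?H w"
        by (simp add: norm_mult norm_power mult.assoc)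
      then show "norm (w ^ m * f w * (cnj (b w) * of_real (?W w))) \<le> norm ((moment \<alpha> l m * C 1) * ?H w)"
        by (rule order_trans) (simp only: real_norm_def abs_ge_self)
    qed
  qed
  have term_int: "integrable lborel (?t z m)" 
    and term_eq: "integral\<^sup>L lborel (?t z m) = cnj z ^ m * hankel_coeff \<alpha> l b f m / of_real (moment \<alpha> l m)" for z m
  proof -
    have e: "?t z m = (\<lambda>w. (cnj z ^ m / of_real (moment \<alpha> l m)) * (w ^ m * f w * (cnj (b w) * of_real (?W w))))"
      by (simp add: mult_ac)
    show "integrable lborel (?t z m)" unfolding e by (intro integrable_mult_right int)
    show "integral\<^sup>L lborel (?t z m) = cnj z ^ m * hankel_coeff \<alpha> l b f m / of_real (moment \<alpha> l m)"
      unfolding e hankel_coeff_def integral_mult_right_zero by simp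
  qed
  have lim: "(\<lambda>N. \<Sum>m<N. ?t z m w) \<longlonglongrightarrow> Bergman_kernel \<alpha> l w z * ?G w" for w
    using sums_mult2[OF Bergman_kernel_sums[OF \<alpha> l, of w z], of "?G w"] unfolding sums_def .
  have "(\<lambda>N. \<integral>w. (\<Sum>m<N. ?t z m w) \<partial>lborel) \<longlonglongrightarrow> (\<integral>w. Bergman_kernel \<alpha> l w z * ?G w \<partial>lborel)"
  proof (rule integral_dominated_convergence[where w = "\<lambda>w. C z * ?H w"])
    show "(\<lambda>w. Bergman_kernel \<alpha> l w z * ?G w) \<in> borel_measurable lborel"
      by (rule borel_measurable_LIMSEQ_metric[OF meas lim])
    show "AE w in lborel. (\<lambda>N. \<Sum>m<N. ?t z m w) \<longlonglongrightarrow> Bergman_kernel \<alpha> l w z * ?G w"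
      by (intro AE_I2 lim)
    show "AE w in lborel. cmod (\<Sum>m<N. ?t z m w) \<le> C z * ?H w" for N
      by (intro AE_I2 partial)
    show "integrable lborel (\<lambda>w. C z * ?H w)" by (intro integrable_mult_right Hint)
  qed (rule meas)
  also have "(\<lambda>N. \<integral>w. (\<Sum>m<N. ?t z m w) \<partial>lborel) = (\<lambda>N. \<Sum>m<N. cnj z ^ m * hankel_coeff \<alpha> l b f m / of_real (moment \<alpha> l m))"
    by (subst Bochner_Integration.integral_sum) (simp_all only: term_int term_eq)
  also have "(\<integral>w. Bergman_kernel \<alpha> l w z * ?G w \<partial>lborel) = small_Hankel \<alpha> l b f z"
    unfolding small_Hankel_def by (simp only: mult.assoc)
  finally show "(\<lambda>m. cnj z ^ m * hankel_coeff \<alpha> l b f m / of_real (moment \<alpha> l m)) sums small_Hankel \<alpha> l b f z"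
    unfolding sums_def .
qed

lemma cnj_small_Hankel_entire:
  assumes "entire_series a f" "entire_series \<beta> b" "hankel_admissible \<alpha> l b f"
  shows "entire_series (\<lambda>m. cnj (hankel_coeff \<alpha> l b f m) / of_real (moment \<alpha> l m)) (\<lambda>z. cnj (small_Hankel \<alpha> l b f z))"
  unfolding entire_series_def
proof
  fix z
  have "(\<lambda>m. cnj (cnj z ^ m * hankel_coeff \<alpha> l b f m / of_real (moment \<alpha> l m))) sums cnj (small_Hankel \<alpha> l b f z)"
    using small_Hankel_sums[OF assms, of z] unfolding sums_cnj .
  then show "(\<lambda>m. cnj (hankel_coeff \<alpha> l b f m) / of_real (moment \<alpha> l m) * z ^ m) sums cnj (small_Hankel \<alpha> l b f z)"
    by (simp add: mult_ac)
qed

lemma small_Hankel_norm: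
  assumes "entire_series a f" "entire_series \<beta> b" "hankel_admissible \<alpha> l b f"
  shows "(\<integral>\<^sup>+z. ennreal ((cmod (small_Hankel \<alpha> l b f z))\<^sup>2 * exp (- \<alpha> * cmod z ^ (2 * l))) \<partial>lborel)
     = (\<Sum>m. ennreal ((cmod (hankel_coeff \<alpha> l b f m))\<^sup>2 / moment \<alpha> l m))"
proof -
  have "ennreal ((cmod (cnj c / complex_of_real (moment \<alpha> l m)))\<^sup>2) * ennreal (moment \<alpha> l m) = ennreal ((cmod c)\<^sup>2 / moment \<alpha> l m)" for m c
  proof -
    have "(cmod (cnj c / complex_of_real (moment \<alpha> l m)))\<^sup>2 * moment \<alpha> l m = (cmod c)\<^sup>2 / moment \<alpha> l m"
      using mom_pos[of m] by (simp add: norm_divide power_divide power2_eq_square)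
    then show ?thesis by (simp flip: ennreal_mult')
  qed
  then show ?thesis
    using fw.parseval_entire[OF cnj_small_Hankel_entire[OF assms]] unfolding nn_integral_moment[OF \<alpha> l] by simp
qed

lemma hankel_coeff_monomial:
  assumes b: "entire_series \<beta> b" and H: "hankel_admissible \<alpha> l b (normalized_monomial \<alpha> l n)"
  shows "(cmod (hankel_coeff \<alpha> l b (normalized_monomial \<alpha> l n) m))\<^sup>2 / moment \<alpha> l m = hankel_entry \<alpha> l \<beta> m n"
proof -
  let ?s = "complex_of_real (1 / sqrt (moment \<alpha> l n))"
  let ?g = "\<lambda>w. cnj (b w) * of_real (exp (- \<alpha> * cmod w ^ (2 * l)))"
  have s0: "?s \<noteq> 0" using mom_pos[of n] by simp
  obtain a where a: "entire_series a (normalized_monomial \<alpha> l n)"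
  proof (rule holomorphic_entire_series)
    show "normalized_monomial \<alpha> l n holomorphic_on UNIV"
      unfolding normalized_monomial_def by (intro holomorphic_intros)
  qed
  have e: "(\<lambda>w. w ^ m * normalized_monomial \<alpha> l n w * ?g w) = (\<lambda>w. ?s * (w ^ (m + n) * ?g w))"
    by (simp add: normalized_monomial_def power_add mult_ac)
  have unscale: "integrable lborel h" if "integrable lborel (\<lambda>w. c * h w)" and "c \<noteq> 0" for c :: complex and h :: "complex \<Rightarrow> complex"
    using integrable_mult_right[of "inverse c" lborel "\<lambda>w. c * h w"] that by (simp flip: mult.assoc)
  have "integrable lborel (\<lambda>w. ?s * (w ^ (m + n) * ?g w))"
    using hankel_coeff_integrable[OF a b H, of m] unfolding e .
  then have "integrable lborel (\<lambda>w. w ^ (m + n) * ?g w)"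
    by (rule unscale[OF _ s0])
  then have "hankel_coeff \<alpha> l b (normalized_monomial \<alpha> l n) m = ?s * (cnj (\<beta> (m + n)) * of_real (moment \<alpha> l (m + n)))"
    unfolding hankel_coeff_def e integral_mult_right_zero moment_def
    using moment_integrable[OF \<alpha> l, of "m + n"] by (subst fw.monomial_pairing[OF b]) simp_all
  then show ?thesis
    using mom_pos[of n] mom_pos[of "m + n"]
    by (simp add: hankel_entry_def norm_mult norm_divide power_mult_distrib power_divide less_imp_le)
qed

text \<open>
  On a disc, \<open>hankel_coeff\<close> is a sum of products of Taylor coefficients of \<open>f\<close> and \<open>b\<close>, to which
  Cauchy-Schwarz applies. The bound is uniform in the radius because moments over discs are at
  most the full moments, so it survives the limit.
\<close>

lemma hankel_coeff_bound:
  assumes b: "entire_series \<beta> b" and a: "entire_series a f" and f: "f \<in> Fock \<alpha> l" and H: "hankel_admissible \<alpha> l b f"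
    and q: "summable (hankel_entry \<alpha> l \<beta> m)"
  shows "(cmod (hankel_coeff \<alpha> l b f m))\<^sup>2 / moment \<alpha> l m \<le> (L2_norm \<alpha> l f)\<^sup>2 * (\<Sum>n. hankel_entry \<alpha> l \<beta> m n)"
proof -
  let ?q = "hankel_entry \<alpha> l \<beta> m"
  define Q where "Q = (\<Sum>n. ?q n)"
  have q0: "?q n \<ge> 0" for n using mom_pos[of n] mom_pos[of m] by (simp add: hankel_entry_def)
  have Q0: "Q \<ge> 0" unfolding Q_def using q q0 by (rule suminf_nonneg)
  define B where "B = L2_norm \<alpha> l f * sqrt (moment \<alpha> l m * Q)"
  let ?d = "\<lambda>N k. fw.disk_moment (real N) k"
  have d: "0 \<le> ?d N k" "?d N k \<le> moment \<alpha> l k" for N k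
    unfolding moment_def by (rule fw.disk_moment_nonneg) (intro fw.disk_moment_le moment_integrable[OF \<alpha> l])
  have fin: "(\<Sum>n<M. cmod (a n) * (cmod (\<beta> (m + n)) * ?d N (m + n))) \<le> B" for M N
  proof -
    have "(\<Sum>n<M. cmod (a n) * (cmod (\<beta> (m + n)) * ?d N (m + n)))
       \<le> (\<Sum>n<M. \<bar>cmod (a n) * sqrt (moment \<alpha> l n)\<bar> * \<bar>sqrt (moment \<alpha> l m * ?q n)\<bar>)"
    proof (rule sum_mono)
      fix n
      have mq: "moment \<alpha> l m * ?q n = (cmod (\<beta> (m + n)) * moment \<alpha> l (m + n))\<^sup>2 / moment \<alpha> l n"
        using mom_pos[of m] by (simp add: hankel_entry_def power_mult_distrib field_simps)
      have "cmod (\<beta> (m + n)) * ?d N (m + n) \<le> cmod (\<beta> (m + n)) * moment \<alpha> l (m + n)"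
        using d by (intro mult_left_mono) auto
      also have "\<dots> = sqrt (moment \<alpha> l n) * sqrt (moment \<alpha> l m * ?q n)"
        unfolding mq real_sqrt_mult[symmetric] using mom_pos[of n] mom_pos[of "m + n"] by (simp add: less_imp_le)
      finally have "cmod (a n) * (cmod (\<beta> (m + n)) * ?d N (m + n)) \<le> cmod (a n) * (sqrt (moment \<alpha> l n) * sqrt (moment \<alpha> l m * ?q n))"
        by (intro mult_left_mono) auto
      then show "cmod (a n) * (cmod (\<beta> (m + n)) * ?d N (m + n)) \<le> \<bar>cmod (a n) * sqrt (moment \<alpha> l n)\<bar> * \<bar>sqrt (moment \<alpha> l m * ?q n)\<bar>"
        using mom_pos[of n] mom_pos[of m] q0[of n] by (simp add: abs_mult less_imp_le mult.assoc)
    qed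
    also have "\<dots> \<le> L2_set (\<lambda>n. cmod (a n) * sqrt (moment \<alpha> l n)) {..<M} * L2_set (\<lambda>n. sqrt (moment \<alpha> l m * ?q n)) {..<M}"
      by (rule L2_set_mult_ineq)
    also have "\<dots> \<le> B" unfolding B_def
    proof (rule mult_mono)
      have "(\<Sum>n<M. (cmod (a n) * sqrt (moment \<alpha> l n))\<^sup>2) = (\<Sum>n<M. (cmod (a n))\<^sup>2 * moment \<alpha> l n)"
        using mom_pos by (intro sum.cong refl) (simp add: power_mult_distrib less_imp_le)
      also have "\<dots> \<le> (L2_norm \<alpha> l f)\<^sup>2"
        unfolding sums_unique[OF Fock_norm_series[OF a f]] using Fock_norm_series[OF a f] mom_pos
        by (intro sum_le_suminf) (auto simp: sums_iff less_imp_le)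
      finally show "L2_set (\<lambda>n. cmod (a n) * sqrt (moment \<alpha> l n)) {..<M} \<le> L2_norm \<alpha> l f"
        unfolding L2_set_def using L2_norm_nonneg by (intro real_le_lsqrt) (auto intro: sum_nonneg)
      have "(\<Sum>n<M. (sqrt (moment \<alpha> l m * ?q n))\<^sup>2) = moment \<alpha> l m * (\<Sum>n<M. ?q n)"
        unfolding sum_distrib_left using mom_pos[of m] q0 by (intro sum.cong refl) (simp add: less_imp_le)
      also have "\<dots> \<le> moment \<alpha> l m * Q"
        unfolding Q_def using mom_pos[of m] q q0 by (intro mult_left_mono sum_le_suminf) (auto simp: less_imp_le)
      finally show "L2_set (\<lambda>n. sqrt (moment \<alpha> l m * ?q n)) {..<M} \<le> sqrt (moment \<alpha> l m * Q)"
        unfolding L2_set_def by (rule real_sqrt_le_mono)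
    qed (auto simp: L2_norm_nonneg L2_set_nonneg)
    finally show ?thesis .
  qed
  let ?a = "\<lambda>k. if k < m then 0 else a (k - m)"
  let ?I = "\<lambda>N. CLINT w:cball 0 (real N)|lborel. w ^ m * f w * (cnj (b w) * of_real (exp (- \<alpha> * cmod w ^ (2 * l))))"
  have disk: "cmod (?I N) \<le> B" for N
  proof -
    let ?s = "\<lambda>k. ?a k * cnj (\<beta> k) * of_real (?d N k)"
    have "?s sums ?I N" by (rule fw.disk_pairing[OF entire_series_mult_monomial[OF a] b])
    then have "(\<lambda>n. ?s (n + m)) sums (?I N - (\<Sum>i<m. ?s i))" by (rule sums_split_initial_segment)
    then have "(\<lambda>M. cmod (\<Sum>n<M. ?s (n + m))) \<longlonglongrightarrow> cmod (?I N)" 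
      unfolding sums_def by (intro tendsto_norm) simp
    moreover have "cmod (\<Sum>n<M. ?s (n + m)) \<le> B" for M
    proof -
      have "cmod (\<Sum>n<M. ?s (n + m)) \<le> (\<Sum>n<M. cmod (a n) * (cmod (\<beta> (m + n)) * ?d N (m + n)))"
        using d(1) by (intro sum_norm_le) (simp add: norm_mult add.commute mult.assoc)
      also note fin
      finally show ?thesis .
    qed
    ultimately show ?thesis by (intro LIMSEQ_le_const2) auto
  qed
  have "?I \<longlonglongrightarrow> hankel_coeff \<alpha> l b f m"
    unfolding hankel_coeff_def by (intro fw.disk_integral_tendsto hankel_coeff_integrable[OF a b H])
  from tendsto_norm[OF this] have "cmod (hankel_coeff \<alpha> l b f m) \<le> B"
    using disk by (intro LIMSEQ_le_const2) auto
  then have "(cmod (hankel_coeff \<alpha> l b f m))\<^sup>2 \<le> B\<^sup>2" by (intro power_mono) auto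
  also have "B\<^sup>2 = (L2_norm \<alpha> l f)\<^sup>2 * Q * moment \<alpha> l m"
    using Q0 mom_pos[of m] by (simp add: B_def power_mult_distrib less_imp_le)
  finally show ?thesis using mom_pos[of m] by (simp add: Q_def divide_le_eq)
qed


text \<open>
  Regrouping by \<open>k = m + n\<close>: the coefficient \<open>\<beta> k\<close> occurs on the whole antidiagonal.
\<close>

lemma hankel_entries_total:
  "(\<Sum>m. \<Sum>n. ennreal (hankel_entry \<alpha> l \<beta> m n))
     = (\<Sum>k. ennreal ((cmod (\<beta> k))\<^sup>2) * ennreal (hankel_coeff_weight \<alpha> l k))"
proof -
  have q0: "hankel_entry \<alpha> l \<beta> m n \<ge> 0" for m n
    using mom_pos[of n] mom_pos[of m] by (simp add: hankel_entry_def)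
  have "(\<Sum>m\<le>k. ennreal (hankel_entry \<alpha> l \<beta> m (k - m))) = ennreal ((cmod (\<beta> k))\<^sup>2) * ennreal (hankel_coeff_weight \<alpha> l k)" for k
  proof -
    have "(\<Sum>m\<le>k. hankel_entry \<alpha> l \<beta> m (k - m)) = (cmod (\<beta> k))\<^sup>2 * hankel_coeff_weight \<alpha> l k"
      unfolding hankel_coeff_weight_def sum_distrib_left
      by (intro sum.cong refl) (simp add: hankel_entry_def)
    then show ?thesis using q0 by (simp add: sum_ennreal ennreal_mult')
  qed
  then show ?thesis by (subst ennreal_suminf_diagonals) simp
qed

lemma Fock_Delta_integrand:
  "(cmod (b z * of_real (exp (- (\<alpha> / 2 / 2) * cmod z ^ (2 * l)))))\<^sup>2 * (1 + cmod z) ^ (2 * (l - 1))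
     = (cmod (b z))\<^sup>2 * delta_weight (\<alpha> / 2) l (cmod z)"
proof -
  have "(exp (- (\<alpha> / 2 / 2) * cmod z ^ (2 * l)))\<^sup>2 = exp (- (\<alpha> / 2) * cmod z ^ (2 * l))"
    unfolding exp_double[symmetric] by (intro arg_cong[where f = exp]) simp
  then show ?thesis by (simp only: delta_weight_def norm_mult norm_of_real abs_exp_cancel power_mult_distrib mult.assoc)
qed

lemma Fock_Delta_iff:
  assumes b: "entire_series \<beta> b"
  shows "b \<in> Fock_Delta (\<alpha> / 2) l \<longleftrightarrow>
     (\<integral>\<^sup>+z. ennreal ((cmod (b z))\<^sup>2 * delta_weight (\<alpha> / 2) l (cmod z)) \<partial>lborel) < \<infinity>"
proof -
  note [measurable] = entire_series_borel[OF b]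
  show ?thesis
    unfolding Fock_Delta_def mem_Collect_eq Fock_Delta_integrand
    using entire_series_holomorphic[OF b]
    by (subst integrable_iff_bounded) (simp add: dw.nonneg)
qed

lemma Fock_Delta_norm_square:
  assumes b: "b \<in> Fock_Delta (\<alpha> / 2) l"
  shows "ennreal ((Fock_Delta_norm (\<alpha> / 2) l b)\<^sup>2) =
     (\<integral>\<^sup>+z. ennreal ((cmod (b z))\<^sup>2 * delta_weight (\<alpha> / 2) l (cmod z)) \<partial>lborel)"
proof -
  have int: "integrable lborel (\<lambda>z. (cmod (b z))\<^sup>2 * delta_weight (\<alpha> / 2) l (cmod z))"
    using b unfolding Fock_Delta_def mem_Collect_eq Fock_Delta_integrand by blast
  have "(Fock_Delta_norm (\<alpha> / 2) l b)\<^sup>2 = (\<integral>z. (cmod (b z))\<^sup>2 * delta_weight (\<alpha> / 2) l (cmod z) \<partial>lborel)"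
    unfolding Fock_Delta_norm_def Fock_Delta_integrand
    by (intro real_sqrt_pow2 integral_nonneg_AE AE_I2) (simp add: dw.nonneg)
  then show ?thesis using int by (simp add: nn_integral_eq_integral dw.nonneg)
qed

lemma hankel_total_comparable:
  shows "\<exists>C>0. \<forall>\<beta> b. entire_series \<beta> b \<longrightarrow> (\<Sum>m. \<Sum>n. ennreal (hankel_entry \<alpha> l \<beta> m n))
       \<le> ennreal C * (\<integral>\<^sup>+z. ennreal ((cmod (b z))\<^sup>2 * delta_weight (\<alpha> / 2) l (cmod z)) \<partial>lborel)"
    and "\<exists>C>0. \<forall>\<beta> b. entire_series \<beta> b \<longrightarrow>
       (\<integral>\<^sup>+z. ennreal ((cmod (b z))\<^sup>2 * delta_weight (\<alpha> / 2) l (cmod z)) \<partial>lborel)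
       \<le> ennreal C * (\<Sum>m. \<Sum>n. ennreal (hankel_entry \<alpha> l \<beta> m n))"
proof -
  let ?D = "\<lambda>k. \<integral>\<^sup>+z. ennreal (cmod z ^ (2 * k) * delta_weight (\<alpha> / 2) l (cmod z)) \<partial>lborel"
  have mono: "(\<Sum>k. ennreal ((cmod (\<beta> k))\<^sup>2) * F k) \<le> c * (\<Sum>k. ennreal ((cmod (\<beta> k))\<^sup>2) * G k)"
    if "\<And>k. F k \<le> c * G k" for F G :: "nat \<Rightarrow> ennreal" and c and \<beta> :: "nat \<Rightarrow> complex"
  proof -
    have "ennreal ((cmod (\<beta> k))\<^sup>2) * F k \<le> c * (ennreal ((cmod (\<beta> k))\<^sup>2) * G k)" for k
      using mult_left_mono[OF that[of k], of "ennreal ((cmod (\<beta> k))\<^sup>2)"] by (simp add: mult.left_commute)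
    then show ?thesis unfolding ennreal_suminf_cmult[symmetric] by (intro suminf_le) auto
  qed
  from hankel_coeff_weight_comparable(1)[OF \<alpha> l] obtain C1
    where C1: "C1 > 0" "\<And>k. ennreal (hankel_coeff_weight \<alpha> l k) \<le> ennreal C1 * ?D k" by blast
  from hankel_coeff_weight_comparable(2)[OF \<alpha> l] obtain C2
    where C2: "C2 > 0" "\<And>k. ?D k \<le> ennreal C2 * ennreal (hankel_coeff_weight \<alpha> l k)" by blast
  have "(\<Sum>m. \<Sum>n. ennreal (hankel_entry \<alpha> l \<beta> m n))
       \<le> ennreal C1 * (\<integral>\<^sup>+z. ennreal ((cmod (b z))\<^sup>2 * delta_weight (\<alpha> / 2) l (cmod z)) \<partial>lborel)"
    if "entire_series \<beta> b" for \<beta> b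
    unfolding hankel_entries_total dw.parseval_entire[OF that] by (rule mono[OF C1(2)])
  then show "\<exists>C>0. \<forall>\<beta> b. entire_series \<beta> b \<longrightarrow> (\<Sum>m. \<Sum>n. ennreal (hankel_entry \<alpha> l \<beta> m n))
       \<le> ennreal C * (\<integral>\<^sup>+z. ennreal ((cmod (b z))\<^sup>2 * delta_weight (\<alpha> / 2) l (cmod z)) \<partial>lborel)"
    using C1(1) by blast
  have "(\<integral>\<^sup>+z. ennreal ((cmod (b z))\<^sup>2 * delta_weight (\<alpha> / 2) l (cmod z)) \<partial>lborel)
       \<le> ennreal C2 * (\<Sum>m. \<Sum>n. ennreal (hankel_entry \<alpha> l \<beta> m n))"
    if "entire_series \<beta> b" for \<beta> b
    unfolding hankel_entries_total dw.parseval_entire[OF that] by (rule mono[OF C2(2)])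
  then show "\<exists>C>0. \<forall>\<beta> b. entire_series \<beta> b \<longrightarrow>
       (\<integral>\<^sup>+z. ennreal ((cmod (b z))\<^sup>2 * delta_weight (\<alpha> / 2) l (cmod z)) \<partial>lborel)
       \<le> ennreal C * (\<Sum>m. \<Sum>n. ennreal (hankel_entry \<alpha> l \<beta> m n))"
    using C2(1) by blast
qed

text \<open>
  The growth of \<open>b\<close> uses up \<open>\<alpha> / 2\<close> of the exponent \<open>3 / 4 * \<alpha>\<close>; what is left dominates the
  polynomial factors.
\<close>

lemma H_infty_admissible:
  assumes b: "b \<in> H_infty \<alpha> l"
  shows "hankel_admissible \<alpha> l b (normalized_monomial \<alpha> l n)"
proof -
  obtain C where C: "\<And>z. cmod (b z) \<le> C * ((1 + cmod z) ^ (2 * l - 2) * exp (\<alpha> * cmod z ^ (2 * l) / 2))"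
    using b by (auto simp: H_infty_def)
  have bc: "continuous_on UNIV b" using b by (auto simp: H_infty_def intro: holomorphic_on_imp_continuous_on)
  define s where "s = cmod (of_real (1 / sqrt (moment \<alpha> l n)))"
  define N where "N = 2 * l - 2 + n"
  let ?e = "\<lambda>z. exp (- (\<alpha> / 4) * cmod z ^ (2 * l))"
  have a4: "\<alpha> / 4 > 0" using \<alpha> by simp
  have majorant: "integrable lborel (\<lambda>z. (s * C * 2 ^ N) * (cmod z ^ (2 * 0) * ?e z + cmod z ^ (2 * N) * ?e z))"
    by (intro integrable_mult_right Bochner_Integration.integrable_add moment_integrable[OF a4 l])
  have "continuous_on UNIV (\<lambda>z. cmod (normalized_monomial \<alpha> l n z) * cmod (b z) * exp (- (3 / 4 * \<alpha>) * cmod z ^ (2 * l)))"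
    unfolding normalized_monomial_def by (intro continuous_intros bc)
  then have meas: "(\<lambda>z. cmod (normalized_monomial \<alpha> l n z) * cmod (b z) * exp (- (3 / 4 * \<alpha>) * cmod z ^ (2 * l))) \<in> borel_measurable lborel"
    using borel_measurable_continuous_onI by simp
  have C0: "C \<ge> 0" using C[of 0] order_trans[OF norm_ge_zero[of "b 0"]] l by (simp add: power_0_left)
  have bound: "AE z in lborel. norm (cmod (normalized_monomial \<alpha> l n z) * cmod (b z) * exp (- (3 / 4 * \<alpha>) * cmod z ^ (2 * l)))
     \<le> norm ((s * C * 2 ^ N) * (cmod z ^ (2 * 0) * ?e z + cmod z ^ (2 * N) * ?e z))"
  proof (rule AE_I2)
    fix z :: complex
    let ?r = "cmod z"
    have "?r ^ n * (1 + ?r) ^ (2 * l - 2) \<le> (1 + ?r) ^ n * (1 + ?r) ^ (2 * l - 2)"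
      by (intro mult_right_mono power_mono) auto
    also have "\<dots> = (1 + ?r) ^ N" by (simp add: N_def power_add mult.commute)
    also have "\<dots> \<le> 2 ^ N * (1 + ?r ^ (2 * N))"
    proof (cases "?r \<le> 1")
      case True
      have "(1 + ?r) ^ N \<le> 2 ^ N * 1" using True by (simp add: power_mono)
      also have "\<dots> \<le> 2 ^ N * (1 + ?r ^ (2 * N))" by (intro mult_left_mono) auto
      finally show ?thesis .
    next
      case False
      have "(1 + ?r) ^ N \<le> (2 * ?r) ^ N" using False by (intro power_mono) auto
      also have "\<dots> = 2 ^ N * ?r ^ N" by (rule power_mult_distrib)
      also have "?r ^ N \<le> 1 + ?r ^ (2 * N)"
      proof -
        have "?r ^ N \<le> ?r ^ (2 * N)" using False by (intro power_increasing) auto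
        then show ?thesis by linarith
      qed
      finally show ?thesis by simp
    qed
    finally have poly: "?r ^ n * (1 + ?r) ^ (2 * l - 2) \<le> 2 ^ N * (1 + ?r ^ (2 * N))" .
    have e: "exp (\<alpha> * ?r ^ (2 * l) / 2) * exp (- (3 / 4 * \<alpha>) * ?r ^ (2 * l)) = ?e z"
      unfolding exp_add[symmetric] by (intro arg_cong[where f = exp]) (simp add: algebra_simps)
    have "cmod (normalized_monomial \<alpha> l n z) * cmod (b z) * exp (- (3 / 4 * \<alpha>) * ?r ^ (2 * l))
       \<le> (s * ?r ^ n) * (C * ((1 + ?r) ^ (2 * l - 2) * exp (\<alpha> * ?r ^ (2 * l) / 2))) * exp (- (3 / 4 * \<alpha>) * ?r ^ (2 * l))"
    proof -
      have "cmod (normalized_monomial \<alpha> l n z) = s * ?r ^ n"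
        by (simp only: normalized_monomial_def norm_mult norm_power s_def)
      moreover have "s \<ge> 0" unfolding s_def by (rule norm_ge_zero)
      ultimately show ?thesis using C[of z] by (intro mult_right_mono mult_mono) auto
    qed
    also have "\<dots> = (s * C) * ((?r ^ n * (1 + ?r) ^ (2 * l - 2)) * (exp (\<alpha> * ?r ^ (2 * l) / 2) * exp (- (3 / 4 * \<alpha>) * ?r ^ (2 * l))))"
      by (simp only: mult_ac)
    also have "\<dots> \<le> (s * C) * ((2 ^ N * (1 + ?r ^ (2 * N))) * ?e z)"
      unfolding e using poly C0 by (intro mult_left_mono mult_right_mono) (auto simp: s_def)
    also have "\<dots> = (s * C * 2 ^ N) * (?r ^ (2 * 0) * ?e z + ?r ^ (2 * N) * ?e z)"
      by (simp add: algebra_simps)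
    finally show "norm (cmod (normalized_monomial \<alpha> l n z) * cmod (b z) * exp (- (3 / 4 * \<alpha>) * ?r ^ (2 * l)))
       \<le> norm ((s * C * 2 ^ N) * (?r ^ (2 * 0) * ?e z + ?r ^ (2 * N) * ?e z))"
      unfolding real_norm_def abs_mult abs_norm_cancel abs_exp_cancel
      using abs_ge_self order_trans unfolding abs_mult[symmetric] by blast
  qed
  show ?thesis
    unfolding hankel_admissible_def by (rule Bochner_Integration.integrable_bound[OF majorant meas bound])
qed

text \<open>
  The exponent \<open>3 / 4 * \<alpha>\<close> splits as \<open>\<alpha> / 2 + \<alpha> / 4\<close>, the amounts that make \<open>f\<close> and \<open>b\<close> square
  integrable.
\<close>

lemma Fock_Delta_admissible:
  assumes b: "b \<in> Fock_Delta (\<alpha> / 2) l" and f: "f \<in> Fock \<alpha> l"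
  shows "hankel_admissible \<alpha> l b f"
  unfolding hankel_admissible_def
proof (rule Bochner_Integration.integrable_bound)
  have bc: "continuous_on UNIV b" using b by (auto simp: Fock_Delta_def intro: holomorphic_on_imp_continuous_on)
  have fc: "continuous_on UNIV f" using f by (auto simp: Fock_def intro: holomorphic_on_imp_continuous_on)
  let ?F = "\<lambda>z. (cmod (f z))\<^sup>2 * exp (- \<alpha> * cmod z ^ (2 * l))" and ?B = "\<lambda>z. (cmod (b z))\<^sup>2 * delta_weight (\<alpha> / 2) l (cmod z)"
  have "integrable lborel ?B"
    using b unfolding Fock_Delta_def mem_Collect_eq Fock_Delta_integrand by blast
  then show "integrable lborel (\<lambda>z. ?F z + ?B z)"
    using L2_spaceD(2)[OF Fock_L2[OF f]] by (intro Bochner_Integration.integrable_add)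
  have "continuous_on UNIV (\<lambda>z. cmod (f z) * cmod (b z) * exp (- (3 / 4 * \<alpha>) * cmod z ^ (2 * l)))"
    by (intro continuous_intros bc fc)
  then show "(\<lambda>z. cmod (f z) * cmod (b z) * exp (- (3 / 4 * \<alpha>) * cmod z ^ (2 * l))) \<in> borel_measurable lborel"
    using borel_measurable_continuous_onI by simp
  show "AE z in lborel. norm (cmod (f z) * cmod (b z) * exp (- (3 / 4 * \<alpha>) * cmod z ^ (2 * l))) \<le> norm (?F z + ?B z)"
  proof (rule AE_I2)
    fix z :: complex
    define x where "x = \<alpha> * cmod z ^ (2 * l)"
    define p where "p = cmod (f z) * exp (- x / 2)"
    define q where "q = cmod (b z) * exp (- x / 4)"
    have pq: "cmod (f z) * cmod (b z) * exp (- (3 / 4 * \<alpha>) * cmod z ^ (2 * l)) = p * q"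
    proof -
      have "exp (- (3 / 4 * \<alpha>) * cmod z ^ (2 * l)) = exp (- x / 2) * exp (- x / 4)"
        unfolding exp_add[symmetric] x_def by (intro arg_cong[where f = exp]) (simp add: algebra_simps)
      then show ?thesis by (simp add: p_def q_def)
    qed
    have "p\<^sup>2 = ?F z"
    proof -
      have "(exp (- x / 2))\<^sup>2 = exp (- \<alpha> * cmod z ^ (2 * l))"
        unfolding exp_double[symmetric] x_def by (intro arg_cong[where f = exp]) simp
      then show ?thesis by (simp only: p_def power_mult_distrib)
    qed
    moreover have "q\<^sup>2 \<le> ?B z"
    proof -
      have e: "(exp (- x / 4))\<^sup>2 = exp (- (\<alpha> / 2) * cmod z ^ (2 * l))"
        unfolding exp_double[symmetric] x_def by (intro arg_cong[where f = exp]) simp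
      have "exp (- (\<alpha> / 2) * cmod z ^ (2 * l)) * 1 \<le> exp (- (\<alpha> / 2) * cmod z ^ (2 * l)) * (1 + cmod z) ^ (2 * (l - 1))"
        by (intro mult_left_mono one_le_power) auto
      then have "(exp (- x / 4))\<^sup>2 \<le> delta_weight (\<alpha> / 2) l (cmod z)"
        unfolding e by (simp only: delta_weight_def mult_1_right)
      then show ?thesis unfolding q_def power_mult_distrib by (intro mult_left_mono) auto
    qed
    moreover have "p * q \<le> p\<^sup>2 + q\<^sup>2"
    proof -
      have "0 \<le> p * q" by (simp add: p_def q_def)
      then show ?thesis using zero_le_power2[of "p - q"] unfolding power2_diff by linarith
    qed
    ultimately have "p * q \<le> ?F z + ?B z" by linarith
    moreover have "0 \<le> p * q" by (simp add: p_def q_def)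
    ultimately show "norm (cmod (f z) * cmod (b z) * exp (- (3 / 4 * \<alpha>) * cmod z ^ (2 * l))) \<le> norm (?F z + ?B z)"
      unfolding pq real_norm_def by linarith
  qed
qed

text \<open>
  Membership in \<open>L2_space\<close> is an assumption because \<open>L2_norm\<close> takes the value 0 on functions
  that are not square integrable.
\<close>

lemma small_Hankel_basis_sum:
  assumes b: "entire_series \<beta> b"
    and H: "\<And>n. hankel_admissible \<alpha> l b (normalized_monomial \<alpha> l n)"
    and L: "\<And>n. small_Hankel \<alpha> l b (normalized_monomial \<alpha> l n) \<in> L2_space \<alpha> l"
  shows "(\<Sum>n. ennreal ((L2_norm \<alpha> l (small_Hankel \<alpha> l b (normalized_monomial \<alpha> l n)))\<^sup>2))
     = (\<Sum>m. \<Sum>n. ennreal (hankel_entry \<alpha> l \<beta> m n))"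
proof -
  have "ennreal ((L2_norm \<alpha> l (small_Hankel \<alpha> l b (normalized_monomial \<alpha> l n)))\<^sup>2) = (\<Sum>m. ennreal (hankel_entry \<alpha> l \<beta> m n))" for n
  proof -
    obtain a where a: "entire_series a (normalized_monomial \<alpha> l n)"
      using Fock_onbD(1)[OF normalized_monomials_onb, of n] by (auto simp: Fock_def elim: holomorphic_entire_series)
    show ?thesis
      unfolding L2_norm_square_nn_integral[OF L] small_Hankel_norm[OF a b H] hankel_coeff_monomial[OF b H] ..
  qed
  then show ?thesis by (simp add: ennreal_suminf_commute[of "\<lambda>m n. ennreal (hankel_entry \<alpha> l \<beta> m n)"])
qed

text \<open>
  For \<open>b\<close> in \<open>Fock_Delta\<close> the integral that defines the operator on the dense subspace converges
  for every \<open>f\<close> in the Fock space, so the operator is its own extension.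
\<close>

lemma small_Hankel_bounded_op:
  assumes b: "entire_series \<beta> b" and bD: "b \<in> Fock_Delta (\<alpha> / 2) l"
    and fin: "(\<Sum>m. \<Sum>n. ennreal (hankel_entry \<alpha> l \<beta> m n)) < \<infinity>"
  shows "Fock_bounded_op \<alpha> l (small_Hankel \<alpha> l b)"
proof -
  let ?T = "small_Hankel \<alpha> l b"
  let ?q = "hankel_entry \<alpha> l \<beta>"
  define X where "X = (\<Sum>m. \<Sum>n. ennreal (?q m n))"
  have q0: "?q m n \<ge> 0" for m n
    using mom_pos[of n] mom_pos[of m] by (simp add: hankel_entry_def)
  have qs: "summable (?q m)" for m
  proof (rule summable_suminf_not_top)
    have "(\<Sum>m'\<in>{m}. \<Sum>n. ennreal (?q m' n)) \<le> X" unfolding X_def by (intro sum_le_suminf) auto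
    then show "(\<Sum>n. ennreal (?q m n)) \<noteq> top" using fin unfolding X_def by (auto simp: top_unique)
  qed (rule q0)
  have norm_le: "(\<integral>\<^sup>+z. ennreal ((cmod (?T f z))\<^sup>2 * exp (- \<alpha> * cmod z ^ (2 * l))) \<partial>lborel) \<le> ennreal ((L2_norm \<alpha> l f)\<^sup>2) * X"
    and ent: "\<exists>c. entire_series c (\<lambda>z. cnj (?T f z))" if f: "f \<in> Fock \<alpha> l" for f
  proof -
    obtain a where a: "entire_series a f" using f by (auto simp: Fock_def elim: holomorphic_entire_series)
    note H = Fock_Delta_admissible[OF bD f]
    show "\<exists>c. entire_series c (\<lambda>z. cnj (?T f z))" using cnj_small_Hankel_entire[OF a b H] by blast
    have "(\<Sum>m. ennreal ((cmod (hankel_coeff \<alpha> l b f m))\<^sup>2 / moment \<alpha> l m)) \<le> (\<Sum>m. ennreal ((L2_norm \<alpha> l f)\<^sup>2) * (\<Sum>n. ennreal (?q m n)))"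
    proof (intro suminf_le allI)
      fix m
      have "ennreal ((cmod (hankel_coeff \<alpha> l b f m))\<^sup>2 / moment \<alpha> l m) \<le> ennreal ((L2_norm \<alpha> l f)\<^sup>2 * (\<Sum>n. ?q m n))"
        by (intro ennreal_leI hankel_coeff_bound[OF b a f H qs])
      also have "\<dots> = ennreal ((L2_norm \<alpha> l f)\<^sup>2) * (\<Sum>n. ennreal (?q m n))"
        using q0 qs by (simp add: ennreal_mult suminf_nonneg suminf_ennreal2)
      finally show "ennreal ((cmod (hankel_coeff \<alpha> l b f m))\<^sup>2 / moment \<alpha> l m) \<le> ennreal ((L2_norm \<alpha> l f)\<^sup>2) * (\<Sum>n. ennreal (?q m n))" .
    qed auto
    then show "(\<integral>\<^sup>+z. ennreal ((cmod (?T f z))\<^sup>2 * exp (- \<alpha> * cmod z ^ (2 * l))) \<partial>lborel) \<le> ennreal ((L2_norm \<alpha> l f)\<^sup>2) * X"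
      unfolding small_Hankel_norm[OF a b H] X_def by simp
  qed
  have mem: "?T f \<in> cnj_Fock \<alpha> l" if f: "f \<in> Fock \<alpha> l" for f
  proof -
    obtain c where c: "entire_series c (\<lambda>z. cnj (?T f z))" using ent[OF f] by blast
    have "ennreal ((L2_norm \<alpha> l f)\<^sup>2) * X < \<infinity>" using fin by (simp add: X_def ennreal_mult_less_top)
    then have "(\<lambda>z. cnj (?T f z)) \<in> L2_space \<alpha> l"
      using norm_le[OF f] entire_series_borel[OF c] by (intro L2_spaceI) (auto intro: le_less_trans)
    then have "(\<lambda>z. cnj (?T f z)) \<in> Fock \<alpha> l" using entire_series_holomorphic[OF c] by (simp add: Fock_def)
    then show ?thesis unfolding cnj_Fock_def by (auto intro!: exI[of _ "\<lambda>z. cnj (?T f z)"])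
  qed
  have add: "?T (\<lambda>z. f z + g z) = (\<lambda>z. ?T f z + ?T g z)" if f: "f \<in> Fock \<alpha> l" and g: "g \<in> Fock \<alpha> l" for f g
  proof
    fix z
    have fg: "(\<lambda>z. f z + g z) \<in> Fock \<alpha> l" using f g by (rule Fock_add)
    obtain a where a: "entire_series a f" using f by (auto simp: Fock_def elim: holomorphic_entire_series)
    obtain a' where a': "entire_series a' g" using g by (auto simp: Fock_def elim: holomorphic_entire_series)
    obtain a'' where a'': "entire_series a'' (\<lambda>z. f z + g z)" using fg by (auto simp: Fock_def elim: holomorphic_entire_series)
    note Hf = Fock_Delta_admissible[OF bD f] and Hg = Fock_Delta_admissible[OF bD g] and Hfg = Fock_Delta_admissible[OF bD fg]
    have c: "hankel_coeff \<alpha> l b (\<lambda>z. f z + g z) m = hankel_coeff \<alpha> l b f m + hankel_coeff \<alpha> l b g m" for m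
      unfolding hankel_coeff_def
      using Bochner_Integration.integral_add[OF hankel_coeff_integrable[OF a b Hf, of m] hankel_coeff_integrable[OF a' b Hg, of m]]
      by (simp only: distrib_left distrib_right)
    have "(\<lambda>m. cnj z ^ m * hankel_coeff \<alpha> l b f m / of_real (moment \<alpha> l m) + cnj z ^ m * hankel_coeff \<alpha> l b g m / of_real (moment \<alpha> l m))
       sums (?T f z + ?T g z)"
      by (intro sums_add small_Hankel_sums[OF a b Hf] small_Hankel_sums[OF a' b Hg])
    then have "(\<lambda>m. cnj z ^ m * hankel_coeff \<alpha> l b (\<lambda>z. f z + g z) m / of_real (moment \<alpha> l m)) sums (?T f z + ?T g z)"
      by (simp only: c distrib_left add_divide_distrib)
    with small_Hankel_sums[OF a'' b Hfg, of z] show "?T (\<lambda>z. f z + g z) z = ?T f z + ?T g z"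
      by (rule sums_unique2)
  qed
  have scale: "?T (\<lambda>z. c * f z) = (\<lambda>z. c * ?T f z)" for c f
  proof
    fix z
    have "(\<lambda>w. Bergman_kernel \<alpha> l w z * (c * f w) * cnj (b w) * of_real (exp (- \<alpha> * cmod w ^ (2 * l))))
       = (\<lambda>w. c * (Bergman_kernel \<alpha> l w z * f w * cnj (b w) * of_real (exp (- \<alpha> * cmod w ^ (2 * l)))))"
      by (simp only: mult_ac)
    then show "?T (\<lambda>z. c * f z) z = c * ?T f z"
      unfolding small_Hankel_def by (simp only: integral_mult_right_zero)
  qed
  obtain x where x: "x \<ge> 0" "X = ennreal x" using fin unfolding X_def[symmetric] by (cases X) auto
  have bd: "L2_norm \<alpha> l (?T f) \<le> sqrt x * L2_norm \<alpha> l f" if f: "f \<in> Fock \<alpha> l" for f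
  proof -
    have "ennreal ((L2_norm \<alpha> l (?T f))\<^sup>2) \<le> ennreal ((L2_norm \<alpha> l f)\<^sup>2 * x)"
      using norm_le[OF f] unfolding L2_norm_square_nn_integral[OF cnj_Fock_L2[OF mem[OF f]]] x(2)
      by (simp add: ennreal_mult x(1))
    then have "(L2_norm \<alpha> l (?T f))\<^sup>2 \<le> (L2_norm \<alpha> l f)\<^sup>2 * x"
      using x(1) by (subst (asm) ennreal_le_iff) auto
    also have "\<dots> = (sqrt x * L2_norm \<alpha> l f)\<^sup>2" using x(1) by (simp add: power_mult_distrib)
    finally show ?thesis by (rule power2_le_imp_le) (simp add: x(1) L2_norm_nonneg)
  qed
  show ?thesis
    unfolding Fock_bounded_op_def using mem add scale bd by blast
qed

text \<open>
  Any extension agrees with the integral formula on monomials, so its Hilbert-Schmidt sum in the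
  monomial basis is the sum of the matrix entries. In the other direction the integral formula
  itself serves as the extension.
\<close>

lemma
  assumes b: "entire_series \<beta> b" and bH: "b \<in> H_infty \<alpha> l"
  shows S2_norm_square_small_Hankel: "small_Hankel \<alpha> l b \<in> S2_class \<alpha> l \<Longrightarrow>
       ennreal ((S2_norm \<alpha> l (small_Hankel \<alpha> l b))\<^sup>2) = (\<Sum>m. \<Sum>n. ennreal (hankel_entry \<alpha> l \<beta> m n))"
    and S2_norm_small_Hankel_nonneg: "small_Hankel \<alpha> l b \<in> S2_class \<alpha> l \<Longrightarrow> S2_norm \<alpha> l (small_Hankel \<alpha> l b) \<ge> 0"
    and small_Hankel_in_S2_class: "b \<in> Fock_Delta (\<alpha> / 2) l \<Longrightarrow> (\<Sum>m. \<Sum>n. ennreal (hankel_entry \<alpha> l \<beta> m n)) < \<infinity> \<Longrightarrow>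
       small_Hankel \<alpha> l b \<in> S2_class \<alpha> l"
proof -
  let ?h = "small_Hankel \<alpha> l b" and ?u = "normalized_monomial \<alpha> l"
  note onb = normalized_monomials_onb
  note H = H_infty_admissible[OF bH]
  {
    define T where "T = (SOME T. S2_extension \<alpha> l ?h T)"
    assume "?h \<in> S2_class \<alpha> l"
    then have "\<exists>T. S2_extension \<alpha> l ?h T" by (simp add: S2_class_def)
    then have T: "S2_extension \<alpha> l ?h T" unfolding T_def by (rule someI_ex)
    have hs: "hilbert_schmidt \<alpha> l T" and ext: "\<And>f. f \<in> E_space l \<Longrightarrow> T f = ?h f"
      using T unfolding S2_extension_def by auto
    have Tu: "T (?u n) = ?h (?u n)" for n
      unfolding normalized_monomial_def by (intro ext monomial_in_E_space l)
    have L: "?h (?u n) \<in> L2_space \<alpha> l" for n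
      using hs Fock_onbD(1)[OF onb, of n] unfolding Tu[symmetric] hilbert_schmidt_def Fock_bounded_op_def
      by (blast intro: cnj_Fock_L2)
    have s: "summable (\<lambda>n. (L2_norm \<alpha> l (?h (?u n)))\<^sup>2)"
      using hilbert_schmidt_in_basis(1)[OF hs onb] by (simp only: Tu)
    have "S2_norm \<alpha> l ?h = sqrt (\<Sum>n. (L2_norm \<alpha> l (?h (?u n)))\<^sup>2)"
      unfolding S2_norm_def T_def[symmetric] hilbert_schmidt_in_basis(2)[OF hs onb] Tu ..
    then show "S2_norm \<alpha> l ?h \<ge> 0" using s by (simp add: suminf_nonneg)
    from \<open>S2_norm \<alpha> l ?h = _\<close> have "(S2_norm \<alpha> l ?h)\<^sup>2 = (\<Sum>n. (L2_norm \<alpha> l (?h (?u n)))\<^sup>2)"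
      using s by (simp add: suminf_nonneg)
    then show "ennreal ((S2_norm \<alpha> l ?h)\<^sup>2) = (\<Sum>m. \<Sum>n. ennreal (hankel_entry \<alpha> l \<beta> m n))"
      unfolding small_Hankel_basis_sum[OF b H L, symmetric] using s by (simp add: suminf_ennreal2)
  next
    assume bD: "b \<in> Fock_Delta (\<alpha> / 2) l" and fin: "(\<Sum>m. \<Sum>n. ennreal (hankel_entry \<alpha> l \<beta> m n)) < \<infinity>"
    have op: "Fock_bounded_op \<alpha> l ?h" by (rule small_Hankel_bounded_op[OF b bD fin])
    then have L: "?h (?u n) \<in> L2_space \<alpha> l" for n
      using Fock_onbD(1)[OF onb, of n] unfolding Fock_bounded_op_def by (blast intro: cnj_Fock_L2)
    have "summable (\<lambda>n. (L2_norm \<alpha> l (?h (?u n)))\<^sup>2)"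
      using small_Hankel_basis_sum[OF b H L] fin by (intro summable_suminf_not_top) auto
    then have "hilbert_schmidt \<alpha> l ?h" unfolding hilbert_schmidt_def using op onb by blast
    then show "?h \<in> S2_class \<alpha> l" unfolding S2_class_def S2_extension_def by blast
  }
qed

end

theorem theorem1p4:
  fixes \<alpha> :: real and l :: nat
  assumes "\<alpha> > 0" and "l \<ge> 1"
  shows "(\<forall>b\<in>H_infty \<alpha> l.
            small_Hankel \<alpha> l b \<in> S2_class \<alpha> l \<longleftrightarrow> b \<in> Fock_Delta (\<alpha> / 2) l) \<and>
         (\<exists>C>0. \<forall>b\<in>H_infty \<alpha> l. small_Hankel \<alpha> l b \<in> S2_class \<alpha> l \<longrightarrow>
            inverse C * Fock_Delta_norm (\<alpha> / 2) l b \<le> S2_norm \<alpha> l (small_Hankel \<alpha> l b) \<and>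
            S2_norm \<alpha> l (small_Hankel \<alpha> l b) \<le> C * Fock_Delta_norm (\<alpha> / 2) l b)"
proof -
  let ?X = "\<lambda>\<beta>. \<Sum>m. \<Sum>n. ennreal (hankel_entry \<alpha> l \<beta> m n)"
  let ?Y = "\<lambda>b. \<integral>\<^sup>+z. ennreal ((cmod (b z))\<^sup>2 * delta_weight (\<alpha> / 2) l (cmod z)) \<partial>lborel"
  let ?S = "\<lambda>b. S2_norm \<alpha> l (small_Hankel \<alpha> l b)" and ?N = "\<lambda>b. Fock_Delta_norm (\<alpha> / 2) l b"
  obtain C1 where C1: "C1 > 0" "\<And>\<beta> b. entire_series \<beta> b \<Longrightarrow> ?X \<beta> \<le> ennreal C1 * ?Y b"
    using hankel_total_comparable(1)[OF assms] by blast
  obtain C2 where C2: "C2 > 0" "\<And>\<beta> b. entire_series \<beta> b \<Longrightarrow> ?Y b \<le> ennreal C2 * ?X \<beta>"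
    using hankel_total_comparable(2)[OF assms] by blast
  have iff: "small_Hankel \<alpha> l b \<in> S2_class \<alpha> l \<longleftrightarrow> b \<in> Fock_Delta (\<alpha> / 2) l"
    and sq: "small_Hankel \<alpha> l b \<in> S2_class \<alpha> l \<Longrightarrow> (?N b)\<^sup>2 \<le> C2 * (?S b)\<^sup>2 \<and> (?S b)\<^sup>2 \<le> C1 * (?N b)\<^sup>2"
    if bH: "b \<in> H_infty \<alpha> l" for b
  proof -
    obtain \<beta> where b: "entire_series \<beta> b" using bH by (auto simp: H_infty_def elim: holomorphic_entire_series)
    show iff: "small_Hankel \<alpha> l b \<in> S2_class \<alpha> l \<longleftrightarrow> b \<in> Fock_Delta (\<alpha> / 2) l"
    proof
      assume "small_Hankel \<alpha> l b \<in> S2_class \<alpha> l"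
      from S2_norm_square_small_Hankel[OF assms b bH this] have "?X \<beta> < \<infinity>" by (metis ennreal_less_top infinity_ennreal_def)
      then have "ennreal C2 * ?X \<beta> < \<infinity>" by (simp add: ennreal_mult_less_top)
      with C2(2)[OF b] have "?Y b < \<infinity>" by (rule le_less_trans)
      then show "b \<in> Fock_Delta (\<alpha> / 2) l" using Fock_Delta_iff[OF assms b] by simp
    next
      assume bD: "b \<in> Fock_Delta (\<alpha> / 2) l"
      then have "?Y b < \<infinity>" using Fock_Delta_iff[OF assms b] by simp
      then have "ennreal C1 * ?Y b < \<infinity>" by (simp add: ennreal_mult_less_top)
      with C1(2)[OF b] have "?X \<beta> < \<infinity>" by (rule le_less_trans)
      then show "small_Hankel \<alpha> l b \<in> S2_class \<alpha> l" by (rule small_Hankel_in_S2_class[OF assms b bH bD])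
    qed
    assume S2: "small_Hankel \<alpha> l b \<in> S2_class \<alpha> l"
    have X: "?X \<beta> = ennreal ((?S b)\<^sup>2)" using S2_norm_square_small_Hankel[OF assms b bH S2] by simp
    have Y: "?Y b = ennreal ((?N b)\<^sup>2)" using Fock_Delta_norm_square[OF assms] S2 iff by simp
    have "ennreal ((?N b)\<^sup>2) \<le> ennreal (C2 * (?S b)\<^sup>2)" "ennreal ((?S b)\<^sup>2) \<le> ennreal (C1 * (?N b)\<^sup>2)"
      using C1(2)[OF b] C2(2)[OF b] C1(1) C2(1) unfolding X Y by (simp_all add: ennreal_mult)
    then show "(?N b)\<^sup>2 \<le> C2 * (?S b)\<^sup>2 \<and> (?S b)\<^sup>2 \<le> C1 * (?N b)\<^sup>2"
      using C1(1) C2(1) by (simp add: ennreal_le_iff)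
  qed
  define C where "C = max (sqrt C1) (sqrt C2)"
  have C: "C > 0" "sqrt C1 \<le> C" "sqrt C2 \<le> C" using C1(1) by (auto simp: C_def less_max_iff_disj)
  have "inverse C * ?N b \<le> ?S b \<and> ?S b \<le> C * ?N b"
    if bH: "b \<in> H_infty \<alpha> l" and S2: "small_Hankel \<alpha> l b \<in> S2_class \<alpha> l" for b
  proof -
    obtain \<beta> where b: "entire_series \<beta> b" using bH by (auto simp: H_infty_def elim: holomorphic_entire_series)
    have N0: "?N b \<ge> 0" by (simp add: Fock_Delta_norm_def)
    have S0: "?S b \<ge> 0" by (rule S2_norm_small_Hankel_nonneg[OF assms b bH S2])
    have "sqrt ((?N b)\<^sup>2) \<le> sqrt (C2 * (?S b)\<^sup>2)" "sqrt ((?S b)\<^sup>2) \<le> sqrt (C1 * (?N b)\<^sup>2)"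
      using sq[OF bH S2] by (intro real_sqrt_le_mono; blast)+
    then have "?N b \<le> sqrt C2 * ?S b" "?S b \<le> sqrt C1 * ?N b"
      using N0 S0 by (simp_all add: real_sqrt_mult)
    moreover have "sqrt C2 * ?S b \<le> C * ?S b" "sqrt C1 * ?N b \<le> C * ?N b"
      using C N0 S0 by (auto intro: mult_right_mono)
    ultimately have "?N b \<le> C * ?S b" "?S b \<le> C * ?N b" by linarith+
    then show ?thesis using C(1) by (simp add: field_simps)
  qed
  then show ?thesis using iff C(1) by blast
qed

end
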